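(* Let $\mathbb{K}$ be an algebraically closed field with $\operatorname{char}(\mathbb{K}) \neq 2$ and let $X$ be a smooth affine algebraic variety of dimension $n$ over $\mathbb{K}$. Then the bracket width of the Lie algebra $\operatorname{Vec}(X)$ is at most $(n+1)^2$.
   Context: $\operatorname{Vec}(X)$ denotes the Lie algebra over $\mathbb{K}$ of (algebraic) vector fields on $X$, i.e. the $\mathbb{K}$-linear derivations of the coordinate ring $\mathbb{K}[X]$, with the commutator bracket. For a Lie algebra $L$ over a field and $z \in [L,L]$ (the derived algebra), let $\ell(z)$ be the smallest number $m$ such that $z = \sum_{i=1}^m [x_i,y_i]$ for some $x_i,y_i \in L$. The bracket width of $L$ is $\sup\{\ell(z) : z \in [L,L]\}$. *)

theory Defs
  imports
    "HOL-Analysis.Finite_Cartesian_Product"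
    "HOL-Computational_Algebra.Polynomial"
    "HOL-Library.Extended_Nat"
    "HOL-Library.Function_Algebras"
begin

section \<open>Lie algebras and bracket width\<close>

locale lie_algebra = vector_space scale
  for scale :: "'k::field \<Rightarrow> 'v::ab_group_add \<Rightarrow> 'v" +
  fixes L :: "'v set" and bracket :: "'v \<Rightarrow> 'v \<Rightarrow> 'v"
  assumes subspace_L: "subspace L"
    and bracket_closed: "x \<in> L \<Longrightarrow> y \<in> L \<Longrightarrow> bracket x y \<in> L"
    and bracket_add_left:
      "x \<in> L \<Longrightarrow> y \<in> L \<Longrightarrow> z \<in> L \<Longrightarrow> bracket (x + y) z = bracket x z + bracket y z"
    and bracket_add_right:
      "x \<in> L \<Longrightarrow> y \<in> L \<Longrightarrow> z \<in> L \<Longrightarrow> bracket x (y + z) = bracket x y + bracket x z"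
    and bracket_scale_left:
      "x \<in> L \<Longrightarrow> y \<in> L \<Longrightarrow> bracket (scale c x) y = scale c (bracket x y)"
    and bracket_scale_right:
      "x \<in> L \<Longrightarrow> y \<in> L \<Longrightarrow> bracket x (scale c y) = scale c (bracket x y)"
    and bracket_self: "x \<in> L \<Longrightarrow> bracket x x = 0"
    and jacobi: "x \<in> L \<Longrightarrow> y \<in> L \<Longrightarrow> z \<in> L \<Longrightarrow>
      bracket x (bracket y z) + bracket y (bracket z x) + bracket z (bracket x y) = 0"
begin

definition derived_algebra :: "'v set" where
  "derived_algebra = span {bracket x y | x y. x \<in> L \<and> y \<in> L}"

text \<open>On the derived algebra the minimum below is attained: scalars can be absorbed into one
  of the two arguments of a bracket, so elements of the span are finite sums of brackets.\<close>

definition bracket_length :: "'v \<Rightarrow> nat" where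
  "bracket_length z = (LEAST m. \<exists>x y. (\<forall>i<m. x i \<in> L \<and> y i \<in> L) \<and>
     z = (\<Sum>i<m. bracket (x i) (y i)))"

definition bracket_width :: enat where
  "bracket_width = (SUP z\<in>derived_algebra. enat (bracket_length z))"

end


section \<open>Affine varieties in affine space\<close>

text \<open>Points of affine $N$-space over a field are vectors of type \<^typ>\<open>'k^'n\<close>. Polynomials are
  represented by the functions they induce, which loses nothing over an infinite field.\<close>

inductive_set polynomial_functions :: "('k::field^'n \<Rightarrow> 'k) set" where
  const: "(\<lambda>p. c) \<in> polynomial_functions"
| coordinate: "(\<lambda>p. p $ i) \<in> polynomial_functions"
| add: "f \<in> polynomial_functions \<Longrightarrow> g \<in> polynomial_functions \<Longrightarrow>
    (\<lambda>p. f p + g p) \<in> polynomial_functions"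
| mult: "f \<in> polynomial_functions \<Longrightarrow> g \<in> polynomial_functions \<Longrightarrow>
    (\<lambda>p. f p * g p) \<in> polynomial_functions"

definition algebraic_set :: "('k::field^'n) set \<Rightarrow> bool" where
  "algebraic_set X \<longleftrightarrow> (\<exists>S \<subseteq> polynomial_functions. X = {p. \<forall>f\<in>S. f p = 0})"

text \<open>An affine variety is not required to be irreducible.\<close>

definition affine_variety :: "('k::field^'n) set \<Rightarrow> bool" where
  "affine_variety X \<longleftrightarrow> algebraic_set X \<and> X \<noteq> {}"

definition irreducible_algebraic_set :: "('k::field^'n) set \<Rightarrow> bool" where
  "irreducible_algebraic_set Z \<longleftrightarrow> algebraic_set Z \<and> Z \<noteq> {} \<and>
     (\<forall>A B. algebraic_set A \<and> algebraic_set B \<and> Z \<subseteq> A \<union> B \<longrightarrow> Z \<subseteq> A \<or> Z \<subseteq> B)"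

text \<open>The supremum of the lengths $m$ of chains $Z_0 \subset \dots \subset Z_m$ of members of a
  family of sets.\<close>

definition chain_length :: "'a set set \<Rightarrow> enat" where
  "chain_length F = (SUP m\<in>{m::nat. \<exists>Z. (\<forall>i\<le>m. Z i \<in> F) \<and> (\<forall>i<m. Z i \<subset> Z (Suc i))}. enat m)"

definition krull_dimension :: "('k::field^'n) set \<Rightarrow> enat" where
  "krull_dimension X = chain_length {Z. irreducible_algebraic_set Z \<and> Z \<subseteq> X}"

text \<open>The Krull dimension of the local ring of \<open>X\<close> at \<open>p\<close>: its primes correspond to the
  irreducible closed subsets of \<open>X\<close> through \<open>p\<close>.\<close>

definition local_dimension :: "('k::field^'n) set \<Rightarrow> 'k^'n \<Rightarrow> enat" where
  "local_dimension X p = chain_length {Z. irreducible_algebraic_set Z \<and> Z \<subseteq> X \<and> p \<in> Z}"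

text \<open>Elements of the coordinate ring are the restrictions to \<open>X\<close> of polynomial functions,
  extended by \<open>0\<close> outside \<open>X\<close>; the operations are pointwise. In particular the unit of the ring
  is the indicator function of \<open>X\<close>.\<close>

definition coordinate_ring :: "('k::field^'n) set \<Rightarrow> ('k^'n \<Rightarrow> 'k) set" where
  "coordinate_ring X = {\<lambda>p. if p \<in> X then f p else 0 | f. f \<in> polynomial_functions}"

definition scale_fun :: "'k::field \<Rightarrow> ('a \<Rightarrow> 'k) \<Rightarrow> 'a \<Rightarrow> 'k" where
  "scale_fun c f = (\<lambda>x. c * f x)"

text \<open>The Zariski tangent space: the derivations of the coordinate ring with values in the residue
  field at \<open>p\<close>. As above, maps defined on the coordinate ring are extended by \<open>0\<close>.\<close>

definition tangent_space :: "('k::field^'n) set \<Rightarrow> 'k^'n \<Rightarrow> (('k^'n \<Rightarrow> 'k) \<Rightarrow> 'k) set" where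
  "tangent_space X p = {v.
     (\<forall>f. f \<notin> coordinate_ring X \<longrightarrow> v f = 0) \<and>
     (\<forall>f\<in>coordinate_ring X. \<forall>g\<in>coordinate_ring X. v (f + g) = v f + v g) \<and>
     (\<forall>c. \<forall>f\<in>coordinate_ring X. v (scale_fun c f) = c * v f) \<and>
     (\<forall>f\<in>coordinate_ring X. \<forall>g\<in>coordinate_ring X. v (f * g) = f p * v g + g p * v f)}"

text \<open>Regularity of all local rings. The tangent spaces are finite-dimensional, so
  \<^const>\<open>vector_space.dim\<close> is the true dimension here. Components of different dimensions are
  allowed.\<close>

definition smooth_variety :: "('k::field^'n) set \<Rightarrow> bool" where
  "smooth_variety X \<longleftrightarrow>
     (\<forall>p\<in>X. enat (vector_space.dim scale_fun (tangent_space X p)) = local_dimension X p)"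


section \<open>The Lie algebra of vector fields\<close>

definition vector_fields :: "('k::field^'n) set \<Rightarrow> (('k^'n \<Rightarrow> 'k) \<Rightarrow> ('k^'n \<Rightarrow> 'k)) set" where
  "vector_fields X = {D.
     (\<forall>f. f \<notin> coordinate_ring X \<longrightarrow> D f = 0) \<and>
     (\<forall>f\<in>coordinate_ring X. D f \<in> coordinate_ring X) \<and>
     (\<forall>f\<in>coordinate_ring X. \<forall>g\<in>coordinate_ring X. D (f + g) = D f + D g) \<and>
     (\<forall>c. \<forall>f\<in>coordinate_ring X. D (scale_fun c f) = scale_fun c (D f)) \<and>
     (\<forall>f\<in>coordinate_ring X. \<forall>g\<in>coordinate_ring X. D (f * g) = f * D g + g * D f)}"

definition scale_op :: "'k::field \<Rightarrow> ('b \<Rightarrow> 'a \<Rightarrow> 'k) \<Rightarrow> 'b \<Rightarrow> 'a \<Rightarrow> 'k" where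
  "scale_op c D = (\<lambda>f. scale_fun c (D f))"

definition commutator :: "('b \<Rightarrow> 'b) \<Rightarrow> ('b \<Rightarrow> 'b) \<Rightarrow> 'b \<Rightarrow> 'b::ab_group_add" where
  "commutator D E = (\<lambda>f. D (E f) - E (D f))"

lemma vector_space_scale_fun: "vector_space scale_fun"
  by unfold_locales (auto simp: scale_fun_def fun_eq_iff algebra_simps)

lemma vector_space_scale_op: "vector_space scale_op"
  by unfold_locales (auto simp: scale_op_def scale_fun_def fun_eq_iff algebra_simps)

lemma coordinate_ringI:
  "f \<in> polynomial_functions \<Longrightarrow> (\<And>p. g p = (if p \<in> X then f p else 0)) \<Longrightarrow> g \<in> coordinate_ring X"
  unfolding coordinate_ring_def by (auto simp: fun_eq_iff)

lemma coordinate_ringE: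
  assumes "g \<in> coordinate_ring X"
  obtains f where "f \<in> polynomial_functions" "g = (\<lambda>p. if p \<in> X then f p else 0)"
  using assms unfolding coordinate_ring_def by auto

lemma coordinate_ring_0: "0 \<in> coordinate_ring X"
  by (rule coordinate_ringI[OF polynomial_functions.const[of 0]]) auto

lemma coordinate_ring_scale: "f \<in> coordinate_ring X \<Longrightarrow> scale_fun c f \<in> coordinate_ring X"
  by (elim coordinate_ringE,
      rule coordinate_ringI[OF polynomial_functions.mult[OF polynomial_functions.const[of c]]])
    (auto simp: scale_fun_def)

lemma coordinate_ring_add:
  "f \<in> coordinate_ring X \<Longrightarrow> g \<in> coordinate_ring X \<Longrightarrow> f + g \<in> coordinate_ring X"
  by (elim coordinate_ringE, rule coordinate_ringI[OF polynomial_functions.add], assumption+) auto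

lemma coordinate_ring_mult:
  "f \<in> coordinate_ring X \<Longrightarrow> g \<in> coordinate_ring X \<Longrightarrow> f * g \<in> coordinate_ring X"
  by (elim coordinate_ringE, rule coordinate_ringI[OF polynomial_functions.mult], assumption+) auto

lemma coordinate_ring_diff:
  assumes "f \<in> coordinate_ring X" "g \<in> coordinate_ring X"
  shows "f - g \<in> coordinate_ring X"
proof -
  have "f - g = f + scale_fun (- 1) g"
    by (auto simp: scale_fun_def fun_eq_iff)
  then show ?thesis
    using assms coordinate_ring_add coordinate_ring_scale by metis
qed

lemma vector_fieldsD:
  assumes "D \<in> vector_fields X"
  shows "f \<notin> coordinate_ring X \<Longrightarrow> D f = 0"
    and "f \<in> coordinate_ring X \<Longrightarrow> D f \<in> coordinate_ring X"
    and "f \<in> coordinate_ring X \<Longrightarrow> g \<in> coordinate_ring X \<Longrightarrow> D (f + g) = D f + D g"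
    and "f \<in> coordinate_ring X \<Longrightarrow> D (scale_fun c f) = scale_fun c (D f)"
    and "f \<in> coordinate_ring X \<Longrightarrow> g \<in> coordinate_ring X \<Longrightarrow> D (f * g) = f * D g + g * D f"
  using assms unfolding vector_fields_def by blast+

lemma vector_fields_zero:
  assumes "D \<in> vector_fields X"
  shows "D 0 = 0"
  using vector_fieldsD(3)[OF assms coordinate_ring_0[of X] coordinate_ring_0[of X]] by simp

lemma vector_fields_diff:
  assumes "D \<in> vector_fields X" "f \<in> coordinate_ring X" "g \<in> coordinate_ring X"
  shows "D (f - g) = D f - D g"
  using vector_fieldsD(3)[OF assms(1) coordinate_ring_diff[OF assms(2,3)] assms(3)] by simp

lemma vector_fields_closed:
  assumes "D \<in> vector_fields X"
  shows "D f \<in> coordinate_ring X"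
  using vector_fieldsD(1,2)[OF assms] coordinate_ring_0 by metis

lemma commutator_vector_fields:
  assumes D: "D \<in> vector_fields X" and E: "E \<in> vector_fields X"
  shows "commutator D E \<in> vector_fields X"
proof -
  note c = vector_fields_closed[OF D] vector_fields_closed[OF E]
  note d = vector_fieldsD[OF D] and e = vector_fieldsD[OF E]
  have "commutator D E (f * g) = f * commutator D E g + g * commutator D E f"
    if "f \<in> coordinate_ring X" "g \<in> coordinate_ring X" for f g
    using that c by (simp add: commutator_def d(5) e(5) d(3) e(3) coordinate_ring_mult algebra_simps)
  moreover have "commutator D E (scale_fun a f) = scale_fun a (commutator D E f)"
    if "f \<in> coordinate_ring X" for a f
    using that c d(4) e(4)
    by (simp add: commutator_def) (simp add: scale_fun_def fun_eq_iff algebra_simps)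
  moreover have "commutator D E (f + g) = commutator D E f + commutator D E g"
    if "f \<in> coordinate_ring X" "g \<in> coordinate_ring X" for f g
    using that c by (simp add: commutator_def d(3) e(3))
  moreover have "commutator D E f \<in> coordinate_ring X" for f
    using c by (simp add: commutator_def coordinate_ring_diff)
  moreover have "commutator D E f = 0" if "f \<notin> coordinate_ring X" for f
    using that d(1) e(1) vector_fields_zero[OF D] vector_fields_zero[OF E]
    by (simp add: commutator_def)
  ultimately show ?thesis
    unfolding vector_fields_def by blast
qed

lemma subspace_vector_fields: "module.subspace scale_op (vector_fields X)"
proof -
  interpret vector_space "scale_op :: 'a \<Rightarrow> (('a^'b \<Rightarrow> 'a) \<Rightarrow> ('a^'b \<Rightarrow> 'a)) \<Rightarrow> _"
    by (rule vector_space_scale_op)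
  have "D + E \<in> vector_fields X" if D: "D \<in> vector_fields X" and E: "E \<in> vector_fields X" for D E
  proof -
    have "scale_fun a f + scale_fun a g = scale_fun a (f + g)" for a and f g :: "'a^'b \<Rightarrow> 'a"
      by (auto simp: scale_fun_def fun_eq_iff algebra_simps)
    then show ?thesis
      using vector_fieldsD[OF D] vector_fieldsD[OF E]
      unfolding vector_fields_def by (auto simp: algebra_simps coordinate_ring_add)
  qed
  moreover have "scale_op a D \<in> vector_fields X" if D: "D \<in> vector_fields X" for a D
  proof -
    have "scale_fun a (f + g) = scale_fun a f + scale_fun a g"
      "f * scale_fun a g = scale_fun a (f * g)"
      "scale_fun a (scale_fun b f) = scale_fun b (scale_fun a f)"
      "scale_fun a (0 :: 'a^'b \<Rightarrow> 'a) = 0" for b and f g :: "'a^'b \<Rightarrow> 'a"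
      by (auto simp: scale_fun_def fun_eq_iff algebra_simps)
    then show ?thesis
      using vector_fieldsD[OF D]
      unfolding vector_fields_def by (simp add: scale_op_def coordinate_ring_scale)
  qed
  moreover have "0 \<in> vector_fields X"
    using coordinate_ring_0 unfolding vector_fields_def
    by (auto simp: scale_fun_def fun_eq_iff)
  ultimately show ?thesis
    by (intro subspaceI) auto
qed

lemma lie_algebra_vector_fields: "lie_algebra scale_op (vector_fields X) commutator"
proof -
  interpret vector_space "scale_op :: 'a \<Rightarrow> (('a^'b \<Rightarrow> 'a) \<Rightarrow> ('a^'b \<Rightarrow> 'a)) \<Rightarrow> _"
    by (rule vector_space_scale_op)
  show ?thesis
  proof
    fix D E F :: "('a^'b \<Rightarrow> 'a) \<Rightarrow> ('a^'b \<Rightarrow> 'a)" and c :: 'a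
    assume D: "D \<in> vector_fields X"
    show "commutator D D = 0"
      by (auto simp: commutator_def fun_eq_iff)
    assume E: "E \<in> vector_fields X"
    note cl = vector_fields_closed[OF D] vector_fields_closed[OF E]
    note d = vector_fieldsD[OF D] and e = vector_fieldsD[OF E]
    show "commutator D E \<in> vector_fields X"
      by (rule commutator_vector_fields[OF D E])
    show "commutator (scale_op c D) E = scale_op c (commutator D E)"
      using cl e(4) by (simp add: commutator_def scale_op_def fun_eq_iff)
        (simp add: scale_fun_def algebra_simps)
    show "commutator D (scale_op c E) = scale_op c (commutator D E)"
      using cl d(4) by (simp add: commutator_def scale_op_def fun_eq_iff)
        (simp add: scale_fun_def algebra_simps)
    assume F: "F \<in> vector_fields X"
    note cl = cl vector_fields_closed[OF F] and f = vector_fieldsD[OF F]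
    show "commutator (D + E) F = commutator D F + commutator E F"
      using cl f(3) by (simp add: commutator_def fun_eq_iff)
    show "commutator D (E + F) = commutator D E + commutator D F"
      using cl d(3) by (simp add: commutator_def fun_eq_iff)
    show "commutator D (commutator E F) + commutator E (commutator F D)
        + commutator F (commutator D E) = 0"
      using cl vector_fields_diff[OF D] vector_fields_diff[OF E] vector_fields_diff[OF F]
      by (simp add: commutator_def fun_eq_iff)
  qed (rule subspace_vector_fields)
qed

end

theory Submission
  imports Defs "HOL-Analysis.Determinants"
begin

text \<open>For a vector field \<open>D\<close> and functions \<open>a\<close>, \<open>b\<close> one has \<open>2 a D(b) D = [D, a b D] + [a D, b D]\<close>.
  Hence it suffices to find \<open>2 n\<close> fields of the form \<open>D(b) D\<close> that generate the module of all
  vector fields: every vector field is then a sum of \<open>4 n \<le> (n + 1)\<^sup>2\<close> brackets.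

  At a smooth point \<open>p\<close> choose elements \<open>F\<^sub>r\<close> of the ideal of \<open>X\<close> whose gradients cut out the tangent
  space, of dimension \<open>d\<close>. If the \<open>F\<^sub>r\<close> did not generate the ideal near \<open>p\<close>, then modulo the ideal
  of \<open>X\<close> and \<open>d - 1\<close> further functions some power of the maximal ideal \<open>m\<close> at \<open>p\<close> would lie in the
  next one, so the codimension of the ideal of \<open>X\<close> plus \<open>m\<^sup>k\<close> would be \<open>O(k\<^sup>d\<^sup>-\<^sup>1)\<close>. A chain of \<open>d + 1\<close>
  irreducible sets through \<open>p\<close> forces this codimension to grow at least like \<open>k\<^sup>d\<close>, by the Artin-Rees lemma.
  So the \<open>F\<^sub>r\<close> are local equations, and Cramer's rule extends every tangent vector at \<open>p\<close> to
  a vector field on \<open>X\<close>.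

  Fields \<open>D(b) D\<close> are then chosen one after the other, generically on every component of the
  loci where the earlier ones have rank at most \<open>s\<close> but the tangent space has larger dimension. Each choice lowers
  the dimension of these loci, and after \<open>2 n\<close> choices they are empty. The fields span every
  tangent space, hence generate the module locally by Cramer's rule and globally by the
  Nullstellensatz.\<close>

text \<open>Smoothness and dimension are given only as lengths of chains of irreducible sets,
  whereas extending a tangent vector needs equations of \<open>X\<close>. The growth of codimensions
  is the bridge: a chain forces growth from below, a small set of generators bounds it from above,
  and no theory of regular local rings enters. Quotients and localizations are avoided too. A
  quotient is replaced by counting the vectors that must be added to a subspace, a localization by a
  multiplier that is non-zero at the point; such multipliers form an ideal, and the Nullstellensatz
  puts 1 into it at the end. The bracket identity yields multiples of \<open>D(b) D\<close> and not
  of \<open>D\<close>, so the generators must have that form. This costs nothing at finitely many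
  test points, because \<open>b\<close> can be chosen with \<open>D(b)\<close> non-zero there. More
  than \<open>n\<close> generators are used because rank may drop on smaller loci even when it is
  full generically: the bad locus for \<open>s\<close> after \<open>k\<close> choices has dimension
  at most \<open>n + s - k\<close>, and \<open>s\<close> runs up to \<open>n - 1\<close>.\<close>

section \<open>Subrings, ideals and Noetherian rings\<close>

inductive_set lin :: "'a::comm_ring_1 set \<Rightarrow> 'a set \<Rightarrow> 'a set" for C A where
  zero: "0 \<in> lin C A"
| step: "c \<in> C \<Longrightarrow> a \<in> A \<Longrightarrow> x \<in> lin C A \<Longrightarrow> c * a + x \<in> lin C A"

definition is_subring :: "'a::comm_ring_1 set \<Rightarrow> bool" where
  "is_subring R \<longleftrightarrow> 1 \<in> R \<and> (\<forall>x\<in>R. \<forall>y\<in>R. x - y \<in> R \<and> x * y \<in> R)"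

definition is_ideal :: "'a::comm_ring_1 set \<Rightarrow> 'a set \<Rightarrow> bool" where
  "is_ideal R I \<longleftrightarrow> 0 \<in> I \<and> I \<subseteq> R \<and> (\<forall>x\<in>I. \<forall>y\<in>I. x + y \<in> I) \<and> (\<forall>r\<in>R. \<forall>x\<in>I. r * x \<in> I)"

text \<open>Stated for sequences of elements instead of ideals, the chain condition applies directly
  to a sequence of leading coefficients and passes to homomorphic images by lifting the
  sequence.\<close>

definition noetherian :: "'a::comm_ring_1 set \<Rightarrow> bool" where
  "noetherian R \<longleftrightarrow> is_subring R \<and> (\<forall>a. range a \<subseteq> R \<longrightarrow> (\<exists>n::nat. a n \<in> lin R (a ` {..<n})))"

lemma subringD:
  assumes "is_subring R"
  shows "0 \<in> R" "1 \<in> R" "x \<in> R \<Longrightarrow> y \<in> R \<Longrightarrow> x - y \<in> R" "x \<in> R \<Longrightarrow> y \<in> R \<Longrightarrow> x * y \<in> R"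
    "x \<in> R \<Longrightarrow> - x \<in> R" "x \<in> R \<Longrightarrow> y \<in> R \<Longrightarrow> x + y \<in> R"
proof -
  show d: "x - y \<in> R" and "x * y \<in> R" if "x \<in> R" "y \<in> R" for x y
    using assms that by (auto simp: is_subring_def)
  show 0: "0 \<in> R" using assms by (metis is_subring_def diff_self)
  show n: "- x \<in> R" if "x \<in> R" for x using d[OF 0 that] by simp
  show "x \<in> R \<Longrightarrow> y \<in> R \<Longrightarrow> x + y \<in> R" using d[of x "- y"] n by simp
  show "1 \<in> R" using assms by (auto simp: is_subring_def)
qed

lemma subring_sum: "is_subring R \<Longrightarrow> (\<And>i. i \<in> A \<Longrightarrow> f i \<in> R) \<Longrightarrow> sum f A \<in> R"
  by (induction A rule: infinite_finite_induct) (auto intro: subringD)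

lemma subring_prod: "is_subring R \<Longrightarrow> (\<And>i. i \<in> A \<Longrightarrow> f i \<in> R) \<Longrightarrow> prod f A \<in> R"
  by (induction A rule: infinite_finite_induct) (auto intro: subringD)

lemma subring_power: "is_subring R \<Longrightarrow> x \<in> R \<Longrightarrow> x ^ k \<in> R"
  by (induction k) (auto intro: subringD)

lemma idealD:
  assumes "is_ideal R I"
  shows "0 \<in> I" "x \<in> I \<Longrightarrow> x \<in> R" "x \<in> I \<Longrightarrow> y \<in> I \<Longrightarrow> x + y \<in> I" "r \<in> R \<Longrightarrow> x \<in> I \<Longrightarrow> r * x \<in> I"
    "r \<in> R \<Longrightarrow> x \<in> I \<Longrightarrow> x * r \<in> I"
  using assms by (auto simp: is_ideal_def mult.commute)

lemma ideal_minus: "is_subring R \<Longrightarrow> is_ideal R I \<Longrightarrow> x \<in> I \<Longrightarrow> - x \<in> I"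
  using idealD(4)[of R I "- 1" x] subringD[of R] by auto

lemma ideal_diff: "is_subring R \<Longrightarrow> is_ideal R I \<Longrightarrow> x \<in> I \<Longrightarrow> y \<in> I \<Longrightarrow> x - y \<in> I"
  using idealD(3)[of R I x "- y"] ideal_minus[of R I y] by auto

lemma ideal_sum: "is_ideal R I \<Longrightarrow> (\<And>i. i \<in> A \<Longrightarrow> f i \<in> I) \<Longrightarrow> sum f A \<in> I"
  by (induction A rule: infinite_finite_induct) (auto intro: idealD)

lemma lin_mono:
  assumes "C \<subseteq> C'" "A \<subseteq> A'"
  shows "lin C A \<subseteq> lin C' A'"
proof
  fix x assume "x \<in> lin C A"
  then show "x \<in> lin C' A'" by induction (use assms in \<open>auto intro!: lin.intros\<close>)
qed

lemma lin_base: "c \<in> C \<Longrightarrow> a \<in> A \<Longrightarrow> c * a \<in> lin C A"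
  using lin.step[OF _ _ lin.zero, of c C a A] by simp

lemma lin_add: "x \<in> lin C A \<Longrightarrow> y \<in> lin C A \<Longrightarrow> x + y \<in> lin C A"
  by (induction x rule: lin.induct) (auto simp: add.assoc intro: lin.intros)

lemma lin_mult: "x \<in> lin C A \<Longrightarrow> (\<And>c. c \<in> C \<Longrightarrow> r * c \<in> C) \<Longrightarrow> r * x \<in> lin C A"
proof (induction x rule: lin.induct)
  case (step c a x)
  then have "(r * c) * a + r * x \<in> lin C A" by (intro lin.step) auto
  then show ?case by (simp add: algebra_simps)
qed (auto intro: lin.intros)

lemma lin_subset_ideal: "is_ideal R I \<Longrightarrow> C \<subseteq> R \<Longrightarrow> A \<subseteq> I \<Longrightarrow> lin C A \<subseteq> I"
proof
  fix x assume *: "is_ideal R I" "C \<subseteq> R" "A \<subseteq> I" "x \<in> lin C A"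
  from *(4) show "x \<in> I" by induction (use *(2,3) idealD(1,3,4)[OF *(1)] in \<open>auto simp: subset_iff\<close>)
qed

lemma lin_ideal_coeffs: "is_ideal R I \<Longrightarrow> A \<subseteq> R \<Longrightarrow> lin I A \<subseteq> I"
proof
  fix x assume *: "is_ideal R I" "A \<subseteq> R" "x \<in> lin I A"
  from *(3) show "x \<in> I" by induction (use *(2) idealD(1,3,5)[OF *(1)] in \<open>auto simp: subset_iff\<close>)
qed

lemma is_ideal_self: "is_subring R \<Longrightarrow> is_ideal R R"
  by (auto simp: is_ideal_def intro: subringD)

text \<open>With an ideal as coefficient set, \<open>lin I A\<close> is the product of
  \<open>I\<close> with the ideal generated by \<open>A\<close>. Powers of maximal ideals and the
  conclusion of Artin-Rees are written this way.\<close>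

lemma is_ideal_lin: "is_subring R \<Longrightarrow> is_ideal R I \<Longrightarrow> A \<subseteq> R \<Longrightarrow> is_ideal R (lin I A)"
  using lin_ideal_coeffs[of R I A]
  by (auto simp: is_ideal_def intro: lin.zero lin_add lin_mult)

lemma is_ideal_span: "is_subring R \<Longrightarrow> A \<subseteq> R \<Longrightarrow> is_ideal R (lin R A)"
  by (simp add: is_ideal_lin is_ideal_self)

lemma lin_insert:
  assumes "x \<in> lin C (insert a A)" "is_ideal R C"
  shows "\<exists>c\<in>C. \<exists>y\<in>lin C A. x = c * a + y"
  using assms(1)
proof induction
  case zero
  then show ?case using idealD(1)[OF assms(2)] lin.zero by force
next
  case (step c b x)
  then obtain c' y where cy: "c' \<in> C" "y \<in> lin C A" "x = c' * a + y" by auto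
  show ?case
  proof (cases "b = a")
    case True
    then have "c * b + x = (c + c') * a + y" by (simp add: cy algebra_simps)
    then show ?thesis using cy step idealD(3)[OF assms(2)] by blast
  next
    case False
    then have "b \<in> A" using step by simp
    then have "c * b + x = c' * a + (c * b + y)" "c * b + y \<in> lin C A"
      using cy(2,3) lin.step[OF step.hyps(1) \<open>b \<in> A\<close> cy(2)] by (simp_all add: ac_simps)
    then show ?thesis using cy by blast
  qed
qed

lemma noetherian_fg:
  assumes "noetherian R" "is_ideal R I"
  shows "\<exists>B. finite B \<and> B \<subseteq> I \<and> I = lin R B"
proof (rule ccontr)
  assume no: "\<not> ?thesis"
  have "\<exists>f. \<forall>n::nat. f n \<in> I - lin R (f ` {..<n})"
  proof (rule dependent_wellorder_choice)
    show "(r \<in> I - lin R (f ` {..<x})) = (r \<in> I - lin R (g ` {..<x}))"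
      if "\<And>y. y < x \<Longrightarrow> f y = g y" for r f g and x :: nat
      using that by (metis (no_types, lifting) image_cong lessThan_iff)
    show "\<exists>r. r \<in> I - lin R (f ` {..<x})" if "\<And>y. y < x \<Longrightarrow> f y \<in> I - lin R (f ` {..<y})"
      for f and x :: nat
    proof -
      have "f ` {..<x} \<subseteq> I" using that by auto
      moreover from this have "lin R (f ` {..<x}) \<subseteq> I" using assms by (intro lin_subset_ideal) auto
      ultimately show ?thesis using no by blast
    qed
  qed
  then obtain f :: "nat \<Rightarrow> 'a" where f: "\<And>n. f n \<in> I" "\<And>n. f n \<notin> lin R (f ` {..<n})" by auto
  moreover have "range f \<subseteq> R" using f assms by (auto intro: idealD)
  ultimately show False using assms(1) unfolding noetherian_def by blast
qed

text \<open>Used twice: for Noetherian induction on algebraic sets, and to find a maximal element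
  among the ideals in the proof of the Nullstellensatz.\<close>

lemma noetherian_wf:
  assumes "noetherian R"
  shows "wf {(J, I). is_ideal R I \<and> is_ideal R J \<and> I \<subset> J}"
  unfolding wf_iff_no_infinite_down_chain
proof
  assume "\<exists>f. \<forall>i. (f (Suc i), f i) \<in> {(J, I). is_ideal R I \<and> is_ideal R J \<and> I \<subset> J}"
  then obtain F where "\<forall>i. is_ideal R (F i) \<and> F i \<subset> F (Suc i)" by blast
  then have F: "\<And>i. is_ideal R (F i)" "\<And>i. F i \<subset> F (Suc i)" by blast+
  then have mono: "i \<le> j \<Longrightarrow> F i \<subseteq> F j" for i j using lift_Suc_mono_le[of F i j] by blast
  obtain a where a: "\<And>i. a i \<in> F (Suc i) - F i" using psubset_imp_ex_mem[OF F(2)] by metis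
  have "range a \<subseteq> R" using a F(1) by (auto intro: idealD)
  then obtain n where n: "a n \<in> lin R (a ` {..<n})" using assms by (auto simp: noetherian_def)
  have "a i \<in> F n" if "i < n" for i using a[of i] mono[of "Suc i" n] that by auto
  then have "a ` {..<n} \<subseteq> F n" by auto
  then have "lin R (a ` {..<n}) \<subseteq> F n" by (intro lin_subset_ideal[OF F(1)]) auto
  then show False using n a by auto
qed

section \<open>Hilbert's basis theorem\<close>

definition adjoin :: "'a::comm_ring_1 set \<Rightarrow> 'a \<Rightarrow> 'a set" where
  "adjoin R x = {poly P x | P. \<forall>i. coeff P i \<in> R}"

lemma subring_adjoin:
  assumes R: "is_subring R" shows "is_subring (adjoin R x)"
  unfolding is_subring_def
proof (intro conjI ballI)
  note r = subringD[OF R]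
  show "1 \<in> adjoin R x" unfolding adjoin_def using r
    by (auto intro!: exI[of _ 1] simp: coeff_1)
  fix y z assume "y \<in> adjoin R x" "z \<in> adjoin R x"
  then obtain P Q where PQ: "y = poly P x" "z = poly Q x" "\<And>i. coeff P i \<in> R" "\<And>i. coeff Q i \<in> R"
    by (auto simp: adjoin_def)
  show "y - z \<in> adjoin R x" unfolding adjoin_def
    by (auto intro!: exI[of _ "P - Q"] simp: PQ r)
  show "y * z \<in> adjoin R x" unfolding adjoin_def
    by (auto intro!: exI[of _ "P * Q"] subring_sum[OF R] simp: PQ r coeff_mult)
qed

lemma adjoin_base: "is_subring R \<Longrightarrow> c \<in> R \<Longrightarrow> c \<in> adjoin R x"
  unfolding adjoin_def
  by (auto intro!: exI[of _ "[:c:]"] simp: coeff_pCons subringD split: nat.split)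

lemma adjoin_gen: "is_subring R \<Longrightarrow> x \<in> adjoin R x"
  unfolding adjoin_def
  by (auto intro!: exI[of _ "[:0, 1:]"] simp: coeff_pCons subringD split: nat.split)

text \<open>The extension \<open>R[x]\<close> lives in an ambient ring, where \<open>x\<close> may
  satisfy relations over \<open>R\<close>. Degrees therefore belong to representing polynomials, and
  the classical argument picks representatives of least degree outside the ideal generated so
  far.\<close>

theorem noetherian_adjoin:
  assumes N: "noetherian R"
  shows "noetherian (adjoin R x)"
proof -
  have R: "is_subring R" using N by (simp add: noetherian_def)
  note r = subringD[OF R]
  define T where "T = adjoin R x"
  have T: "is_subring T" unfolding T_def by (rule subring_adjoin[OF R])
  have RT: "R \<subseteq> T" and xT: "x \<in> T" unfolding T_def using adjoin_base adjoin_gen R by auto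
  have "\<exists>n. a n \<in> lin T (a ` {..<n})" if a: "range a \<subseteq> T" for a :: "nat \<Rightarrow> 'a"
  proof (rule ccontr)
    assume no: "\<nexists>n. a n \<in> lin T (a ` {..<n})"
    define I where "I = lin T (range a)"
    have I: "is_ideal T I" unfolding I_def by (rule is_ideal_span[OF T a])
    have aI: "a n \<in> I" for n unfolding I_def using lin_base[of 1 T "a n" "range a"] subringD[OF T] by auto
    \<comment> \<open>A finite generating set would involve only finitely many \<open>a n\<close>,
      and the next one would lie in the ideal of its predecessors.\<close>
    have nfg: "\<not> I \<subseteq> lin T B" if B: "finite B" "B \<subseteq> I" for B
    proof
      assume IB: "I \<subseteq> lin T B"
      have "\<exists>n. y \<in> lin T (a ` {..<n})" if "y \<in> I" for y
        using that unfolding I_def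
      proof induction
        case (step c b y)
        then obtain n m where "y \<in> lin T (a ` {..<n})" "b = a m" by auto
        then have "y \<in> lin T (a ` {..<max n (Suc m)})" "b \<in> a ` {..<max n (Suc m)}"
          using lin_mono[of T T "a ` {..<n}" "a ` {..<max n (Suc m)}"] image_mono[of "{..<n}" "{..<max n (Suc m)}" a]
          by auto
        then show ?case using lin.step step by metis
      qed (auto intro: lin.zero)
      then obtain g where g: "\<And>y. y \<in> B \<Longrightarrow> y \<in> lin T (a ` {..<g y})" using B by (metis subsetD)
      define m where "m = Max (insert 0 (g ` B))"
      have gm: "g y \<le> m" if "y \<in> B" for y unfolding m_def using B that by auto
      have "B \<subseteq> lin T (a ` {..<m})"
      proof
        fix y assume y: "y \<in> B"
        have "a ` {..<g y} \<subseteq> a ` {..<m}" using gm[OF y] by auto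
        then show "y \<in> lin T (a ` {..<m})" using g[OF y] lin_mono by blast
      qed
      then have "lin T B \<subseteq> lin T (a ` {..<m})"
        using a by (intro lin_subset_ideal[OF is_ideal_span[OF T]]) auto
      then show False using no aI[of m] IB by auto
    qed
    define cand where "cand f n P \<longleftrightarrow> (\<forall>i. coeff P i \<in> R) \<and> poly P x \<in> I - lin T ((\<lambda>Q. poly Q x) ` f ` {..<n})"
      for f :: "nat \<Rightarrow> 'a poly" and n :: nat and P
    have "\<exists>f. \<forall>n. cand f n (f n) \<and> (\<forall>Q. cand f n Q \<longrightarrow> degree (f n) \<le> degree Q)"
    proof (rule dependent_wellorder_choice)
      fix P n and f g :: "nat \<Rightarrow> 'a poly" assume "\<And>y. y < n \<Longrightarrow> f y = g y"
      then have "f ` {..<n} = g ` {..<n}" by auto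
      then show "(cand f n P \<and> (\<forall>Q. cand f n Q \<longrightarrow> degree P \<le> degree Q)) =
        (cand g n P \<and> (\<forall>Q. cand g n Q \<longrightarrow> degree P \<le> degree Q))" by (simp add: cand_def)
    next
      fix n f assume IH: "\<And>y. y < n \<Longrightarrow> cand f y (f y) \<and> (\<forall>Q. cand f y Q \<longrightarrow> degree (f y) \<le> degree Q)"
      then have "(\<lambda>Q. poly Q x) ` f ` {..<n} \<subseteq> I" by (auto simp: cand_def)
      then have "\<not> I \<subseteq> lin T ((\<lambda>Q. poly Q x) ` f ` {..<n})" by (intro nfg) auto
      then obtain y where y: "y \<in> I" "y \<notin> lin T ((\<lambda>Q. poly Q x) ` f ` {..<n})" by auto
      then obtain P where "y = poly P x" "\<forall>i. coeff P i \<in> R"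
        using idealD(2)[OF I] by (auto simp: T_def adjoin_def)
      then have "cand f n P" using y by (simp add: cand_def)
      then show "\<exists>P. cand f n P \<and> (\<forall>Q. cand f n Q \<longrightarrow> degree P \<le> degree Q)"
        by (metis ex_has_least_nat)
    qed
    then obtain f where f: "\<And>n. cand f n (f n)" "\<And>n Q. cand f n Q \<Longrightarrow> degree (f n) \<le> degree Q" by blast
    have fR: "coeff (f n) i \<in> R" and fI: "poly (f n) x \<in> I" for n i
      using f(1)[of n] by (simp_all add: cand_def)
    have cm: "cand f m Q" if "cand f n Q" "m \<le> n" for m n Q
    proof -
      have "lin T ((\<lambda>Q. poly Q x) ` f ` {..<m}) \<subseteq> lin T ((\<lambda>Q. poly Q x) ` f ` {..<n})"
        using that(2) by (intro lin_mono) auto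
      then show ?thesis using that(1) by (auto simp: cand_def)
    qed
    have deg: "degree (f m) \<le> degree (f n)" if "m \<le> n" for m n
      using f(2)[OF cm[OF f(1) that]] .
    have "range (\<lambda>n. lead_coeff (f n)) \<subseteq> R" using fR by auto
    then obtain n where n: "lead_coeff (f n) \<in> lin R ((\<lambda>n. lead_coeff (f n)) ` {..<n})"
      using N unfolding noetherian_def by (auto dest: spec[of _ "\<lambda>n. lead_coeff (f n)"])
    define L where "L = lin T ((\<lambda>Q. poly Q x) ` f ` {..<n})"
    have L: "is_ideal T L" unfolding L_def
      using fI idealD(2)[OF I] by (intro is_ideal_span[OF T]) auto
    \<comment> \<open>A relation among leading coefficients lifts to a polynomial with value in
      \<open>L\<close>: each earlier \<open>f m\<close> is multiplied by the monomial that raises it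
      to the degree of \<open>f n\<close>, which is possible by \<open>deg\<close>.\<close>
    have "\<exists>Q. (\<forall>i. coeff Q i \<in> R) \<and> degree Q \<le> degree (f n) \<and> coeff Q (degree (f n)) = c \<and> poly Q x \<in> L"
      if "c \<in> lin R ((\<lambda>n. lead_coeff (f n)) ` {..<n})" for c
      using that
    proof induction
      case zero
      show ?case using r idealD(1)[OF L] by (intro exI[of _ 0]) auto
    next
      case (step c b y)
      then obtain Q where Q: "\<And>i. coeff Q i \<in> R" "degree Q \<le> degree (f n)" "coeff Q (degree (f n)) = y" "poly Q x \<in> L"
        by blast
      obtain m where m: "m < n" "b = lead_coeff (f m)" using step by auto
      define e where "e = degree (f n) - degree (f m)"
      have e: "e + degree (f m) = degree (f n)" using deg[of m n] m by (simp add: e_def)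
      let ?M = "monom c e * f m"
      have "degree ?M \<le> degree (f n)"
        using degree_mult_le[of "monom c e" "f m"] degree_monom_le[of c e] e by linarith
      moreover have "coeff ?M (degree (f n)) = c * b"
        using m(2) by (simp add: coeff_monom_mult e[symmetric])
      moreover have "coeff ?M i \<in> R" for i using r fR step by (auto simp: coeff_monom_mult)
      moreover have "poly ?M x \<in> L"
      proof -
        have "poly (f m) x \<in> L" unfolding L_def using m lin_base[of 1 T] subringD[OF T] by force
        moreover have "c * x ^ e \<in> T" using step RT xT by (auto intro: subringD[OF T] subring_power[OF T])
        ultimately show ?thesis using idealD(4)[OF L] by (simp add: poly_monom)
      qed
      ultimately show ?case using Q r idealD(3)[OF L]
        by (intro exI[of _ "?M + Q"]) (auto intro: degree_add_le)
    qed
    from this[OF n] obtain Q where Q: "\<And>i. coeff Q i \<in> R" "degree Q \<le> degree (f n)"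
      "coeff Q (degree (f n)) = lead_coeff (f n)" "poly Q x \<in> L" by blast
    have nL: "poly (f n) x \<notin> L" using f(1)[of n] by (simp add: cand_def L_def)
    have sub: "poly (f n - Q) x \<notin> L"
    proof
      assume "poly (f n - Q) x \<in> L"
      from idealD(3)[OF L this Q(4)] show False using nL by simp
    qed
    have "L \<subseteq> I" unfolding L_def using fI by (intro lin_subset_ideal[OF I]) auto
    then have "cand f n (f n - Q)" unfolding cand_def L_def[symmetric]
      using sub fR Q r ideal_diff[OF T I] fI by auto
    \<comment> \<open>\<open>f n - Q\<close> competes with \<open>f n\<close> for the least degree,
      but the leading terms cancel.\<close>
    from f(2)[OF this] have le: "degree (f n) \<le> degree (f n - Q)" .
    have "f n - Q = 0 \<or> degree (f n - Q) < degree (f n)"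
      using Q by (intro eq_zero_or_degree_less degree_diff_le) auto
    then show False using le sub idealD(1)[OF L] by auto
  qed
  then show ?thesis using T by (simp add: noetherian_def T_def)
qed

lemma zero_fun_eta [simp]: "(\<lambda>x. 0) = 0"
  by (simp add: zero_fun_def)

section \<open>Polynomial functions and the Artin-Rees lemma\<close>

lemma lin_sum: "(\<And>i. i \<in> B \<Longrightarrow> f i \<in> lin C A) \<Longrightarrow> sum f B \<in> lin C A"
  by (induction B rule: infinite_finite_induct) (auto intro: lin.zero lin_add)

lemma adjoin_subset:
  assumes "is_subring T" "R \<subseteq> T" "x \<in> T"
  shows "adjoin R x \<subseteq> T"
  unfolding adjoin_def using assms
  by (auto simp: poly_altdef intro!: subring_sum[of T] subringD(4)[of T] subring_power[of T])

text \<open>The minimality clause later identifies \<open>R'\<close> with the ring of polynomial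
  functions and with the Rees algebra.\<close>

lemma noetherian_adjoin_finite:
  assumes "noetherian R" "finite A"
  shows "\<exists>R'. noetherian R' \<and> R \<subseteq> R' \<and> A \<subseteq> R' \<and> (\<forall>T. is_subring T \<longrightarrow> R \<union> A \<subseteq> T \<longrightarrow> R' \<subseteq> T)"
  using assms(2)
proof induction
  case empty
  then show ?case using assms by auto
next
  case (insert x A)
  then obtain R' where R': "noetherian R'" "R \<subseteq> R'" "A \<subseteq> R'"
    "\<And>T. is_subring T \<Longrightarrow> R \<union> A \<subseteq> T \<Longrightarrow> R' \<subseteq> T" by blast
  then have s: "is_subring R'" by (simp add: noetherian_def)
  show ?case
  proof (intro exI[of _ "adjoin R' x"] conjI allI impI)
    show "noetherian (adjoin R' x)" by (rule noetherian_adjoin[OF R'(1)])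
    show "R \<subseteq> adjoin R' x" "insert x A \<subseteq> adjoin R' x"
      using R' adjoin_base[OF s] adjoin_gen[OF s] by auto
    show "adjoin R' x \<subseteq> T" if "is_subring T" "R \<union> insert x A \<subseteq> T" for T
      using that by (intro adjoin_subset R'(4)) auto
  qed
qed

lemma noetherian_image:
  assumes N: "noetherian R" and h: "\<And>x y. h (x + y) = h x + h y" "\<And>x y. h (x * y) = h x * h y" "h 1 = 1"
  shows "noetherian (h ` R)"
proof -
  have R: "is_subring R" using N by (simp add: noetherian_def)
  have "h 0 + h 0 = h 0 + 0" using h(1)[of 0 0] by simp
  then have h0: "h 0 = 0" by (simp only: add_left_cancel)
  have "h x + h (- x) = 0" for x using h(1)[of x "- x"] h0 by simp
  then have hm: "h (- x) = - h x" for x by (metis add.inverse_unique)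
  have hd: "h (x - y) = h x - h y" for x y using h(1)[of x "- y"] by (simp add: hm)
  have "is_subring (h ` R)" unfolding is_subring_def
  proof (intro conjI ballI)
    show "1 \<in> h ` R" using subringD(2)[OF R] h(3) by (metis image_eqI)
    fix x y assume "x \<in> h ` R" "y \<in> h ` R"
    then obtain a b where ab: "a \<in> R" "b \<in> R" "x = h a" "y = h b" by auto
    then show "x - y \<in> h ` R" "x * y \<in> h ` R"
      using subringD(3,4)[OF R] by (auto simp: hd[symmetric] h(2)[symmetric])
  qed
  moreover have "\<exists>n. a n \<in> lin (h ` R) (a ` {..<n})" if "range a \<subseteq> h ` R" for a :: "nat \<Rightarrow> 'b"
  proof -
    have "\<forall>n. \<exists>b. b \<in> R \<and> a n = h b" using that by auto
    then obtain b where b: "\<And>n. b n \<in> R" "\<And>n. a n = h (b n)" by metis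
    have "range b \<subseteq> R" using b by auto
    then obtain n where n: "b n \<in> lin R (b ` {..<n})" using N unfolding noetherian_def by blast
    have "h y \<in> lin (h ` R) (a ` {..<n})" if "y \<in> lin R (b ` {..<n})" for y
      using that
    proof induction
      case (step c d y)
      then have "h d \<in> a ` {..<n}" using b by auto
      then show ?case using step by (auto simp: h intro: lin.step)
    qed (simp add: h0 lin.zero)
    then show ?thesis using n b by auto
  qed
  ultimately show ?thesis by (simp add: noetherian_def)
qed

abbreviation coord :: "'n \<Rightarrow> 'k^'n \<Rightarrow> 'k" where "coord i \<equiv> \<lambda>p. p $ i"

lemma polynomial_functions_subring: "is_subring (polynomial_functions :: ('k::field^'n \<Rightarrow> 'k) set)"
  unfolding is_subring_def
proof (intro conjI ballI)
  show "1 \<in> (polynomial_functions :: ('k^'n \<Rightarrow> 'k) set)"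
    using polynomial_functions.const[of 1] by (simp add: one_fun_def)
  fix f g :: "'k^'n \<Rightarrow> 'k" assume fg: "f \<in> polynomial_functions" "g \<in> polynomial_functions"
  show "f * g \<in> polynomial_functions" using polynomial_functions.mult[OF fg] by (simp add: times_fun_def)
  show "f - g \<in> polynomial_functions"
    using polynomial_functions.add[OF fg(1) polynomial_functions.mult[OF polynomial_functions.const[of "- 1"] fg(2)]]
    by (simp add: fun_diff_def)
qed

lemmas pf = subringD[OF polynomial_functions_subring]
  subring_sum[OF polynomial_functions_subring] subring_prod[OF polynomial_functions_subring]
  polynomial_functions.const polynomial_functions.coordinate

lemma noetherian_constants: "noetherian (range (\<lambda>c::'k::field. (\<lambda>p::'k^'n. c)))" (is "noetherian ?C")
  unfolding noetherian_def
proof (intro conjI allI impI)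
  show "is_subring ?C" by (auto simp: is_subring_def one_fun_def fun_diff_def times_fun_def)
  fix a :: "nat \<Rightarrow> 'k^'n \<Rightarrow> 'k" assume "range a \<subseteq> ?C"
  then have "\<forall>n. \<exists>c. a n = (\<lambda>p. c)" by blast
  then obtain c where c: "\<And>n. a n = (\<lambda>p. c n)" by metis
  show "\<exists>n. a n \<in> lin ?C (a ` {..<n})"
  proof (cases "c 0 = 0")
    case True
    then have "a 0 = 0" by (simp add: c)
    then show ?thesis using lin.zero by metis
  next
    case False
    then have "a 1 = (\<lambda>p. c 1 / c 0) * a 0" by (simp add: c times_fun_def)
    then have "a 1 \<in> lin ?C (a ` {..<1})" by (auto intro: lin_base)
    then show ?thesis by blast
  qed
qed

lemma noetherian_polynomial_functions: "noetherian (polynomial_functions :: ('k::field^'n \<Rightarrow> 'k) set)"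
proof -
  obtain R :: "('k^'n \<Rightarrow> 'k) set" where R: "noetherian R" "range (\<lambda>c p. c) \<subseteq> R" "range coord \<subseteq> R"
    "\<And>T. is_subring T \<Longrightarrow> range (\<lambda>c p. c) \<union> range coord \<subseteq> T \<Longrightarrow> R \<subseteq> T"
    using noetherian_adjoin_finite[OF noetherian_constants, of "range coord"] by auto
  have "R \<subseteq> polynomial_functions"
    by (rule R(4)) (auto simp: polynomial_functions_subring intro: polynomial_functions.intros)
  moreover have "f \<in> R" if "f \<in> polynomial_functions" for f
  proof -
    have s: "is_subring R" using R(1) by (simp add: noetherian_def)
    show ?thesis using that
    proof induction
      case (add f g)
      then show ?case using subringD(6)[OF s, of f g] by (simp add: plus_fun_def)
    next
      case (mult f g)
      then show ?case using subringD(4)[OF s, of f g] by (simp add: times_fun_def)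
    qed (use R in auto)
  qed
  ultimately show ?thesis using R(1) by (metis subsetI subset_antisym)
qed

section \<open>Powers of the maximal ideal at a point\<close>

primrec mpow :: "'k::field^'n \<Rightarrow> nat \<Rightarrow> ('k^'n \<Rightarrow> 'k) set" where
  "mpow p 0 = polynomial_functions"
| "mpow p (Suc k) = lin (mpow p k) (range (\<lambda>i q. q $ i - p $ i))"

lemma shifted_coord: "(\<lambda>q. q $ i - c) \<in> polynomial_functions"
  using pf(3)[OF polynomial_functions.coordinate polynomial_functions.const]
  by (simp add: fun_diff_def)

lemma mpow_ideal: "is_ideal polynomial_functions (mpow p k)"
  by (induction k) (auto intro!: is_ideal_lin is_ideal_self polynomial_functions_subring shifted_coord)

lemmas mpow_idealD = idealD[OF mpow_ideal]

lemma mpow_Suc_subset: "mpow p (Suc k) \<subseteq> mpow p k"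
  unfolding mpow.simps(2) by (rule lin_ideal_coeffs[OF mpow_ideal]) (auto simp: shifted_coord)

lemma mpow_antimono: "j \<le> k \<Longrightarrow> mpow p k \<subseteq> mpow p j"
  by (induction k rule: dec_induct) (use mpow_Suc_subset in blast)+

lemma mpow_mult: "f \<in> mpow p j \<Longrightarrow> g \<in> mpow p k \<Longrightarrow> f * g \<in> mpow p (j + k)"
proof (induction j arbitrary: f)
  case 0
  then show ?case by (simp add: mpow_idealD(4) del: times_fun_apply)
next
  case (Suc j)
  have "f \<in> lin (mpow p j) (range (\<lambda>i q. q $ i - p $ i))" using Suc.prems by simp
  then show ?case
  proof induction
    case zero
    then show ?case by (simp add: lin.zero)
  next
    case (step c a x)
    have "(c * a + x) * g = (c * g) * a + x * g" by (simp only: algebra_simps)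
    also have "(c * g) * a + x * g \<in> mpow p (Suc j + k)"
      unfolding add_Suc mpow.simps
      by (rule lin.step[OF Suc.IH[OF step(1) Suc.prems(2)] step(2)]) (rule step(4)[unfolded add_Suc mpow.simps])
    finally show ?case .
  qed
qed

lemma mpow_1: "mpow p 1 = {f \<in> polynomial_functions. f p = 0}"
proof
  have "f p = 0" if "f \<in> mpow p 1" for f
  proof -
    have "f \<in> lin polynomial_functions (range (\<lambda>i q. q $ i - p $ i))" using that by simp
    then show ?thesis by induction auto
  qed
  then show "mpow p 1 \<subseteq> {f \<in> polynomial_functions. f p = 0}" using mpow_idealD(2) by blast
  note m = idealD[OF mpow_ideal[of p 1]]
  have "f - (\<lambda>q. f p) \<in> mpow p 1" if "f \<in> polynomial_functions" for f
    using that
  proof induction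
    case (const c)
    then show ?case using m(1) by (simp add: fun_diff_def)
  next
    case (coordinate i)
    have "1 * (\<lambda>q. q $ i - p $ i) \<in> lin polynomial_functions (range (\<lambda>i q. q $ i - p $ i))"
      by (rule lin_base) (auto simp: pf)
    then show ?case by (simp add: fun_diff_def)
  next
    case (add f g)
    have "(\<lambda>x. f x + g x) - (\<lambda>q. f p + g p) = (f - (\<lambda>q. f p)) + (g - (\<lambda>q. g p))"
      by (auto simp: fun_eq_iff)
    then show ?case using m(3)[OF add.IH] by metis
  next
    case (mult f g)
    have "(\<lambda>x. f x * g x) - (\<lambda>q. f p * g p) = f * (g - (\<lambda>q. g p)) + (\<lambda>q. g p) * (f - (\<lambda>q. f p))"
      by (auto simp: fun_eq_iff algebra_simps)
    moreover have "f * (g - (\<lambda>q. g p)) + (\<lambda>q. g p) * (f - (\<lambda>q. f p)) \<in> mpow p 1"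
      by (intro m(3) m(4) mult polynomial_functions.const)
    ultimately show ?case by metis
  qed
  then have "f \<in> mpow p 1" if "f \<in> polynomial_functions" "f p = 0" for f
  proof -
    have "f - (\<lambda>q. f p) = f" using that(2) by (simp add: fun_eq_iff)
    then show ?thesis using that(1) \<open>\<And>f. f \<in> polynomial_functions \<Longrightarrow> f - (\<lambda>q. f p) \<in> mpow p 1\<close> by metis
  qed
  then show "{f \<in> polynomial_functions. f p = 0} \<subseteq> mpow p 1" by auto
qed

text \<open>The Rees algebra of the maximal ideal at \<open>p\<close>; as an algebra over the constant polynomials it is
  generated by the \<open>(x\<^sub>i - p\<^sub>i) t\<close>.\<close>

definition rees :: "'k::field^'n \<Rightarrow> ('k^'n \<Rightarrow> 'k) poly set" where
  "rees p = {P. \<forall>k. coeff P k \<in> mpow p k}"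

lemma rees_subring: "is_subring (rees p)"
  unfolding is_subring_def
proof (intro conjI ballI)
  show "1 \<in> rees p" by (auto simp: rees_def coeff_1 pf mpow_idealD(1))
  fix P Q assume PQ: "P \<in> rees p" "Q \<in> rees p"
  show "P - Q \<in> rees p"
    using PQ by (auto simp: rees_def ideal_diff[OF polynomial_functions_subring mpow_ideal])
  have "coeff (P * Q) k \<in> mpow p k" for k
    unfolding coeff_mult
  proof (rule ideal_sum[OF mpow_ideal])
    fix i assume "i \<in> {..k}"
    then show "coeff P i * coeff Q (k - i) \<in> mpow p k"
      using mpow_mult[of "coeff P i" p i "coeff Q (k - i)" "k - i"] PQ by (simp add: rees_def)
  qed
  then show "P * Q \<in> rees p" by (simp add: rees_def)
qed

lemma noetherian_rees: "noetherian (rees p)"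
proof -
  define G where "G = range (\<lambda>i. monom (\<lambda>q. q $ i - p $ i) 1)"
  have "noetherian ((\<lambda>f. [:f:]) ` (polynomial_functions :: ('a^'b \<Rightarrow> 'a) set))"
    by (rule noetherian_image[OF noetherian_polynomial_functions]) auto
  from noetherian_adjoin_finite[OF this, of G]
  obtain R where R: "noetherian R" "(\<lambda>f. [:f:]) ` polynomial_functions \<subseteq> R" "G \<subseteq> R"
    "\<And>T. is_subring T \<Longrightarrow> (\<lambda>f. [:f:]) ` polynomial_functions \<union> G \<subseteq> T \<Longrightarrow> R \<subseteq> T"
    by (auto simp: G_def)
  have s: "is_subring R" using R(1) by (simp add: noetherian_def)
  have "R \<subseteq> rees p"
  proof (rule R(4)[OF rees_subring])
    have "[:f:] \<in> rees p" if "f \<in> polynomial_functions" for f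
      using that by (auto simp: rees_def coeff_pCons mpow_idealD(1) simp del: mpow.simps(2) split: nat.split)
    moreover have "monom (\<lambda>q. q $ i - p $ i) 1 \<in> rees p" for i
    proof -
      have "(\<lambda>q. q $ i - p $ i) \<in> mpow p 1" unfolding mpow_1 using shifted_coord by simp
      then show ?thesis by (auto simp: rees_def mpow_idealD(1))
    qed
    ultimately show "(\<lambda>f. [:f:]) ` polynomial_functions \<union> G \<subseteq> rees p" by (auto simp: G_def)
  qed
  moreover have mon: "monom g k \<in> R" if "g \<in> mpow p k" for g k
    using that
  proof (induction k arbitrary: g)
    case 0
    then show ?case using R(2) by (auto simp: monom_0)
  next
    case (Suc k)
    have "g \<in> lin (mpow p k) (range (\<lambda>i q. q $ i - p $ i))" using Suc.prems by simp
    then show ?case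
    proof induction
      case zero
      then show ?case using subringD(1)[OF s] by simp
    next
      case (step c a x)
      then have "monom c k * monom a 1 \<in> R"
        using R(3) Suc.IH by (intro subringD(4)[OF s]) (auto simp: G_def)
      moreover have "monom (c * a + x) (Suc k) = monom c k * monom a 1 + monom x (Suc k)"
        by (simp add: mult_monom add_monom)
      ultimately show ?case using step subringD(6)[OF s] by metis
    qed
  qed
  moreover have "P \<in> R" if "P \<in> rees p" for P
  proof -
    have "(\<Sum>i\<le>degree P. monom (coeff P i) i) \<in> R"
      using that mon by (intro subring_sum[OF s]) (auto simp: rees_def)
    then show ?thesis by (simp add: poly_as_sum_of_monoms)
  qed
  ultimately show ?thesis using R(1) by (metis subsetI subset_antisym)
qed

text \<open>The elements of the Rees algebra with all coefficients in \<open>I\<close> form an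
  ideal, generated by finitely many polynomials of degree at most \<open>c\<close>. In the
  coefficient of index \<open>k + c\<close> of a combination of these, each generator meets only
  coefficients of its multiplier of index at least \<open>k\<close>, which lie in
  \<open>mpow p k\<close>.\<close>

theorem artin_rees:
  assumes I: "is_ideal polynomial_functions I"
  shows "\<exists>c. \<forall>k. I \<inter> mpow p (k + c) \<subseteq> lin (mpow p k) I"
proof -
  define J where "J = {P \<in> rees p. \<forall>k. coeff P k \<in> I}"
  have "is_ideal (rees p) J" unfolding is_ideal_def
  proof (intro conjI ballI)
    show "0 \<in> J" using idealD(1)[OF I] subringD(1)[OF rees_subring] by (auto simp: J_def)
    fix P Q assume "P \<in> J" "Q \<in> J"
    then show "P + Q \<in> J" using idealD(3)[OF I] subringD(6)[OF rees_subring] by (auto simp: J_def)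
  next
    fix P Q assume PQ: "P \<in> rees p" "Q \<in> J"
    have "coeff P i \<in> polynomial_functions" for i
      using PQ(1) mpow_idealD(2) by (fastforce simp: rees_def)
    then have "coeff (P * Q) k \<in> I" for k unfolding coeff_mult
      using PQ by (intro ideal_sum[OF I] idealD(4)[OF I]) (auto simp: J_def)
    then show "P * Q \<in> J" using PQ subringD(4)[OF rees_subring] by (auto simp: J_def)
  qed (auto simp: J_def)
  from noetherian_fg[OF noetherian_rees this]
  obtain B where B: "finite B" "B \<subseteq> J" "J = lin (rees p) B" by blast
  define c where "c = Max (insert 0 (degree ` B))"
  have deg: "degree b \<le> c" if "b \<in> B" for b unfolding c_def using that B(1) by auto
  have "coeff P (k + c) \<in> lin (mpow p k) I" if "P \<in> lin (rees p) B" for P k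
    using that
  proof induction
    case zero
    then show ?case by (simp add: lin.zero)
  next
    case (step Q b x)
    have "coeff Q i * coeff b (k + c - i) \<in> lin (mpow p k) I" if "i \<le> k + c" for i
    proof (cases "k \<le> i")
      case True
      then have "coeff Q i \<in> mpow p k" using step(1) mpow_antimono[of k i p] by (auto simp: rees_def)
      then show ?thesis using step(2) B by (intro lin_base) (auto simp: J_def)
    next
      case False
      then have "coeff b (k + c - i) = 0" using deg[OF step(2)] by (intro coeff_eq_0) auto
      then show ?thesis by (simp add: lin.zero)
    qed
    then have "coeff (Q * b) (k + c) \<in> lin (mpow p k) I" unfolding coeff_mult by (intro lin_sum) simp
    show ?case unfolding coeff_add by (rule lin_add[OF \<open>coeff (Q * b) (k + c) \<in> lin (mpow p k) I\<close> step(4)])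
  qed
  moreover have "monom h k \<in> J" if "h \<in> I" "h \<in> mpow p k" for h k
    using that idealD(1)[OF I] by (auto simp: J_def rees_def mpow_idealD(1))
  ultimately have "h \<in> lin (mpow p k) I" if "h \<in> I" "h \<in> mpow p (k + c)" for h k
    using that B(3) by (metis coeff_monom)
  then show ?thesis by blast
qed

section \<open>Codimension\<close>

locale codimension = vector_space scale for scale :: "'a::field \<Rightarrow> 'b::ab_group_add \<Rightarrow> 'b"
begin

definition ext :: "'b set \<Rightarrow> 'b \<Rightarrow> 'b set" where
  "ext V b = {v + scale c b | v c. v \<in> V}"

inductive codim_le :: "'b set \<Rightarrow> 'b set \<Rightarrow> nat \<Rightarrow> bool" where
  base: "A \<subseteq> V \<Longrightarrow> codim_le V A h"
| step: "b \<in> A \<Longrightarrow> codim_le (ext V b) A h \<Longrightarrow> codim_le V A (Suc h)"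

lemma ext_mono: "V \<subseteq> W \<Longrightarrow> ext V b \<subseteq> ext W b"
  by (auto simp: ext_def)

lemma ext_subset: "subspace A \<Longrightarrow> V \<subseteq> A \<Longrightarrow> b \<in> A \<Longrightarrow> ext V b \<subseteq> A"
  by (auto simp: ext_def intro!: subspace_add subspace_scale)

lemma subset_ext: "V \<subseteq> ext V b"
proof
  fix v assume "v \<in> V"
  then have "v + scale 0 b \<in> ext V b" unfolding ext_def by blast
  then show "v \<in> ext V b" by simp
qed

lemma subspace_ext: 
  assumes "subspace A" shows "subspace (ext A b)"
proof (rule subspaceI)
  show "0 \<in> ext A b" using subset_ext subspace_0[OF assms] by blast
  fix x y c assume "x \<in> ext A b"
  then obtain v e where v: "v \<in> A" "x = v + scale e b" by (auto simp: ext_def)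
  have "scale c x = scale c v + scale (c * e) b" by (simp add: v scale_right_distrib)
  then show "scale c x \<in> ext A b" using subspace_scale[OF assms v(1), of c] by (auto simp: ext_def)
  assume "y \<in> ext A b"
  then obtain w d where w: "w \<in> A" "y = w + scale d b" by (auto simp: ext_def)
  have "x + y = (v + w) + scale (e + d) b" by (simp add: v w scale_left_distrib)
  then show "x + y \<in> ext A b" using subspace_add[OF assms v(1) w(1)] unfolding ext_def by blast
qed

lemma codim_le_mono: "codim_le V A h \<Longrightarrow> V \<subseteq> W \<Longrightarrow> h \<le> k \<Longrightarrow> codim_le W A k"
proof (induction arbitrary: W k rule: codim_le.induct)
  case (base A V h)
  then show ?case by (auto intro: codim_le.base)
next
  case (step b A V h)
  then obtain k' where k: "k = Suc k'" "h \<le> k'" by (cases k) auto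
  show ?case unfolding k(1)
    by (rule codim_le.step[OF step(1)]) (rule step.IH[OF ext_mono[OF step.prems(1)] k(2)])
qed

lemma codim_le_trans: "codim_le V A h \<Longrightarrow> codim_le A S k \<Longrightarrow> A \<subseteq> S \<Longrightarrow> codim_le V S (h + k)"
proof (induction rule: codim_le.induct)
  case (base A V h)
  then show ?case using codim_le_mono by force
next
  case (step b A V h)
  then show ?case by (auto intro: codim_le.step)
qed

text \<open>\<open>\<phi>\<close> induces a surjection from \<open>S\<close> modulo \<open>W\<close>
  onto \<open>A\<close> modulo \<open>V\<close>, so it carries the vectors added to \<open>W\<close>
  to vectors that may be added to \<open>V\<close>.\<close>

lemma codim_le_image:
  assumes "codim_le W S h" "\<And>x y. \<phi> (x + y) = \<phi> x + \<phi> y" "\<And>c x. \<phi> (scale c x) = scale c (\<phi> x)"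
    and "\<phi> ` S \<subseteq> A" "\<phi> ` W \<subseteq> V" "\<And>a. a \<in> A \<Longrightarrow> \<exists>v\<in>V. \<exists>s\<in>S. a = v + \<phi> s"
    and "subspace V"
  shows "codim_le V A h"
  using assms(1,4-)
proof (induction arbitrary: V rule: codim_le.induct)
  case (base S W h)
  have "A \<subseteq> V"
  proof
    fix a assume "a \<in> A"
    from base(4)[OF this] obtain v s where vs: "v \<in> V" "s \<in> S" "a = v + \<phi> s" by blast
    then have "\<phi> s \<in> V" using base(1,3) by blast
    then show "a \<in> V" using subspace_add[OF base(5) vs(1)] vs(3) by simp
  qed
  then show ?case by (rule codim_le.base)
next
  case (step b S W h)
  show ?case
  proof (rule codim_le.step)
    show "\<phi> b \<in> A" using step by auto
    show "codim_le (ext V (\<phi> b)) A h"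
    proof (rule step.IH)
      show "\<phi> ` ext W b \<subseteq> ext V (\<phi> b)"
        using step.prems(2) unfolding ext_def by (force simp: assms(2,3))
      show "\<exists>v\<in>ext V (\<phi> b). \<exists>s\<in>S. a = v + \<phi> s" if "a \<in> A" for a
        using step.prems(3)[OF that] subset_ext by blast
    qed (use step.prems subspace_ext in auto)
  qed
qed

text \<open>Adding one vector outside \<open>A\<close> to both spaces does not change the
  quotient.\<close>

lemma codim_le_cancel:
  assumes "codim_le V' A' h" "V' = ext V b" "A' = ext A b" "V \<subseteq> A" "subspace A" "b \<notin> A"
  shows "codim_le V A h"
  using assms(1-4)
proof (induction arbitrary: V rule: codim_le.induct)
  case (base A' V' h)
  have "A \<subseteq> V"
  proof
    fix a assume a: "a \<in> A"
    then have "a \<in> ext V b" using base subset_ext by blast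
    then obtain v e where v: "v \<in> V" "a = v + scale e b" by (auto simp: ext_def)
    have "e = 0"
    proof (rule ccontr)
      assume "e \<noteq> 0"
      then have "b = scale (1 / e) (a - v)" by (simp add: v)
      moreover have "a - v \<in> A" using a v(1) base(4) assms(5) by (blast intro: subspace_diff)
      ultimately show False using assms(5,6) by (metis subspace_scale)
    qed
    then show "a \<in> V" using v by simp
  qed
  then show ?case by (rule codim_le.base)
next
  case (step c A' V' h)
  \<comment> \<open>The new vector \<open>c\<close> can be replaced by its component
    \<open>a\<close> in \<open>A\<close>, because \<open>b\<close> is added anyway.\<close>
  then obtain a e where a: "a \<in> A" "c = a + scale e b" by (auto simp: ext_def)
  have "ext V' c = ext (ext V a) b"
  proof (intro set_eqI iffI)
    fix x assume "x \<in> ext V' c"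
    then obtain v s t where x: "v \<in> V" "x = (v + scale s b) + scale t c" by (auto simp: ext_def step.prems)
    have "x = (v + scale t a) + scale (s + t * e) b"
      by (simp add: x a scale_right_distrib scale_left_distrib)
    then show "x \<in> ext (ext V a) b" unfolding ext_def using x(1) by blast
  next
    fix x assume "x \<in> ext (ext V a) b"
    then obtain v s t where x: "v \<in> V" "x = (v + scale t a) + scale s b" by (auto simp: ext_def)
    have "x = (v + scale (s - t * e) b) + scale t c"
      by (simp add: x a scale_right_distrib scale_left_distrib scale_left_diff_distrib)
    then show "x \<in> ext V' c" unfolding ext_def step.prems(1) using x(1) by blast
  qed
  then have "codim_le (ext V a) A h" using step ext_subset[OF assms(5)] a by (intro step.IH) auto
  then show ?case using a(1) by (intro codim_le.step)
qed

text \<open>Additivity of codimension. Each vector added on the way from \<open>V\<close> to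
  \<open>S\<close> is charged to \<open>A\<close> over \<open>V\<close> if it lies in the current
  \<open>A\<close>, and otherwise to \<open>S\<close> over \<open>A\<close>, where \<open>A\<close>
  is enlarged and the vector cancelled again.\<close>

lemma codim_le_split:
  assumes "codim_le V S h" "V \<subseteq> A" "A \<subseteq> S" "subspace A" "subspace S"
  shows "\<exists>j k. j + k \<le> h \<and> codim_le V A j \<and> codim_le A S k"
  using assms
proof (induction arbitrary: A rule: codim_le.induct)
  case (base S V h)
  then show ?case by (intro exI[of _ 0]) (auto intro: codim_le.base)
next
  case (step b S V h)
  show ?case
  proof (cases "b \<in> A")
    case True
    from step.IH[OF ext_subset[OF step.prems(3,1) True] step.prems(2,3,4)]
    obtain j k where "j + k \<le> h" "codim_le (ext V b) A j" "codim_le A S k" by blast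
    then show ?thesis using codim_le.step[OF True] by (metis add_Suc Suc_le_mono)
  next
    case False
    have T: "ext A b \<subseteq> S" using ext_subset[OF step.prems(4,2)] step(1) by simp
    from step.IH[OF ext_mono[OF step.prems(1)] T subspace_ext[OF step.prems(3)] step.prems(4)]
    obtain j k where jk: "j + k \<le> h" "codim_le (ext V b) (ext A b) j" "codim_le (ext A b) S k" by blast
    have "codim_le V A j" using codim_le_cancel[OF jk(2) refl refl step.prems(1,3) False] .
    moreover have "codim_le A S (Suc k)" using jk(3) step(1) by (rule codim_le.step[rotated])
    ultimately show ?thesis using jk(1) by (metis add_Suc_right Suc_le_mono)
  qed
qed

end

section \<open>Growth of the codimension of powers of a maximal ideal\<close>

global_interpretation pfs: codimension "scale_fun :: 'k::field \<Rightarrow> ('a \<Rightarrow> 'k) \<Rightarrow> 'a \<Rightarrow> 'k"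
  by (intro codimension.intro vector_space_scale_fun)

lemma scale_fun_mult: "scale_fun c f = (\<lambda>_. c) * f"
  by (simp add: scale_fun_def fun_eq_iff)

lemma ideal_subspace: "is_ideal polynomial_functions I \<Longrightarrow> pfs.subspace I"
  by (rule pfs.subspaceI) (auto simp: scale_fun_mult simp del: times_fun_apply
      intro: idealD(1,3) idealD(4)[OF _ polynomial_functions.const])

abbreviation gen :: "('k::field^'n \<Rightarrow> 'k) set \<Rightarrow> ('k^'n \<Rightarrow> 'k) set" where
  "gen A \<equiv> lin polynomial_functions A"

lemma gen_ideal: "A \<subseteq> polynomial_functions \<Longrightarrow> is_ideal polynomial_functions (gen A)"
  by (rule is_ideal_span[OF polynomial_functions_subring])

lemma gen_mono: "A \<subseteq> B \<Longrightarrow> gen A \<subseteq> gen B"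
  by (rule lin_mono) auto

lemma gen_superset: "A \<subseteq> gen A"
  using lin_base[OF pf(2)] by (metis mult_1 subsetI)

lemma gen_base: "x \<in> A \<Longrightarrow> x \<in> gen A"
  using gen_superset by blast

lemma gen_subset: "is_ideal polynomial_functions I \<Longrightarrow> A \<subseteq> I \<Longrightarrow> gen A \<subseteq> I"
  by (rule lin_subset_ideal) auto

lemma gen_of_ideal: "is_ideal polynomial_functions I \<Longrightarrow> gen I = I"
  using gen_subset gen_superset by blast

lemma gen_Un:
  assumes "x \<in> gen (A \<union> B)"
  shows "\<exists>y\<in>gen A. \<exists>z\<in>gen B. x = y + z"
  using assms
proof induction
  case zero
  then show ?case using lin.zero[of polynomial_functions A] lin.zero[of polynomial_functions B]
    by (metis add.right_neutral)
next
  case (step c a x)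
  then obtain y z where yz: "y \<in> gen A" "z \<in> gen B" "x = y + z" by blast
  have "c * a + x = (c * a + y) + z" "c * a + x = y + (c * a + z)" by (simp_all only: yz ac_simps)
  then show ?case using step(1,2) yz lin.step by (metis UnE)
qed

lemma mpow_subset_pf: "mpow p k \<subseteq> polynomial_functions"
  using mpow_idealD(2) by blast

lemma mpow_1_mult: "z \<in> mpow p 1 \<Longrightarrow> g \<in> mpow p k \<Longrightarrow> z * g \<in> mpow p (Suc k)"
  using mpow_mult[of z p 1 g k] by simp

lemma gen_mpow_mult:
  assumes A: "A \<subseteq> polynomial_functions" and z: "z \<in> mpow p 1" and x: "x \<in> gen (A \<union> mpow p k)"
  shows "z * x \<in> gen (A \<union> mpow p (Suc k))"
proof -
  have I: "is_ideal polynomial_functions (gen (A \<union> mpow p (Suc k)))"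
    using A mpow_subset_pf by (intro gen_ideal) blast
  obtain a b where ab: "a \<in> gen A" "b \<in> gen (mpow p k)" "x = a + b" using gen_Un[OF x] by blast
  have "a \<in> gen (A \<union> mpow p (Suc k))" using ab(1) gen_mono[of A "A \<union> mpow p (Suc k)"] by blast
  moreover have "z * b \<in> gen (A \<union> mpow p (Suc k))"
    using ab(2) mpow_1_mult[OF z] unfolding gen_of_ideal[OF mpow_ideal] by (intro gen_base) blast
  moreover have "z \<in> polynomial_functions" using z mpow_subset_pf by blast
  ultimately show ?thesis unfolding ab(3) distrib_left by (metis idealD(3)[OF I] idealD(4)[OF I])
qed

text \<open>Multiplication by \<open>z\<close> maps \<open>A\<close> plus \<open>mpow p k\<close>
  into \<open>A\<close> plus \<open>mpow p (Suc k)\<close>, and it covers the gap between the ideals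
  with and without the generator \<open>z\<close>. So this gap costs at most
  \<open>b\<close>.\<close>

lemma codim_le_Suc:
  assumes A: "A \<subseteq> polynomial_functions" and z: "z \<in> mpow p 1"
    and b: "pfs.codim_le (gen (A \<union> mpow p k)) polynomial_functions b"
    and a: "pfs.codim_le (gen (insert z A \<union> mpow p (Suc k))) polynomial_functions a"
  shows "pfs.codim_le (gen (A \<union> mpow p (Suc k))) polynomial_functions (b + a)"
proof (rule pfs.codim_le_trans[OF _ a])
  let ?V = "gen (A \<union> mpow p (Suc k))" and ?A = "gen (insert z A \<union> mpow p (Suc k))"
  have zp: "z \<in> polynomial_functions" using z mpow_subset_pf by blast
  have V: "is_ideal polynomial_functions ?V" using A mpow_subset_pf by (intro gen_ideal) blast
  have A': "is_ideal polynomial_functions ?A" using A zp mpow_subset_pf by (intro gen_ideal) blast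
  show "?A \<subseteq> polynomial_functions" using A' idealD(2) by blast
  have zA: "z \<in> ?A" by (rule gen_base) simp
  show "pfs.codim_le ?V ?A b"
  proof (rule pfs.codim_le_image[OF b, of "(*) z"])
    show "(*) z ` polynomial_functions \<subseteq> ?A" using idealD(5)[OF A' _ zA] by blast
    show "(*) z ` gen (A \<union> mpow p k) \<subseteq> ?V" using gen_mpow_mult[OF A z] by blast
    show "\<exists>v\<in>?V. \<exists>s\<in>polynomial_functions. a = v + z * s" if "a \<in> ?A" for a
    proof -
      have "a \<in> lin polynomial_functions (insert z (A \<union> mpow p (Suc k)))" using that by simp
      from lin_insert[OF this is_ideal_self[OF polynomial_functions_subring]]
      obtain c y where "c \<in> polynomial_functions" "y \<in> ?V" "a = c * z + y" by blast
      moreover from this have "a = y + z * c" by (simp only: ac_simps)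
      ultimately show ?thesis by blast
    qed
    show "pfs.subspace ?V" by (rule ideal_subspace[OF V])
  qed (simp_all add: scale_fun_mult algebra_simps del: times_fun_apply)
qed

text \<open>Each element of \<open>Z\<close> contributes one degree of growth: dropping
  \<open>z\<close> from the generators replaces the bound by a sum of \<open>k + 1\<close> such
  bounds, by iterating \<open>codim_le_Suc\<close>.\<close>

lemma codim_le_mpow:
  assumes "finite Z" "Z \<subseteq> mpow p 1" "A \<subseteq> polynomial_functions"
    and "\<And>k. pfs.codim_le (gen (A \<union> Z \<union> mpow p k)) polynomial_functions C"
  shows "pfs.codim_le (gen (A \<union> mpow p k)) polynomial_functions (C * (k + 1) ^ card Z)"
  using assms
proof (induction Z arbitrary: A k rule: finite_induct)
  case empty
  then show ?case by simp
next
  case (insert z Z)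
  let ?r = "card Z"
  have zA: "insert z A \<subseteq> polynomial_functions" using insert.prems mpow_subset_pf by blast
  have IH: "pfs.codim_le (gen (insert z A \<union> mpow p k)) polynomial_functions (C * (k + 1) ^ ?r)" for k
    using insert.prems zA by (intro insert.IH) auto
  have "pfs.codim_le (gen (A \<union> mpow p k)) polynomial_functions ((k + 1) * (C * (k + 1) ^ ?r))" for k
  proof (induction k)
    case 0
    show ?case by (intro pfs.codim_le.base) (auto intro: gen_base)
  next
    case (Suc k)
    have "z \<in> mpow p 1" using insert.prems by blast
    from codim_le_Suc[OF insert.prems(2) this Suc IH]
    show ?case
    proof (rule pfs.codim_le_mono)
      have "(k + 1) * (C * (k + 1) ^ ?r) \<le> (k + 1) * (C * (Suc k + 1) ^ ?r)"
        by (intro mult_le_mono power_mono) auto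
      then show "(k + 1) * (C * (k + 1) ^ ?r) + C * (Suc k + 1) ^ ?r \<le> (Suc k + 1) * (C * (Suc k + 1) ^ ?r)"
        by simp
    qed auto
  qed
  then show ?case using insert.hyps by (simp add: ac_simps)
qed

lemma codim_mpow_finite: "\<exists>h. pfs.codim_le (mpow p k) polynomial_functions h"
proof -
  let ?Z = "range (\<lambda>i q. q $ i - p $ i)"
  have "pfs.codim_le (gen ({} \<union> mpow p k)) polynomial_functions (1 * (k + 1) ^ card ?Z)"
  proof (rule codim_le_mpow)
    show "?Z \<subseteq> mpow p 1" unfolding mpow_1 using shifted_coord by auto
    show "pfs.codim_le (gen ({} \<union> ?Z \<union> mpow p k)) polynomial_functions 1" for k
    proof -
      have "gen ?Z = mpow p 1" by simp
      then have m1: "mpow p 1 \<subseteq> gen ({} \<union> ?Z \<union> mpow p k)" using gen_mono[of ?Z "{} \<union> ?Z \<union> mpow p k"] by simp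
      have "polynomial_functions \<subseteq> pfs.ext (mpow p 1) 1"
      proof
        fix f :: "'a^'b \<Rightarrow> 'a" assume "f \<in> polynomial_functions"
        then have "f - (\<lambda>q. f p) \<in> mpow p 1" unfolding mpow_1 by (auto intro: pf)
        moreover have "f = (f - (\<lambda>q. f p)) + scale_fun (f p) 1" by (simp add: scale_fun_def fun_eq_iff)
        ultimately show "f \<in> pfs.ext (mpow p 1) 1" unfolding pfs.ext_def by blast
      qed
      then have "pfs.codim_le (mpow p 1) polynomial_functions (Suc 0)"
        by (intro pfs.codim_le.step[of 1] pfs.codim_le.base) (auto intro: pf)
      then show ?thesis using m1 by (rule pfs.codim_le_mono) simp
    qed
  qed auto
  then show ?thesis by (auto simp: gen_of_ideal[OF mpow_ideal])
qed

section \<open>Growth of codimension along chains of primes\<close>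

definition cod :: "('k::field^'n \<Rightarrow> 'k) set \<Rightarrow> nat" where
  "cod V = (LEAST h. pfs.codim_le V polynomial_functions h)"

lemma cod_le: "pfs.codim_le V polynomial_functions h \<Longrightarrow> cod V \<le> h"
  unfolding cod_def by (rule Least_le)

text \<open>Containing some power of the maximal ideal is what keeps the \<open>LEAST\<close> in
  \<open>cod\<close> from ranging over an empty set.\<close>

lemma cod_attained:
  assumes "mpow p k \<subseteq> V" shows "pfs.codim_le V polynomial_functions (cod V)"
proof -
  obtain h where "pfs.codim_le (mpow p k) polynomial_functions h" using codim_mpow_finite by blast
  then have "pfs.codim_le V polynomial_functions h" using assms by (rule pfs.codim_le_mono) simp
  then show ?thesis unfolding cod_def by (rule LeastI)
qed

lemma cod_antimono: "mpow p k \<subseteq> V \<Longrightarrow> V \<subseteq> W \<Longrightarrow> cod W \<le> cod V"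
  by (rule cod_le[OF pfs.codim_le_mono[OF cod_attained _ order.refl]])

definition is_prime :: "('k::field^'n \<Rightarrow> 'k) set \<Rightarrow> bool" where
  "is_prime P \<longleftrightarrow> is_ideal polynomial_functions P \<and> P \<noteq> polynomial_functions \<and>
     (\<forall>f\<in>polynomial_functions. \<forall>g\<in>polynomial_functions. f * g \<in> P \<longrightarrow> f \<in> P \<or> g \<in> P)"

text \<open>Multiplication by \<open>x\<close> maps onto \<open>A\<close> modulo \<open>V\<close>,
  and whatever it sends into \<open>V\<close> lies in \<open>W\<close>, so the ring modulo
  \<open>W\<close> is no larger than \<open>A\<close> modulo \<open>V\<close>. This is the estimate
  opposite to \<open>codim_le_image\<close>.\<close>

lemma preimage_codim_le:
  fixes x :: "'k::field^'n \<Rightarrow> 'k"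
  assumes "pfs.codim_le V A h" "x \<in> polynomial_functions"
    and "\<And>g. g \<in> polynomial_functions \<Longrightarrow> x * g \<in> V \<Longrightarrow> g \<in> W"
    and "A = {v + x * s | v s. v \<in> V \<and> s \<in> polynomial_functions}"
    and "pfs.subspace V"
  shows "pfs.codim_le W polynomial_functions h"
  using assms
proof (induction arbitrary: W rule: pfs.codim_le.induct)
  case (base A V h)
  have "polynomial_functions \<subseteq> W"
  proof
    fix g :: "'k^'n \<Rightarrow> 'k" assume g: "g \<in> polynomial_functions"
    have "0 + x * g \<in> A" unfolding base(4) using g pfs.subspace_0[OF base(5)] by blast
    then have "x * g \<in> V" using base(1) by (metis add_0 subsetD)
    then show "g \<in> W" by (rule base(3)[OF g])
  qed
  then show ?case by (rule pfs.codim_le.base)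
next
  case (step b A V h)
  then obtain v s where vs: "v \<in> V" "s \<in> polynomial_functions" "b = v + x * s" by blast
  note sv = step.prems(4)
  have "pfs.codim_le (pfs.ext W s) polynomial_functions h"
  proof (rule step.IH[OF step.prems(1)])
    show "pfs.subspace (pfs.ext V b)" by (rule pfs.subspace_ext[OF sv])
    show "g \<in> pfs.ext W s" if g: "g \<in> polynomial_functions" "x * g \<in> pfs.ext V b" for g
    proof -
      obtain w c where w: "w \<in> V" "x * g = w + scale_fun c b" using g(2) by (auto simp: pfs.ext_def)
      have "x * (g - scale_fun c s) = w + scale_fun c v"
        using w(2) by (simp add: vs scale_fun_mult algebra_simps del: times_fun_apply)
      then have "x * (g - scale_fun c s) \<in> V"
        using w(1) vs(1) sv by (metis pfs.subspace_add pfs.subspace_scale)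
      moreover have "g - scale_fun c s \<in> polynomial_functions"
        using g vs by (auto simp: scale_fun_mult simp del: times_fun_apply intro!: pf(3,4) polynomial_functions.const)
      ultimately have "g - scale_fun c s \<in> W" by (rule step.prems(2)[rotated])
      moreover have "g = (g - scale_fun c s) + scale_fun c s" by simp
      ultimately show ?thesis unfolding pfs.ext_def by blast
    qed
    show "A = {w + x * t | w t. w \<in> pfs.ext V b \<and> t \<in> polynomial_functions}"
    proof (intro set_eqI iffI)
      fix a assume "a \<in> A"
      then show "a \<in> {w + x * t | w t. w \<in> pfs.ext V b \<and> t \<in> polynomial_functions}"
        using step.prems(3) pfs.subset_ext by blast
    next
      fix a assume "a \<in> {w + x * t | w t. w \<in> pfs.ext V b \<and> t \<in> polynomial_functions}"
      then obtain w c t where w: "w \<in> V" "t \<in> polynomial_functions" "a = (w + scale_fun c b) + x * t"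
        by (auto simp: pfs.ext_def)
      have "a = (w + scale_fun c v) + x * (scale_fun c s + t)"
        by (simp add: w vs scale_fun_mult algebra_simps del: times_fun_apply)
      moreover have "w + scale_fun c v \<in> V" using w vs sv by (metis pfs.subspace_add pfs.subspace_scale)
      moreover have "scale_fun c s + t \<in> polynomial_functions"
        using w vs by (auto simp: scale_fun_mult simp del: times_fun_apply plus_fun_apply intro!: pf(4,6) polynomial_functions.const)
      ultimately show "a \<in> A" unfolding step.prems(3) by blast
    qed
  qed
  then show ?case using vs(2) by (intro pfs.codim_le.step)
qed

text \<open>For \<open>x\<close> in \<open>P\<close> outside \<open>P'\<close>, insert between
  \<open>P'\<close> plus \<open>mpow p (k + c)\<close> and the ring the ideal \<open>B\<close> that
  also contains \<open>x\<close>. The upper part is at least the codimension for \<open>P\<close>;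
  the lower part is an image of multiplication by \<open>x\<close>, whose kernel lies in
  \<open>P'\<close> plus \<open>mpow p k\<close>. The shift \<open>c\<close> is the Artin-Rees
  constant.\<close>

lemma cod_add_le:
  assumes P: "is_ideal polynomial_functions P" and P': "is_prime P'" and PP: "P' \<subset> P"
  shows "\<exists>c. \<forall>k. cod (gen (P \<union> mpow p (k + c))) + cod (gen (P' \<union> mpow p k)) \<le> cod (gen (P' \<union> mpow p (k + c)))"
proof -
  have I': "is_ideal polynomial_functions P'" using P' by (simp add: is_prime_def)
  obtain x where x: "x \<in> P" "x \<notin> P'" using PP by blast
  have xp: "x \<in> polynomial_functions" using idealD(2)[OF P x(1)] .
  have P'p: "P' \<subseteq> polynomial_functions" and Pp: "P \<subseteq> polynomial_functions"
    using I' P by (auto simp: is_ideal_def)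
  let ?I = "gen (insert x P')"
  have "is_ideal polynomial_functions ?I" using xp P'p by (intro gen_ideal) auto
  then obtain c where c: "\<And>k. ?I \<inter> mpow p (k + c) \<subseteq> lin (mpow p k) ?I" using artin_rees by blast
  have dec: "\<exists>q\<in>P'. \<exists>t\<in>polynomial_functions. y = q + x * t" if "y \<in> ?I" for y
  proof -
    note lin_insert[OF that is_ideal_self[OF polynomial_functions_subring]]
    then obtain t q where "t \<in> polynomial_functions" "q \<in> gen P'" "y = t * x + q" by blast
    moreover from this have "y = q + x * t" by (simp only: ac_simps)
    ultimately show ?thesis using gen_of_ideal[OF I'] by blast
  qed
  have dec2: "\<exists>q\<in>P'. \<exists>t\<in>mpow p k. y = q + x * t" if "y \<in> lin (mpow p k) ?I" for y k
    using that
  proof induction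
    case zero
    then show ?case using idealD(1)[OF I'] mpow_idealD(1)[of p k] by (intro bexI[of _ 0]) auto
  next
    case (step d a y)
    obtain q t where qt: "q \<in> P'" "t \<in> mpow p k" "y = q + x * t" using step by blast
    obtain r u where ru: "r \<in> P'" "u \<in> polynomial_functions" "a = r + x * u" using dec[OF step(2)] by blast
    have "d * a + y = (d * r + q) + x * (d * u + t)"
      unfolding qt ru by (simp add: algebra_simps del: times_fun_apply)
    moreover have "d * r + q \<in> P'" using step(1) mpow_subset_pf qt ru by (intro idealD(3)[OF I'] idealD(4)[OF I']) auto
    moreover have "d * u + t \<in> mpow p k" using step(1) qt ru by (intro mpow_idealD(3) mpow_idealD(5))
    ultimately show ?case by blast
  qed
  have "cod (gen (P \<union> mpow p (k + c))) + cod (gen (P' \<union> mpow p k)) \<le> cod (gen (P' \<union> mpow p (k + c)))" for k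
  proof -
    let ?V = "gen (P' \<union> mpow p (k + c))" and ?A = "gen (P \<union> mpow p (k + c))"
    have V: "is_ideal polynomial_functions ?V" using P'p mpow_subset_pf by (intro gen_ideal) blast
    have A: "is_ideal polynomial_functions ?A" using Pp mpow_subset_pf by (intro gen_ideal) blast
    define B where "B = {v + x * s | v s. v \<in> ?V \<and> s \<in> polynomial_functions}"
    have VA: "?V \<subseteq> ?A" using PP by (intro gen_mono) blast
    have "x \<in> ?A" using x by (intro gen_base) simp
    then have BA: "B \<subseteq> ?A" unfolding B_def using VA by (auto simp del: plus_fun_apply times_fun_apply intro!: idealD(3)[OF A] idealD(5)[OF A])
    have "?V \<subseteq> B" unfolding B_def using pf(1) by (force simp del: times_fun_apply plus_fun_apply)
    have "B = gen (insert x (P' \<union> mpow p (k + c)))"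
    proof (intro set_eqI iffI)
      let ?G = "gen (insert x (P' \<union> mpow p (k + c)))"
      fix b assume "b \<in> B"
      moreover have G: "is_ideal polynomial_functions ?G" using P'p mpow_subset_pf xp by (intro gen_ideal) blast
      moreover have "x \<in> ?G" by (rule gen_base) simp
      moreover have "?V \<subseteq> ?G" by (intro gen_mono) blast
      ultimately show "b \<in> ?G" unfolding B_def
        by (auto simp del: plus_fun_apply times_fun_apply intro!: idealD(3)[OF G] idealD(5)[OF G])
    next
      fix b assume "b \<in> gen (insert x (P' \<union> mpow p (k + c)))"
      from lin_insert[OF this is_ideal_self[OF polynomial_functions_subring]]
      obtain t q where "t \<in> polynomial_functions" "q \<in> ?V" "b = t * x + q" by blast
      moreover from this have "b = q + x * t" by (simp only: ac_simps)
      ultimately show "b \<in> B" unfolding B_def by blast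
    qed
    then have B: "is_ideal polynomial_functions B" using P'p mpow_subset_pf xp by (auto intro!: gen_ideal)
    have mV: "mpow p (k + c) \<subseteq> ?V" by (auto intro: gen_base)
    have Spf: "pfs.subspace (polynomial_functions :: ('a^'b \<Rightarrow> 'a) set)"
      by (rule ideal_subspace[OF is_ideal_self[OF polynomial_functions_subring]])
    obtain h1 h2 where h: "h1 + h2 \<le> cod ?V" "pfs.codim_le ?V B h1" "pfs.codim_le B polynomial_functions h2"
      using pfs.codim_le_split[OF cod_attained[OF mV] \<open>?V \<subseteq> B\<close> _ ideal_subspace[OF B] Spf] idealD(2)[OF B] by blast
    have "cod ?A \<le> h2" using pfs.codim_le_mono[OF h(3) BA order.refl] by (rule cod_le)
    moreover have "pfs.codim_le (gen (P' \<union> mpow p k)) polynomial_functions h1"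
    proof (rule preimage_codim_le[OF h(2) xp _ B_def ideal_subspace[OF V]])
      fix g :: "'a^'b \<Rightarrow> 'a" assume g: "g \<in> polynomial_functions" "x * g \<in> ?V"
      obtain y z where yz: "y \<in> P'" "z \<in> mpow p (k + c)" "x * g = y + z"
        using gen_Un[OF g(2)] gen_of_ideal[OF I'] gen_of_ideal[OF mpow_ideal] by blast
      have "z = g * x + (- 1) * y" using yz(3) by (simp add: algebra_simps)
      also have "\<dots> \<in> ?I" using g(1) yz(1)
        by (intro lin_add lin_base pf(5) pf(2)) auto
      \<comment> \<open>Artin-Rees writes the error term \<open>z\<close> as an element of
        \<open>P'\<close> plus \<open>x * t\<close> with \<open>t\<close> in
        \<open>mpow p k\<close>; then \<open>x\<close> can be cancelled modulo the prime
        \<open>P'\<close>.\<close>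
      finally obtain q t where qt: "q \<in> P'" "t \<in> mpow p k" "z = q + x * t" using c yz(2) dec2 by blast
      have gt: "g - t \<in> polynomial_functions" using g(1) qt(2) mpow_subset_pf by (intro pf(3)) auto
      have "x * (g - t) = y + q" using yz(3) qt(3) by (simp add: algebra_simps del: times_fun_apply)
      then have "x * (g - t) \<in> P'" using idealD(3)[OF I' yz(1) qt(1)] by metis
      then have "g - t \<in> P'" using P' xp x(2) gt unfolding is_prime_def by blast
      then have "g - t \<in> gen (P' \<union> mpow p k)" "t \<in> gen (P' \<union> mpow p k)" using qt(2) by (simp_all add: gen_base)
      from lin_add[OF this] show "g \<in> gen (P' \<union> mpow p k)" by simp
    qed
    then have "cod (gen (P' \<union> mpow p k)) \<le> h1" by (rule cod_le)
    ultimately show ?thesis using h(1) by linarith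
  qed
  then show ?thesis by blast
qed

text \<open>By \<open>cod_add_le\<close>, the differences of the codimension for the smaller prime
  are bounded below by the codimension for the larger one. Summation raises the degree of growth by
  one for each link of the chain.\<close>

lemma codim_growth:
  assumes "\<And>i. i \<le> e \<Longrightarrow> is_prime (P i)" "\<And>i. i < e \<Longrightarrow> P (Suc i) \<subset> P i" "P 0 \<subseteq> mpow p 1"
  shows "\<exists>C\<ge>1. \<forall>m\<ge>1. m ^ e \<le> cod (gen (P e \<union> mpow p (C * m)))"
  using assms
proof (induction e)
  case 0
  have "1 \<le> cod (gen (P 0 \<union> mpow p (1 * m)))" if "m \<ge> 1" for m
  proof (rule ccontr)
    let ?V = "gen (P 0 \<union> mpow p (1 * m))"
    assume "\<not> 1 \<le> cod ?V"
    moreover have "mpow p m \<subseteq> ?V" by (auto intro: gen_base)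
    ultimately have "pfs.codim_le ?V polynomial_functions 0" using cod_attained[of p m ?V] by (simp add: not_le)
    then have "polynomial_functions \<subseteq> ?V" by (cases rule: pfs.codim_le.cases) auto
    moreover have "?V \<subseteq> mpow p 1" using 0(3) mpow_antimono[OF that] by (intro gen_subset mpow_ideal) auto
    ultimately have "1 \<in> mpow p 1" using pf(2) by blast
    then show False unfolding mpow_1 by simp
  qed
  then show ?case by (intro exI[of _ 1]) auto
next
  case (Suc e)
  then obtain C where C: "C \<ge> 1" "\<And>m. m \<ge> 1 \<Longrightarrow> m ^ e \<le> cod (gen (P e \<union> mpow p (C * m)))" by auto
  have "is_ideal polynomial_functions (P e)" using Suc.prems(1)[of e] by (simp add: is_prime_def)
  from cod_add_le[OF this Suc.prems(1)[of "Suc e"] Suc.prems(2)[of e]]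
  obtain c0 where c0: "\<And>k. cod (gen (P e \<union> mpow p (k + c0))) + cod (gen (P (Suc e) \<union> mpow p k))
      \<le> cod (gen (P (Suc e) \<union> mpow p (k + c0)))" by auto
  define H H' where "H k = cod (gen (P e \<union> mpow p k))" and "H' k = cod (gen (P (Suc e) \<union> mpow p k))" for k
  have mono: "H i \<le> H j" "H' i \<le> H' j" if "i \<le> j" for i j
  proof -
    have "cod (gen (Q \<union> mpow p i)) \<le> cod (gen (Q \<union> mpow p j))" for Q
      using mpow_antimono[OF that, of p] gen_superset[of "Q \<union> mpow p j"]
      by (intro cod_antimono[of p j] gen_mono) auto
    then show "H i \<le> H j" "H' i \<le> H' j" by (simp_all add: H_def H'_def)
  qed
  \<comment> \<open>The successor makes the step length positive, so that \<open>(M + j) * c\<close>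
    is at least \<open>M\<close> below.\<close>
  define c where "c = Suc c0"
  have c: "H (k + c) + H' k \<le> H' (k + c)" for k
  proof -
    have "H (k + 1 + c0) + H' (k + 1) \<le> H' (k + 1 + c0)" unfolding H_def H'_def by (rule c0)
    then show ?thesis using mono(2)[of k "k + 1"] by (simp add: c_def)
  qed
  \<comment> \<open>Sums the difference inequality over \<open>j\<close> steps of length
    \<open>c\<close>, each of which contributes at least \<open>H M\<close>.\<close>
  have *: "j * H M \<le> H' ((M + j) * c)" for j M
  proof (induction j)
    case (Suc j)
    have "H M \<le> H ((M + j) * c + c)" by (rule mono(1)) (simp add: c_def)
    then show ?case using c[of "(M + j) * c"] Suc by (simp add: add.commute)
  qed simp
  have "m ^ Suc e \<le> cod (gen (P (Suc e) \<union> mpow p (2 * c * C * m)))" if "m \<ge> 1" for m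
  proof -
    \<comment> \<open>\<open>C * m\<close> serves both as the starting point and as the number of
      steps; the latter gives the additional factor \<open>m\<close>.\<close>
    have "m * m ^ e \<le> (C * m) * H (C * m)"
      using C that unfolding H_def by (intro mult_mono) auto
    also have "\<dots> \<le> H' ((C * m + C * m) * c)" by (rule *)
    also have "(C * m + C * m) * c = 2 * c * C * m" by (simp add: algebra_simps)
    finally show ?thesis by (simp add: H'_def)
  qed
  moreover have "2 * c * C \<ge> 1" using C by (simp add: c_def)
  ultimately show ?case by blast
qed

text \<open>Two growth rates collide. Modulo \<open>A\<close> and \<open>Z\<close> the powers of the
  maximal ideal stabilize, so the codimension for \<open>A\<close> alone grows at most with degree
  \<open>card Z\<close>; since \<open>A\<close> lies in \<open>P e\<close>, the chain makes it grow
  at least with degree \<open>e\<close>.\<close>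

theorem chain_length_le_parameters:
  assumes P: "\<And>i. i \<le> e \<Longrightarrow> is_prime (P i)" "\<And>i. i < e \<Longrightarrow> P (Suc i) \<subset> P i" "P 0 \<subseteq> mpow p 1"
    and A: "A \<subseteq> P e" and Z: "finite Z" "Z \<subseteq> mpow p 1"
    and s: "mpow p s \<subseteq> gen (A \<union> Z \<union> mpow p (Suc s))"
  shows "e \<le> card Z"
proof (rule ccontr)
  assume less: "\<not> e \<le> card Z"
  have "is_ideal polynomial_functions (P e)" using P(1) by (simp add: is_prime_def)
  then have Ap: "A \<subseteq> polynomial_functions" using A idealD(2) by blast
  have AZ: "A \<union> Z \<subseteq> polynomial_functions" using Ap Z(2) mpow_subset_pf by blast
  \<comment> \<open>Multiplying the inclusion by coordinate differences moves it to every higher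
    power. Chained together, these inclusions put \<open>mpow p s\<close> into the ideal of
    \<open>A\<close> and \<open>Z\<close> modulo arbitrarily high powers.\<close>
  have step: "mpow p (s + j) \<subseteq> gen (A \<union> Z \<union> mpow p (Suc (s + j)))" for j
  proof (induction j)
    case (Suc j)
    have *: "c * a \<in> gen (A \<union> Z \<union> mpow p (Suc (Suc (s + j))))"
      if "c \<in> mpow p (s + j)" "a \<in> range (\<lambda>i q. q $ i - p $ i)" for c a
    proof -
      have "a \<in> mpow p 1" unfolding mpow_1 using that shifted_coord by auto
      then show ?thesis using gen_mpow_mult[OF AZ _ subsetD[OF Suc that(1)]] by (simp only: mult.commute)
    qed
    have "x \<in> gen (A \<union> Z \<union> mpow p (Suc (Suc (s + j))))"
      if "x \<in> lin (mpow p (s + j)) (range (\<lambda>i q. q $ i - p $ i))" for x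
      using that
    proof induction
      case (step c a x)
      show ?case by (rule lin_add[OF *[OF step(1,2)] step(4)])
    qed (rule lin.zero)
    then show ?case unfolding add_Suc_right mpow.simps(2)[of p "s + j"] by blast
  qed (use s in simp)
  have sub: "mpow p s \<subseteq> gen (A \<union> Z \<union> mpow p (s + j))" for j
  proof (induction j)
    case 0
    then show ?case by (auto intro: gen_base)
  next
    case (Suc j)
    have "gen (A \<union> Z \<union> mpow p (s + j)) \<subseteq> gen (A \<union> Z \<union> mpow p (Suc (s + j)))"
      using step[of j] gen_superset[of "A \<union> Z \<union> mpow p (Suc (s + j))"] AZ mpow_subset_pf
      by (intro gen_subset gen_ideal) blast+
    then show ?case using Suc by auto
  qed
  obtain K where K: "pfs.codim_le (mpow p s) polynomial_functions K" using codim_mpow_finite by blast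
  have "pfs.codim_le (gen (A \<union> Z \<union> mpow p k)) polynomial_functions K" for k
  proof (rule pfs.codim_le_mono[OF K _ order.refl])
    show "mpow p s \<subseteq> gen (A \<union> Z \<union> mpow p k)"
    proof (cases "k \<le> s")
      case True
      then show ?thesis using mpow_antimono[OF True, of p] gen_superset[of "A \<union> Z \<union> mpow p k"] by blast
    qed (use sub[of "k - s"] in simp)
  qed
  from codim_le_mpow[OF Z Ap this]
  have up: "cod (gen (A \<union> mpow p k)) \<le> K * (k + 1) ^ card Z" for k by (rule cod_le)
  obtain C where C: "C \<ge> 1" "\<And>m. m \<ge> 1 \<Longrightarrow> m ^ e \<le> cod (gen (P e \<union> mpow p (C * m)))"
    using codim_growth[OF P] by blast
  \<comment> \<open>Exceeds the constant left over when the upper bound at \<open>C * m\<close> is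
    compared with \<open>m ^ card Z\<close>.\<close>
  define m where "m = K * (C + 1) ^ card Z + 1"
  have m1: "m \<ge> 1" by (simp add: m_def)
  have "m ^ Suc (card Z) \<le> m ^ e" using less m1 by (intro power_increasing) auto
  also have "\<dots> \<le> cod (gen (P e \<union> mpow p (C * m)))" by (rule C(2)[OF m1])
  also have "\<dots> \<le> cod (gen (A \<union> mpow p (C * m)))"
    using gen_superset[of "A \<union> mpow p (C * m)"] A by (intro cod_antimono[of p "C * m"] gen_mono) auto
  also have "\<dots> \<le> K * (C * m + 1) ^ card Z" by (rule up)
  also have "\<dots> \<le> K * ((C + 1) * m) ^ card Z" using m1 by (intro mult_le_mono power_mono) auto
  also have "\<dots> = (K * (C + 1) ^ card Z) * m ^ card Z" by (simp only: power_mult_distrib mult.assoc)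
  also have "\<dots> < m * m ^ card Z" using m1 by (simp add: m_def)
  finally show False by simp
qed

section \<open>Directional derivatives and tangent vectors\<close>

lemma infinite_alg_closed: "infinite (UNIV :: 'k::alg_closed_field set)"
proof
  assume fin: "finite (UNIV :: 'k set)"
  let ?p = "(\<Prod>a\<in>(UNIV::'k set). [:- a, 1:]) + 1"
  have d: "degree (\<Prod>a\<in>(UNIV::'k set). [:- a, 1:]) = card (UNIV :: 'k set)"
    by (subst degree_prod_eq_sum_degree) auto
  have "card (UNIV :: 'k set) > 0" using fin by (simp add: card_gt_0_iff)
  then have "degree ?p > 0" using d by (subst degree_add_eq_left) auto
  then obtain x where "poly ?p x = 0" using alg_closed_imp_poly_has_root by blast
  moreover have "poly (\<Prod>a\<in>(UNIV::'k set). [:- a, 1:]) x = 0"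
    using fin by (auto simp: poly_prod)
  ultimately show False by simp
qed

lemma poly_ext: "(\<And>t. poly P t = poly Q t) \<Longrightarrow> P = (Q :: 'k::alg_closed_field poly)"
proof (rule ccontr)
  assume *: "\<And>t. poly P t = poly Q t" "P \<noteq> Q"
  then have "finite {t. poly (P - Q) t = 0}" by (intro poly_roots_finite) simp
  moreover have "{t. poly (P - Q) t = 0} = UNIV" using * by simp
  ultimately show False using infinite_alg_closed[where 'k='k] by simp
qed

text \<open>Polynomials occur only as functions, so the derivative is read off from the restriction
  to a line. Over an infinite field this restriction determines its polynomial, which makes the
  \<open>THE\<close> well defined for polynomial functions.\<close>

definition ddir :: "('k::alg_closed_field^'n \<Rightarrow> 'k) \<Rightarrow> 'k^'n \<Rightarrow> 'k^'n \<Rightarrow> 'k" where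
  "ddir f q v = coeff (THE P. \<forall>t. poly P t = f (q + t *s v)) 1"

lemma ddirI:
  assumes "\<And>t. poly P t = f (q + t *s v)" shows "ddir f q v = coeff P 1"
proof -
  have "(THE P. \<forall>t. poly P t = f (q + t *s v)) = P"
    using assms by (intro the_equality) (auto intro: poly_ext)
  then show ?thesis by (simp add: ddir_def)
qed

lemma line_poly: "f \<in> polynomial_functions \<Longrightarrow> \<exists>P. \<forall>t. poly P t = f (q + t *s v)"
proof (induction rule: polynomial_functions.induct)
  case (const c)
  show ?case by (intro exI[of _ "[:c:]"]) simp
next
  case (coordinate i)
  show ?case by (intro exI[of _ "[:q $ i, v $ i:]"]) simp
next
  case (add f g)
  then obtain P Q where "\<forall>t. poly P t = f (q + t *s v)" "\<forall>t. poly Q t = g (q + t *s v)" by blast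
  then show ?case by (intro exI[of _ "P + Q"]) simp
next
  case (mult f g)
  then obtain P Q where "\<forall>t. poly P t = f (q + t *s v)" "\<forall>t. poly Q t = g (q + t *s v)" by blast
  then show ?case by (intro exI[of _ "P * Q"]) simp
qed

lemma ddir_const: "ddir (\<lambda>p. c) q v = 0"
  by (subst ddirI[of "[:c:]"]) auto

lemma ddir_coord: "ddir (\<lambda>p. p $ i) q v = v $ i"
  by (subst ddirI[of "[:q $ i, v $ i:]"]) auto

lemma ddir_add:
  assumes "f \<in> polynomial_functions" "g \<in> polynomial_functions"
  shows "ddir (\<lambda>p. f p + g p) q v = ddir f q v + ddir g q v"
proof -
  obtain P Q where PQ: "\<And>t. poly P t = f (q + t *s v)" "\<And>t. poly Q t = g (q + t *s v)"
    using line_poly assms by metis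
  show ?thesis by (subst ddirI[of "P + Q"]) (simp_all add: PQ ddirI[OF PQ(1)] ddirI[OF PQ(2)])
qed

lemma ddir_mult:
  assumes "f \<in> polynomial_functions" "g \<in> polynomial_functions"
  shows "ddir (\<lambda>p. f p * g p) q v = f q * ddir g q v + g q * ddir f q v"
proof -
  obtain P Q where PQ: "\<And>t. poly P t = f (q + t *s v)" "\<And>t. poly Q t = g (q + t *s v)"
    using line_poly assms by metis
  have "poly P 0 = f q" "poly Q 0 = g q" by (simp_all add: PQ)
  then have 0: "coeff P 0 = f q" "coeff Q 0 = g q" by (simp_all add: poly_0_coeff_0)
  show ?thesis
    by (subst ddirI[of "P * Q"]) (simp_all add: PQ ddirI[OF PQ(1)] ddirI[OF PQ(2)] coeff_mult 0 mult.commute)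
qed

lemma ddir_plus:
  "f \<in> polynomial_functions \<Longrightarrow> g \<in> polynomial_functions \<Longrightarrow> ddir (f + g) q v = ddir f q v + ddir g q v"
  using ddir_add[of f g q v] by (simp add: plus_fun_def)

lemma ddir_times:
  "f \<in> polynomial_functions \<Longrightarrow> g \<in> polynomial_functions \<Longrightarrow>
    ddir (f * g) q v = f q * ddir g q v + g q * ddir f q v"
  using ddir_mult[of f g q v] by (simp add: times_fun_def)

lemma ddir_zero [simp]: "ddir 0 q v = 0"
  using ddir_const[of 0 q v] by simp

lemma ddir_sum: "(\<And>i. i \<in> A \<Longrightarrow> f i \<in> polynomial_functions) \<Longrightarrow> ddir (sum f A) q v = (\<Sum>i\<in>A. ddir (f i) q v)"
  by (induction A rule: infinite_finite_induct) (auto simp: ddir_plus pf)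

section \<open>Gradients and first-order expansion\<close>

definition grad :: "('k::alg_closed_field^'n \<Rightarrow> 'k) \<Rightarrow> 'k^'n \<Rightarrow> 'k^'n" where
  "grad f q = (\<chi> i. ddir f q (axis i 1))"

definition dot :: "'k::field^'n \<Rightarrow> 'k^'n \<Rightarrow> 'k" where
  "dot a v = (\<Sum>i\<in>UNIV. a $ i * v $ i)"

lemma dot_add_right: "dot a (v + w) = dot a v + dot a w"
  by (simp add: dot_def distrib_left sum.distrib)

lemma dot_scale_right: "dot a (c *s v) = c * dot a v"
  by (simp add: dot_def sum_distrib_left mult.left_commute)

lemma dot_add_left: "dot (a + b) v = dot a v + dot b v"
  by (simp add: dot_def distrib_right sum.distrib)

lemma dot_scale_left: "dot (c *s a) v = c * dot a v"
  by (simp add: dot_def sum_distrib_left mult.assoc)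

lemma dot_zero [simp]: "dot 0 v = 0" "dot a 0 = 0"
  by (simp_all add: dot_def)

lemma dot_span: "a \<in> vec.span B \<Longrightarrow> (\<And>b. b \<in> B \<Longrightarrow> dot b v = 0) \<Longrightarrow> dot a v = 0"
  by (induction rule: vec.span_induct_alt) (auto simp: dot_add_left dot_scale_left)

lemma ddir_grad: "f \<in> polynomial_functions \<Longrightarrow> ddir f q v = dot (grad f q) v"
proof (induction rule: polynomial_functions.induct)
  case (coordinate i)
  show ?case by (simp add: dot_def grad_def ddir_coord axis_def if_distrib[of "\<lambda>x. x * _"] cong: if_cong)
next
  case (add f g)
  then have "grad (\<lambda>p. f p + g p) q = grad f q + grad g q" by (simp add: grad_def ddir_add vec_eq_iff)
  then show ?case using add by (simp add: ddir_add dot_add_left)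
next
  case (mult f g)
  then have "grad (\<lambda>p. f p * g p) q = f q *s grad g q + g q *s grad f q"
    by (simp add: grad_def ddir_mult vec_eq_iff)
  then show ?case using mult by (simp add: ddir_mult dot_add_left dot_scale_left)
qed (simp add: dot_def grad_def ddir_const)

lemma ddir_polynomial:
  assumes "\<And>i. (\<lambda>q. w q $ i) \<in> polynomial_functions" "f \<in> polynomial_functions"
  shows "(\<lambda>q. ddir f q (w q)) \<in> polynomial_functions"
  using assms(2)
  by induction (simp_all add: ddir_const ddir_coord ddir_add ddir_mult assms(1) polynomial_functions.intros
    del: zero_fun_eta)

lemma grad_polynomial: "f \<in> polynomial_functions \<Longrightarrow> (\<lambda>q. grad f q $ j) \<in> polynomial_functions"
  unfolding grad_def by (auto intro!: ddir_polynomial polynomial_functions.const)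

definition linear_at :: "'k::field^'n \<Rightarrow> 'k^'n \<Rightarrow> 'k^'n \<Rightarrow> 'k" where
  "linear_at p a q = (\<Sum>j\<in>UNIV. a $ j * (q $ j - p $ j))"

lemma linear_at_eq: "linear_at p a = (\<Sum>j\<in>UNIV. (\<lambda>_. a $ j) * (\<lambda>q. q $ j - p $ j))"
proof
  have "(\<Sum>j\<in>A. (\<lambda>_. a $ j) * (\<lambda>q. q $ j - p $ j)) q = (\<Sum>j\<in>A. a $ j * (q $ j - p $ j))" for q A
    by (induction A rule: infinite_finite_induct) simp_all
  then show "linear_at p a q = (\<Sum>j\<in>UNIV. (\<lambda>_. a $ j) * (\<lambda>q. q $ j - p $ j)) q" for q
    by (simp add: linear_at_def)
qed

lemma linear_at_polynomial: "linear_at p a \<in> polynomial_functions"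
  unfolding linear_at_eq by (intro pf(7) pf(4) polynomial_functions.const shifted_coord)

lemma linear_at_zero [simp]: "linear_at p a p = 0"
  by (simp add: linear_at_def)

lemma grad_linear_at [simp]: "grad (linear_at p a) q = a"
proof -
  have "ddir (linear_at p a) q v = dot a v" for v
  proof -
    have "poly [:linear_at p a q, dot a v:] t = linear_at p a (q + t *s v)" for t
      by (simp add: linear_at_def dot_def sum_distrib_left sum.distrib[symmetric] algebra_simps)
    from ddirI[OF this] show ?thesis by simp
  qed
  then show ?thesis
    by (simp add: grad_def dot_def axis_def vec_eq_iff if_distrib[of "\<lambda>x. _ * x"] cong: if_cong)
qed

lemma taylor:
  assumes "f \<in> polynomial_functions"
  shows "f - (\<lambda>_. f p) - linear_at p (grad f p) \<in> mpow p 2"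
proof -
  note m = idealD[OF mpow_ideal[of p 2]]
  define T where "T f = f - (\<lambda>_. f p) - linear_at p (grad f p)" for f :: "'a^'b \<Rightarrow> 'a"
  have lin: "linear_at p (a + b) = linear_at p a + linear_at p b"
    "linear_at p (c *s a) = (\<lambda>_. c) * linear_at p a" for a b c
    by (auto simp: linear_at_def fun_eq_iff distrib_right sum.distrib sum_distrib_left mult.assoc)
  have "T f \<in> mpow p 2" using assms
  proof induction
    case (const c)
    have "T (\<lambda>p. c) = 0"
      by (auto simp: T_def fun_eq_iff linear_at_def grad_def ddir_const)
    then show ?case using m(1) by simp
  next
    case (coordinate i)
    have "T (\<lambda>q. q $ i) = 0"
      by (auto simp: T_def fun_eq_iff linear_at_def grad_def ddir_coord axis_def
          if_distrib[of "\<lambda>x. x * _"] cong: if_cong)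
    then show ?case using m(1) by simp
  next
    case (add f g)
    have "grad (\<lambda>p. f p + g p) p = grad f p + grad g p" using add by (simp add: grad_def ddir_add vec_eq_iff)
    then have "T (\<lambda>p. f p + g p) = T f + T g" unfolding T_def by (auto simp: lin fun_eq_iff)
    then show ?case using m(3)[OF add.IH] by metis
  next
    case (mult f g)
    have "grad (\<lambda>p. f p * g p) p = f p *s grad g p + g p *s grad f p"
      using mult by (simp add: grad_def ddir_mult vec_eq_iff)
    \<comment> \<open>The first summand is a product of two functions vanishing at \<open>p\<close>,
      hence of second order.\<close>
    then have eq: "T (\<lambda>p. f p * g p) = (f - (\<lambda>_. f p)) * (g - (\<lambda>_. g p)) + ((\<lambda>_. f p) * T g + (\<lambda>_. g p) * T f)"
      unfolding T_def by (auto simp: lin fun_eq_iff algebra_simps)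
    have "f - (\<lambda>_. f p) \<in> mpow p 1" "g - (\<lambda>_. g p) \<in> mpow p 1"
      unfolding mpow_1 using mult by (auto intro!: pf(3) polynomial_functions.const)
    from mpow_mult[OF this] have m1: "(f - (\<lambda>_. f p)) * (g - (\<lambda>_. g p)) \<in> mpow p 2" by (simp only: one_add_one)
    have "(\<lambda>_. f p) * T g + (\<lambda>_. g p) * T f \<in> mpow p 2"
      by (intro m(3) m(4) mult polynomial_functions.const)
    then show ?case unfolding eq by (rule m(3)[OF m1])
  qed
  then show ?thesis by (simp add: T_def)
qed

section \<open>Tangent spaces and adapted coordinates\<close>

definition vanishing :: "('k::field^'n) set \<Rightarrow> ('k^'n \<Rightarrow> 'k) set" where
  "vanishing X = {f \<in> polynomial_functions. \<forall>p\<in>X. f p = 0}"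

lemma vanishing_ideal: "is_ideal polynomial_functions (vanishing (X :: ('k::field^'n) set))"
  unfolding is_ideal_def
proof (intro conjI ballI)
  fix f g :: "'k^'n \<Rightarrow> 'k" assume "f \<in> vanishing X" "g \<in> vanishing X"
  then show "f + g \<in> vanishing X" using pf(6)[of f g] by (simp add: vanishing_def)
next
  fix f g :: "'k^'n \<Rightarrow> 'k" assume "f \<in> polynomial_functions" "g \<in> vanishing X"
  then show "f * g \<in> vanishing X" using pf(4)[of f g] by (simp add: vanishing_def)
qed (auto simp: vanishing_def intro: pf(1))

definition tangent :: "('k::alg_closed_field^'n) set \<Rightarrow> 'k^'n \<Rightarrow> ('k^'n) set" where
  "tangent X p = {v. \<forall>f\<in>vanishing X. dot (grad f p) v = 0}"

lemma tangent_subspace: "vec.subspace (tangent X p)"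
  by (rule vec.subspaceI) (auto simp: tangent_def dot_add_right dot_scale_right)

text \<open>An extension to a basis is indexed by the coordinate type itself, so that the basis
  becomes the rows of a square matrix and determinants and Cramer's rule apply; \<open>R\<close>
  marks the original vectors.\<close>

lemma adapted_rows:
  assumes "vec.independent (B :: ('k::field^'n) set)"
  shows "\<exists>(e :: 'n \<Rightarrow> 'k^'n) R. bij_betw e R B \<and> det (\<chi> i. e i) \<noteq> 0"
proof -
  obtain B' where B': "B \<subseteq> B'" "vec.independent B'" "UNIV \<subseteq> vec.span B'"
    using vec.maximal_independent_subset_extend[OF subset_UNIV assms] by metis
  have fin: "finite B'" using B'(2) by (rule vec.finiteI_independent)
  have "card B' = vec.dim (UNIV :: ('k^'n) set)" using B' by (intro vec.basis_card_eq_dim) auto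
  then have "card B' = card (UNIV :: 'n set)" by (simp add: vec.dim_UNIV vec.dimension_def card_cart_basis)
  then obtain e :: "'n \<Rightarrow> 'k^'n" where e: "bij_betw e UNIV B'"
    using finite_same_card_bij[of "UNIV :: 'n set" B'] fin by auto
  have "\<forall>i. c i = 0" if "(\<Sum>i\<in>UNIV. c i *s row i (\<chi> i. e i)) = 0" for c
  proof -
    have inj: "inj e" and B: "B' = range e" using e by (auto simp: bij_betw_def)
    have "(\<Sum>v\<in>B'. c (inv e v) *s v) = (\<Sum>i\<in>UNIV. c i *s e i)"
      unfolding B using inj by (subst sum.reindex) auto
    also have "\<dots> = 0" using that by (simp add: row_def)
    finally have "c (inv e v) = 0" if "v \<in> B'" for v
      using vec.independentD[OF B'(2) fin order.refl, of "\<lambda>v. c (inv e v)" v] that by blast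
    then show ?thesis using inj by (metis B inv_f_f rangeI)
  qed
  then have "det (\<chi> i. e i) \<noteq> 0"
    unfolding invertible_det_nz[symmetric] invertible_right_inverse matrix_right_invertible_independent_rows by blast
  moreover have "bij_betw e (e -` B) B"
    using e B'(1) by (auto simp: bij_betw_def inj_on_def)
  ultimately show ?thesis by blast
qed

lemma matrix_rows_mult: "(\<chi> i. e i) *v v = (\<chi> i. dot (e i) v)"
  by (simp add: matrix_vector_mult_def dot_def vec_eq_iff)

text \<open>The invertible matrix with rows \<open>e i\<close> carries the common kernel onto a
  coordinate subspace.\<close>

lemma dim_kernel_rows:
  fixes e :: "'n \<Rightarrow> 'k::field^'n"
  assumes "det (\<chi> i. e i) \<noteq> 0"
  shows "vec.dim {v. \<forall>r\<in>R. dot (e r) v = 0} = card (- R)"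
proof -
  let ?M = "\<chi> i. e i"
  have "invertible ?M" using assms by (simp add: invertible_det_nz)
  then have inj: "inj ((*v) ?M)" and surj: "surj ((*v) ?M)"
    using invertible_eq_bij[of ?M] by (auto simp: bij_def)
  let ?W = "{x :: 'k^'n. \<forall>i. i \<notin> - R \<longrightarrow> x $ i = 0}"
  have pre: "{v. \<forall>r\<in>R. dot (e r) v = 0} = (*v) ?M -` ?W" by (auto simp: matrix_rows_mult)
  have im: "(*v) ?M ` {v. \<forall>r\<in>R. dot (e r) v = 0} = ?W"
    unfolding pre by (rule surj_image_vimage_eq[OF surj])
  have "vec.dim {v. \<forall>r\<in>R. dot (e r) v = 0} = vec.dim ((*v) ?M ` {v. \<forall>r\<in>R. dot (e r) v = 0})"
    by (rule vec.dim_image_eq[OF matrix_vector_mul_linear_gen inj_on_subset[OF inj subset_UNIV], symmetric])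
  also have "\<dots> = card (- R)" unfolding im by (rule dim_substandard_cart)
  finally show ?thesis .
qed

text \<open>The rows \<open>e r\<close> with \<open>r \<in> R\<close> are gradients of elements of the ideal of \<open>X\<close> and cut out the
  tangent space; the remaining \<open>F i\<close> are linear and form local coordinates when \<open>X\<close> is smooth.\<close>

definition adapted :: "('k::alg_closed_field^'n) set \<Rightarrow> 'k^'n \<Rightarrow> ('n \<Rightarrow> 'k^'n \<Rightarrow> 'k) \<Rightarrow> ('n \<Rightarrow> 'k^'n) \<Rightarrow> 'n set \<Rightarrow> bool"
  where "adapted X p F e R \<longleftrightarrow>
    (\<forall>i. F i \<in> polynomial_functions \<and> F i p = 0 \<and> grad (F i) p = e i) \<and> det (\<chi> i. e i) \<noteq> 0 \<and>
    (\<forall>r\<in>R. F r \<in> vanishing X) \<and> (\<forall>i\<in>-R. F i = linear_at p (e i)) \<and>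
    tangent X p = {v. \<forall>r\<in>R. dot (e r) v = 0}"

lemma adaptedD:
  assumes "adapted X p F e R"
  shows "F i \<in> polynomial_functions" "F i p = 0" "grad (F i) p = e i" "det (\<chi> i. e i) \<noteq> 0"
    "r \<in> R \<Longrightarrow> F r \<in> vanishing X" "r \<notin> R \<Longrightarrow> F r = linear_at p (e r)"
    "tangent X p = {v. \<forall>r\<in>R. dot (e r) v = 0}"
  using assms by (auto simp: adapted_def)

lemma adapted_coordinates:
  fixes p :: "'k::alg_closed_field^'n"
  assumes "p \<in> X"
  shows "\<exists>F e R. adapted X p F e R"
proof -
  let ?G = "(\<lambda>f. grad f p) ` vanishing X"
  obtain B where B: "B \<subseteq> ?G" "vec.independent B" "?G \<subseteq> vec.span B"
    using vec.maximal_independent_subset[of ?G] by blast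
  obtain e :: "'n \<Rightarrow> 'k^'n" and R where e: "bij_betw e R B" "det (\<chi> i. e i) \<noteq> 0"
    using adapted_rows[OF B(2)] by blast
  have "e r \<in> ?G" if "r \<in> R" for r using B(1) e(1) that by (auto simp: bij_betw_def)
  then have "\<forall>r\<in>R. \<exists>f\<in>vanishing X. grad f p = e r" by (metis imageE)
  then obtain f where f: "\<And>r. r \<in> R \<Longrightarrow> f r \<in> vanishing X \<and> grad (f r) p = e r" by metis
  define F where "F i = (if i \<in> R then f i else linear_at p (e i))" for i
  have F: "F i \<in> polynomial_functions \<and> F i p = 0 \<and> grad (F i) p = e i" for i
    using f[of i] assms linear_at_polynomial by (auto simp: F_def vanishing_def)
  have T: "tangent X p = {v. \<forall>r\<in>R. dot (e r) v = 0}"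
  proof (intro set_eqI iffI)
    fix v assume "v \<in> tangent X p"
    then show "v \<in> {v. \<forall>r\<in>R. dot (e r) v = 0}" using f by (force simp: tangent_def)
  next
    fix v assume v: "v \<in> {v. \<forall>r\<in>R. dot (e r) v = 0}"
    then have "dot b v = 0" if "b \<in> B" for b using that e(1) by (auto simp: bij_betw_def)
    then have "dot g v = 0" if "g \<in> ?G" for g using that B(3) dot_span by blast
    then show "v \<in> tangent X p" by (auto simp: tangent_def)
  qed
  have "adapted X p F e R" unfolding adapted_def using F e(2) f T by (auto simp: F_def)
  then show ?thesis by blast
qed

section \<open>Local equations at a smooth point\<close>

lemma fun_sum_apply: "(\<Sum>i\<in>A. f i) x = (\<Sum>i\<in>A. f i x)"
  by (induction A rule: infinite_finite_induct) simp_all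

text \<open>Homogeneous polynomials of degree \<open>k\<close> in the elements of \<open>L\<close>,
  with constant coefficients.\<close>

primrec forms :: "('k::field^'n \<Rightarrow> 'k) set \<Rightarrow> nat \<Rightarrow> ('k^'n \<Rightarrow> 'k) set" where
  "forms L 0 = range (\<lambda>c _. c)"
| "forms L (Suc k) = lin (forms L k) L"

lemma forms_scale: "g \<in> forms L k \<Longrightarrow> (\<lambda>_. c) * g \<in> forms L k"
proof (induction k arbitrary: g)
  case 0
  then show ?case by (auto simp: times_fun_def)
next
  case (Suc k)
  have "g \<in> lin (forms L k) L" using Suc.prems by simp
  from lin_mult[OF this Suc.IH] show ?case unfolding forms.simps .
qed

lemma forms_add: "f \<in> forms L k \<Longrightarrow> g \<in> forms L k \<Longrightarrow> f + g \<in> forms L k"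
proof (cases k)
  case (Suc j)
  show "f \<in> forms L k \<Longrightarrow> g \<in> forms L k \<Longrightarrow> f + g \<in> forms L k"
    unfolding Suc forms.simps by (rule lin_add)
qed (auto simp: plus_fun_def)

lemma forms_zero: "0 \<in> forms L k"
proof (cases k)
  case (Suc j)
  show ?thesis unfolding Suc forms.simps by (rule lin.zero)
qed (auto simp: zero_fun_def simp del: zero_fun_eta)

lemma forms_mpow: "L \<subseteq> mpow p 1 \<Longrightarrow> forms L k \<subseteq> mpow p k"
proof (induction k)
  case 0
  then show ?case by (auto intro: polynomial_functions.const)
next
  case (Suc k)
  show ?case
  proof
    fix f assume "f \<in> forms L (Suc k)"
    then have "f \<in> lin (forms L k) L" by simp
    then show "f \<in> mpow p (Suc k)"
    proof induction
      case zero
      show ?case by (rule mpow_idealD(1))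
    next
      case (step c a x)
      have "c * a \<in> mpow p (k + 1)" using step(1,2) Suc by (intro mpow_mult) auto
      then show ?case using mpow_idealD(3)[OF _ step(4)] by (metis Suc_eq_plus1)
    qed
  qed
qed

text \<open>Modulo \<open>Z\<close> every \<open>a\<close> in \<open>L\<close> becomes
  \<open>a q\<close> times \<open>z\<close>, so a form of degree \<open>k\<close> becomes its value
  at \<open>q\<close> times \<open>z ^ k\<close>. Thus fewer than \<open>card L\<close> relations
  (for finite \<open>L\<close>) turn a form that is non-zero at \<open>q\<close> into a non-zero
  multiple of a pure power.\<close>

lemma forms_reduce:
  assumes "L \<subseteq> polynomial_functions" "l \<in> L" "l q \<noteq> 0" "g \<in> forms L k"
  defines "z \<equiv> (\<lambda>_. 1 / l q) * l"
  defines "Z \<equiv> (\<lambda>a. a - (\<lambda>_. a q) * z) ` (L - {l})"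
  shows "g - (\<lambda>_. g q) * z ^ k \<in> gen Z"
proof -
  have zp: "z \<in> polynomial_functions" using assms(1,2) unfolding z_def
    by (intro pf(4) polynomial_functions.const) auto
  have Zp: "Z \<subseteq> polynomial_functions" using assms(1) zp unfolding Z_def
    by (auto intro!: pf(3) pf(4)[OF polynomial_functions.const])
  note I = gen_ideal[OF Zp]
  have Lp: "forms L k \<subseteq> polynomial_functions" for k
  proof (induction k)
    case (Suc k)
    then show ?case using lin_subset_ideal[OF is_ideal_self[OF polynomial_functions_subring] _ assms(1)] by auto
  qed (auto intro: polynomial_functions.const)
  show ?thesis using assms(4)
  proof (induction k arbitrary: g)
    case 0
    then obtain c where "g = (\<lambda>_. c)" by auto
    then have "g - (\<lambda>_. g q) * z ^ 0 = 0" by (auto simp: fun_eq_iff)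
    then show ?case using lin.zero by metis
  next
    case (Suc k)
    have "g \<in> lin (forms L k) L" using Suc.prems by simp
    then show ?case
    proof induction
      case zero
      have "0 - (\<lambda>_. 0 q) * z ^ Suc k = 0" by (auto simp: fun_eq_iff)
      then show ?case using lin.zero by metis
    next
      case (step c a x)
      have "a - (\<lambda>_. a q) * z \<in> gen Z"
      proof (cases "a = l")
        case True
        then have "a - (\<lambda>_. a q) * z = 0" using assms(3) by (auto simp: fun_eq_iff z_def)
        then show ?thesis using lin.zero by metis
      next
        case False
        then show ?thesis using step(2) by (intro gen_base) (auto simp: Z_def)
      qed
      moreover have "c \<in> polynomial_functions" using step(1) Lp by blast
      moreover have "(\<lambda>_. a q) * z \<in> polynomial_functions" by (intro pf(4) polynomial_functions.const zp)
      ultimately have "c * (a - (\<lambda>_. a q) * z) + ((\<lambda>_. a q) * z * (c - (\<lambda>_. c q) * z ^ k)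
          + (x - (\<lambda>_. x q) * z ^ Suc k)) \<in> gen Z"
        using Suc.IH[OF step(1)] step(4) by (metis idealD(3,4)[OF I])
      moreover have "(c * a + x) - (\<lambda>_. (c * a + x) q) * z ^ Suc k =
          c * (a - (\<lambda>_. a q) * z) + ((\<lambda>_. a q) * z * (c - (\<lambda>_. c q) * z ^ k)
          + (x - (\<lambda>_. x q) * z ^ Suc k))"
        by (auto simp: fun_eq_iff algebra_simps)
      ultimately show ?case by metis
    qed
  qed
qed

lemma forms_nonzero:
  assumes "g \<in> forms L (Suc k)" "g q \<noteq> 0"
  shows "\<exists>l\<in>L. l q \<noteq> 0"
proof (rule ccontr)
  assume *: "\<not> ?thesis"
  have "g \<in> lin (forms L k) L" using assms(1) by simp
  then have "g q = 0" by induction (use * in auto)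
  then show False using assms(2) by simp
qed

text \<open>By Taylor expansion each \<open>F i\<close> agrees with its linear part modulo second
  order, and the linear parts span the coordinate differences. Hence to leading order everything in
  \<open>mpow p k\<close> is a form in the \<open>F i\<close>, and those with \<open>i\<close> in
  \<open>R\<close> are absorbed by the ideal.\<close>

lemma mpow_forms:
  fixes p :: "'k::alg_closed_field^'n"
  assumes F: "\<And>i. F i \<in> polynomial_functions" "\<And>i. F i p = 0" "\<And>i. grad (F i) p = e i"
    and det: "det (\<chi> i. e i) \<noteq> 0" and lin: "\<And>i. i \<notin> R \<Longrightarrow> F i = linear_at p (e i)"
    and f: "f \<in> mpow p k"
  shows "\<exists>g\<in>forms (F ` (- R)) k. \<exists>h\<in>gen (F ` R \<union> mpow p (Suc k)). f = g + h"
  using f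
proof (induction k arbitrary: f)
  case 0
  have "f - (\<lambda>_. f p) \<in> mpow p 1" unfolding mpow_1 using 0 by (auto intro!: pf(3) polynomial_functions.const)
  then have "f - (\<lambda>_. f p) \<in> gen (F ` R \<union> mpow p (Suc 0))" by (intro gen_base) simp
  moreover have "f = (\<lambda>_. f p) + (f - (\<lambda>_. f p))" by simp
  ultimately show ?case by (metis forms.simps(1) rangeI)
next
  case (Suc k)
  let ?L = "F ` (- R)"
  have Fm: "F i \<in> mpow p 1" for i unfolding mpow_1 using F by simp
  have Rp: "F ` R \<subseteq> polynomial_functions" using F by auto
  have FT: "F i - linear_at p (e i) \<in> mpow p 2" for i
    using taylor[OF F(1)[of i], of p] by (simp add: F)
  have I: "is_ideal polynomial_functions (gen (F ` R \<union> mpow p (Suc (Suc k))))"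
    using Rp mpow_subset_pf by (intro gen_ideal) blast
  have step: "\<exists>g\<in>forms ?L (Suc k). \<exists>h\<in>gen (F ` R \<union> mpow p (Suc (Suc k))). c * a = g + h"
    if c: "c \<in> mpow p k" and a: "a \<in> range (\<lambda>i q. q $ i - p $ i)" for c a
  proof -
    obtain j where j: "a = (\<lambda>q. q $ j - p $ j)" using a by blast
    \<comment> \<open>\<open>B\<close> inverts the gradient matrix and thereby expresses the
      coordinate difference \<open>a\<close> through the linear functions
      \<open>linear_at p (e i)\<close>.\<close>
    obtain B where "B ** (\<chi> i. e i) = mat 1"
      using det invertible_det_nz[of "\<chi> i. e i"] unfolding invertible_def by blast
    then have B: "(\<Sum>i\<in>UNIV. B $ j $ i * e i $ l) = (if j = l then 1 else 0)" for l
      by (simp add: matrix_matrix_mult_def mat_def vec_eq_iff)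
    obtain g h where gh: "g \<in> forms ?L k" "h \<in> gen (F ` R \<union> mpow p (Suc k))" "c = g + h"
      using Suc.IH[OF c] by blast
    have gm: "g \<in> mpow p k" using gh(1) forms_mpow[of ?L p k] Fm by blast
    have gp: "g \<in> polynomial_functions" using gm mpow_subset_pf by blast
    have am: "a \<in> mpow p 1" unfolding mpow_1 j using shifted_coord by auto
    let ?b = "\<lambda>i. (\<lambda>_. B $ j $ i) * g"
    have bp: "?b i \<in> polynomial_functions" for i using gp by (intro pf(4) polynomial_functions.const)
    have bm: "?b i \<in> mpow p k" for i using gm by (intro mpow_idealD(4) polynomial_functions.const)
    have "a q = (\<Sum>i\<in>UNIV. B $ j $ i * linear_at p (e i) q)" for q
    proof -
      have "(\<Sum>i\<in>UNIV. B $ j $ i * linear_at p (e i) q) = (\<Sum>l\<in>UNIV. (\<Sum>i\<in>UNIV. B $ j $ i * e i $ l) * (q $ l - p $ l))"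
        unfolding linear_at_def sum_distrib_left sum_distrib_right
        by (subst sum.swap) (simp add: mult.assoc)
      also have "\<dots> = a q" unfolding B j by (simp add: if_distrib[of "\<lambda>x. x * _"] cong: if_cong)
      finally show ?thesis by simp
    qed
    then have ga: "g * a = (\<Sum>i\<in>UNIV. ?b i * linear_at p (e i))"
      by (auto simp: fun_eq_iff sum_distrib_left mult_ac fun_sum_apply)
    \<comment> \<open>The part of the sum over \<open>R\<close>, with each linear function written
      as \<open>F i\<close> minus its remainder of second order; both pieces lie in the
      ideal.\<close>
    define h1 where "h1 = (\<Sum>i\<in>R. ?b i * F i) - (\<Sum>i\<in>R. ?b i * (F i - linear_at p (e i)))"
    have h1: "h1 \<in> gen (F ` R \<union> mpow p (Suc (Suc k)))" unfolding h1_def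
    proof (intro ideal_diff[OF polynomial_functions_subring I] ideal_sum[OF I])
      fix i assume i: "i \<in> R"
      show "?b i * F i \<in> gen (F ` R \<union> mpow p (Suc (Suc k)))"
        using i by (intro idealD(4)[OF I bp] gen_base) auto
      have "?b i * (F i - linear_at p (e i)) \<in> mpow p (k + 2)" by (intro mpow_mult bm FT)
      then show "?b i * (F i - linear_at p (e i)) \<in> gen (F ` R \<union> mpow p (Suc (Suc k)))"
        by (intro gen_base UnI2) (simp only: add_2_eq_Suc')
    qed
    have "(\<Sum>i\<in>UNIV. ?b i * linear_at p (e i)) = (\<Sum>i\<in>-R. ?b i * linear_at p (e i)) + (\<Sum>i\<in>R. ?b i * linear_at p (e i))"
      by (metis (no_types, lifting) Compl_partition2 Compl_disjoint2 finite sum.union_disjoint)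
    moreover have "h1 = (\<Sum>i\<in>R. ?b i * linear_at p (e i))"
      unfolding h1_def sum_subtractf[symmetric] by (simp add: right_diff_distrib del: times_fun_apply)
    ultimately have "c * a = (\<Sum>i\<in>-R. ?b i * F i) + (h1 + a * h)"
      unfolding gh(3) distrib_right ga by (simp add: lin add.assoc mult.commute)
    moreover have "(\<Sum>i\<in>-R. ?b i * F i) \<in> forms ?L (Suc k)"
      using forms_scale[OF gh(1)] unfolding forms.simps by (intro lin_sum lin_base) auto
    moreover have "h1 + a * h \<in> gen (F ` R \<union> mpow p (Suc (Suc k)))"
      by (rule idealD(3)[OF I h1 gen_mpow_mult[OF Rp am gh(2)]])
    ultimately show ?thesis by blast
  qed
  have "f \<in> lin (mpow p k) (range (\<lambda>i q. q $ i - p $ i))" using Suc.prems by simp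
  then show ?case
  proof induction
    case zero
    show ?case using forms_zero lin.zero by (metis add_0)
  next
    case (step c a x)
    obtain g h where 1: "g \<in> forms ?L (Suc k)" "h \<in> gen (F ` R \<union> mpow p (Suc (Suc k)))" "x = g + h"
      using step(4) by blast
    obtain g' h' where 2: "g' \<in> forms ?L (Suc k)" "h' \<in> gen (F ` R \<union> mpow p (Suc (Suc k)))" "c * a = g' + h'"
      using \<open>\<And>c a. c \<in> mpow p k \<Longrightarrow> a \<in> range (\<lambda>i q. q $ i - p $ i) \<Longrightarrow> _ c a\<close> step(1,2) by blast
    have "c * a + x = (g' + g) + (h' + h)" unfolding 1(3) 2(3) by (simp only: ac_simps)
    then show ?case using forms_add[OF 2(1) 1(1)] lin_add[OF 2(2) 1(2)] by blast
  qed
qed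

text \<open>Were the leading form of an element of \<open>I\<close> modulo the \<open>F r\<close>
  non-zero, it would be a relation between the remaining \<open>card (- R)\<close> coordinates. One
  coordinate could then be saved, against the chain of that length.\<close>

lemma vanishing_subset_mpow:
  fixes p :: "'k::alg_closed_field^'n"
  assumes F: "\<And>i. F i \<in> polynomial_functions" "\<And>i. F i p = 0" "\<And>i. grad (F i) p = e i"
    and det: "det (\<chi> i. e i) \<noteq> 0" and lin: "\<And>i. i \<notin> R \<Longrightarrow> F i = linear_at p (e i)"
    and FR: "\<And>r. r \<in> R \<Longrightarrow> F r \<in> I"
    and I: "is_ideal polynomial_functions I" "I \<subseteq> mpow p 1"
    and P: "\<And>i. i \<le> card (- R) \<Longrightarrow> is_prime (P i)" "\<And>i. i < card (- R) \<Longrightarrow> P (Suc i) \<subset> P i" "P 0 \<subseteq> mpow p 1"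
      "I \<subseteq> P (card (- R))"
  shows "I \<subseteq> gen (F ` R \<union> mpow p k)"
proof (induction k)
  case 0
  show ?case using idealD(2)[OF I(1)] by (auto intro: gen_base)
next
  case (Suc k)
  let ?L = "F ` (- R)"
  have Ip: "I \<subseteq> polynomial_functions" using I(1) by (simp add: is_ideal_def)
  have Rp: "F ` R \<subseteq> polynomial_functions" using F by auto
  have Lm: "?L \<subseteq> mpow p 1" unfolding mpow_1 using F by auto
  show ?case
  proof (cases k)
    case 0
    \<comment> \<open>The first power is handled directly: a form of degree 0 is constant and
      involves no element of \<open>L\<close> that could be kept.\<close>
    then show ?thesis using I(2) by (auto intro: gen_base)
  next
    case (Suc k')
    show ?thesis
    proof
      fix f assume f: "f \<in> I"
      obtain j h where jh: "j \<in> gen (F ` R)" "h \<in> mpow p k" "f = j + h"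
        using gen_Un[OF subsetD[OF Suc.IH f]] gen_of_ideal[OF mpow_ideal] by blast
      obtain g h' where gh: "g \<in> forms ?L k" "h' \<in> gen (F ` R \<union> mpow p (Suc k))" "h = g + h'"
        using mpow_forms[OF F det lin jh(2)] by blast
      have j': "j \<in> gen (F ` R \<union> mpow p (Suc k))" using jh(1) gen_mono[of "F ` R" "F ` R \<union> mpow p (Suc k)"] by blast
      show "f \<in> gen (F ` R \<union> mpow p (Suc k))"
      proof (cases "g = 0")
        case True
        then show ?thesis using lin_add[OF j' gh(2)] by (simp add: jh gh)
      next
        case False
        \<comment> \<open>A point where the leading form does not vanish selects the coordinate
          \<open>l\<close> to keep and the fewer than \<open>card (- R)\<close> relations
          \<open>Z\<close>.\<close>
        then obtain q where q: "g q \<noteq> 0" by (auto simp: fun_eq_iff)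
        then obtain l where l: "l \<in> ?L" "l q \<noteq> 0" using forms_nonzero gh(1) Suc by blast
        define z where "z = (\<lambda>_. 1 / l q) * l"
        define Z where "Z = (\<lambda>a. a - (\<lambda>_. a q) * z) ` (?L - {l})"
        have Lp: "?L \<subseteq> polynomial_functions" using F by auto
        have zm: "z \<in> mpow p 1" unfolding z_def using l Lm by (intro mpow_idealD(4) polynomial_functions.const) auto
        have Zm: "Z \<subseteq> mpow p 1" unfolding Z_def using zm Lm
          by (auto simp del: mpow.simps intro!: ideal_diff[OF polynomial_functions_subring mpow_ideal] mpow_idealD(4)[OF polynomial_functions.const])
        let ?G = "gen (I \<union> Z \<union> mpow p (Suc k))"
        have G: "is_ideal polynomial_functions ?G" using Ip Zm mpow_subset_pf by (intro gen_ideal) blast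
        have ZG: "gen Z \<subseteq> ?G" by (intro gen_mono) auto
        have FG: "gen (F ` R \<union> mpow p (Suc k)) \<subseteq> ?G" using FR by (intro gen_mono) auto
        have red: "x - (\<lambda>_. x q) * z ^ k \<in> ?G" if "x \<in> forms ?L k" for x
          using forms_reduce[OF Lp l that] ZG unfolding Z_def z_def by blast
        have "g = f - j - h'" by (simp add: jh gh)
        moreover have "f \<in> ?G" using f by (intro gen_base) simp
        then have "f - j - h' \<in> ?G" using j' gh(2) FG
          by (intro ideal_diff[OF polynomial_functions_subring G]) blast+
        ultimately have gG: "g \<in> ?G" by simp
        have "g - (g - (\<lambda>_. g q) * z ^ k) \<in> ?G"
          by (rule ideal_diff[OF polynomial_functions_subring G gG red[OF gh(1)]])
        then have "(\<lambda>_. 1 / g q) * (g - (g - (\<lambda>_. g q) * z ^ k)) \<in> ?G"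
          by (rule idealD(4)[OF G polynomial_functions.const])
        moreover have "(\<lambda>_. 1 / g q) * (g - (g - (\<lambda>_. g q) * z ^ k)) = z ^ k" using q by (auto simp: fun_eq_iff)
        ultimately have zG: "z ^ k \<in> ?G" by metis
        \<comment> \<open>Modulo \<open>?G\<close> all forms of degree \<open>k\<close> are
          multiples of \<open>z ^ k\<close>, which is already in \<open>?G\<close>. So
          \<open>I\<close> and \<open>Z\<close> satisfy the hypothesis of
          \<open>chain_length_le_parameters\<close> with too few elements in
          \<open>Z\<close>.\<close>
        have "mpow p k \<subseteq> ?G"
        proof
          fix y assume "y \<in> mpow p k"
          then obtain x h where xh: "x \<in> forms ?L k" "h \<in> gen (F ` R \<union> mpow p (Suc k))" "y = x + h"
            using mpow_forms[OF F det lin] by blast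
          have "y = (x - (\<lambda>_. x q) * z ^ k) + ((\<lambda>_. x q) * z ^ k + h)" by (simp add: xh)
          also have "\<dots> \<in> ?G" using red[OF xh(1)] idealD(4)[OF G polynomial_functions.const zG] xh(2) FG
            by (intro idealD(3)[OF G]) blast+
          finally show "y \<in> ?G" .
        qed
        then have "card (- R) \<le> card Z"
          using chain_length_le_parameters[OF P(1-3) P(4) _ Zm] by (simp add: Z_def)
        also have "card Z \<le> card (?L - {l})" unfolding Z_def by (intro card_image_le) simp
        also have "\<dots> < card ?L" using l by (intro psubset_card_mono) auto
        also have "\<dots> \<le> card (- R)" by (intro card_image_le) simp
        finally show ?thesis by simp
      qed
    qed
  qed
qed

text \<open>Nakayama's lemma at a point, by eliminating one generator at a time.\<close>

lemma nakayama:
  assumes "finite A" "A \<subseteq> polynomial_functions" "is_ideal polynomial_functions J"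
    and "u \<in> polynomial_functions" "u p \<noteq> 0"
    and "\<And>b. b \<in> A \<Longrightarrow> \<exists>j\<in>J. \<exists>y\<in>lin (mpow p 1) A. u * b = j + y"
  shows "\<exists>u'\<in>polynomial_functions. u' p \<noteq> 0 \<and> (\<forall>b\<in>A. u' * b \<in> J)"
  using assms
proof (induction A arbitrary: u rule: finite_induct)
  case empty
  then show ?case by blast
next
  case (insert r A)
  note J = \<open>is_ideal polynomial_functions J\<close>
  obtain j a y where r: "j \<in> J" "a \<in> mpow p 1" "y \<in> lin (mpow p 1) A" "u * r = j + (a * r + y)"
    using insert.prems(5)[of r] lin_insert[OF _ mpow_ideal] by (metis insertI1)
  have ap: "a \<in> polynomial_functions" "a p = 0" using r(2) unfolding mpow_1 by auto
  \<comment> \<open>Solves the relation for \<open>r\<close>. The new multiplier is still non-zero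
    at \<open>p\<close>, since \<open>a\<close> vanishes there.\<close>
  let ?v = "u - a"
  have vp: "?v \<in> polynomial_functions" using insert.prems(3) ap by (intro pf(3))
  have vr: "?v * r = j + y" using r(4) by (simp add: algebra_simps del: times_fun_apply)
  have M: "is_ideal polynomial_functions (lin (mpow p 1) A)"
    using insert.prems(1) by (intro is_ideal_lin[OF polynomial_functions_subring mpow_ideal]) auto
  have "\<exists>j\<in>J. \<exists>y\<in>lin (mpow p 1) A. (?v * u) * b = j + y" if b: "b \<in> A" for b
  proof -
    obtain k c z where b: "k \<in> J" "c \<in> mpow p 1" "z \<in> lin (mpow p 1) A" "u * b = k + (c * r + z)"
      using insert.prems(5)[of b] lin_insert[OF _ mpow_ideal] b by (metis insertI2)
    have "(?v * u) * b = ?v * (u * b)" by (simp only: ac_simps)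
    also have "\<dots> = ?v * k + (c * (?v * r) + ?v * z)" unfolding b(4) by (simp only: distrib_left ac_simps)
    also have "\<dots> = (?v * k + c * j) + (c * y + ?v * z)" unfolding vr by (simp only: distrib_left ac_simps)
    finally have eq: "(?v * u) * b = (?v * k + c * j) + (c * y + ?v * z)" .
    have cp: "c \<in> polynomial_functions" using b(2) mpow_subset_pf by blast
    have "?v * k + c * j \<in> J" by (intro idealD(3)[OF J] idealD(4)[OF J] vp cp b r)
    moreover have "c * y + ?v * z \<in> lin (mpow p 1) A" by (intro idealD(3)[OF M] idealD(4)[OF M] vp cp b r)
    ultimately show ?thesis using eq by blast
  qed
  moreover have "?v * u \<in> polynomial_functions" using vp insert.prems(3) by (rule pf(4))
  moreover have "(?v * u) p \<noteq> 0" using insert.prems(4) ap by simp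
  ultimately obtain w where w: "w \<in> polynomial_functions" "w p \<noteq> 0" "\<And>b. b \<in> A \<Longrightarrow> w * b \<in> J"
    using insert.IH[of "?v * u"] insert.prems(1,2) by blast
  have "w * x \<in> J" if "x \<in> lin (mpow p 1) A" for x
    using that
  proof induction
    case zero
    then show ?case using idealD(1)[OF J] by simp
  next
    case (step c a x)
    have "w * (c * a + x) = c * (w * a) + w * x" by (simp only: distrib_left ac_simps)
    moreover have "c * (w * a) \<in> J"
      by (rule idealD(4)[OF J subsetD[OF mpow_subset_pf step(1)] w(3)[OF step(2)]])
    ultimately show ?case using step(4) idealD(3)[OF J] by metis
  qed
  then have "w * (j + y) \<in> J" unfolding distrib_left using r w by (metis idealD(3,4)[OF J])
  then have "(w * ?v) * r \<in> J" using vr by (metis mult.assoc)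
  moreover have "(w * ?v) * b \<in> J" if "b \<in> A" for b
    using idealD(4)[OF J vp w(3)[OF that]] by (simp only: ac_simps)
  moreover have "w * ?v \<in> polynomial_functions" "(w * ?v) p \<noteq> 0"
    using w vp insert.prems(4) ap by (auto intro!: pf(4) simp del: times_fun_apply) simp
  ultimately show ?case by blast
qed

text \<open>By Artin-Rees a single high power of the maximal ideal already gives that
  \<open>I\<close> lies in \<open>J\<close> plus \<open>mpow p 1\<close> times \<open>I\<close>, and
  Nakayama's lemma applies. The multiplier \<open>u\<close> stands for passing to the local
  ring.\<close>

lemma krull_intersection:
  assumes I: "is_ideal polynomial_functions I" and J: "is_ideal polynomial_functions J" "J \<subseteq> I"
    and sub: "\<And>k. I \<subseteq> gen (J \<union> mpow p k)"
  shows "\<exists>u\<in>polynomial_functions. u p \<noteq> 0 \<and> (\<forall>f\<in>I. u * f \<in> J)"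
proof -
  obtain c where c: "\<And>k. I \<inter> mpow p (k + c) \<subseteq> lin (mpow p k) I" using artin_rees[OF I] by blast
  obtain B where B: "finite B" "B \<subseteq> I" "I = gen B"
    using noetherian_fg[OF noetherian_polynomial_functions I] by blast
  have Bp: "B \<subseteq> polynomial_functions" using B I idealD(2) by blast
  have M: "is_ideal polynomial_functions (lin (mpow p 1) B)"
    by (rule is_ideal_lin[OF polynomial_functions_subring mpow_ideal Bp])
  have base: "d * b \<in> lin (mpow p 1) B" if d: "d \<in> mpow p 1" and "b \<in> gen B" for d b
    using that(2)
  proof induction
    case zero
    show ?case using lin.zero by simp
  next
    case (step r a x)
    have "d * (r * a + x) = (r * d) * a + d * x" by (simp only: distrib_left ac_simps)
    moreover have "r * d \<in> mpow p 1" by (rule mpow_idealD(4)[OF step(1) d])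
    ultimately show ?case using lin.step[OF _ step(2) step(4)] by metis
  qed
  have "x \<in> lin (mpow p 1) B" if "x \<in> lin (mpow p 1) I" for x
    using that
  proof induction
    case (step d a x)
    show ?case using base[OF step(1)] step(2,4) B(3) by (intro idealD(3)[OF M]) auto
  qed (rule lin.zero)
  then have MI: "lin (mpow p 1) I \<subseteq> lin (mpow p 1) B" by blast
  have "\<exists>j\<in>J. \<exists>y\<in>lin (mpow p 1) B. 1 * b = j + y" if "b \<in> B" for b
  proof -
    have "b \<in> gen (J \<union> mpow p (1 + c))" using sub B(2) that by blast
    from gen_Un[OF this] obtain j h where jh: "j \<in> J" "h \<in> mpow p (1 + c)" "b = j + h"
      using gen_of_ideal[OF J(1)] gen_of_ideal[OF mpow_ideal] by blast
    have "h = b - j" using jh(3) by simp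
    then have "h \<in> I" using ideal_diff[OF polynomial_functions_subring I] B(2) J(2) that jh(1) by blast
    then have "h \<in> lin (mpow p 1) B" using c[of 1] jh(2) MI by blast
    then show ?thesis using jh by (metis mult_1)
  qed
  then obtain u where u: "u \<in> polynomial_functions" "u p \<noteq> 0" "\<And>b. b \<in> B \<Longrightarrow> u * b \<in> J"
    using nakayama[OF B(1) Bp J(1) pf(2), of p] by auto
  have "u * f \<in> J" if "f \<in> gen B" for f
    using that
  proof induction
    case zero
    then show ?case using idealD(1)[OF J(1)] by simp
  next
    case (step r a x)
    have "u * (r * a + x) = r * (u * a) + u * x" by (simp only: distrib_left ac_simps)
    then show ?case using idealD(3)[OF J(1) idealD(4)[OF J(1) step(1) u(3)[OF step(2)]] step(4)] by metis
  qed
  then show ?thesis using u B(3) by blast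
qed

section \<open>Tangent vectors of smooth varieties\<close>

lemma algebraic_set_vanishing: "algebraic_set Z \<Longrightarrow> Z = {p. \<forall>f\<in>vanishing Z. f p = 0}"
  unfolding algebraic_set_def vanishing_def by blast

lemma algebraic_setI: "(\<And>p. (\<And>f. f \<in> vanishing Z \<Longrightarrow> f p = 0) \<Longrightarrow> p \<in> Z) \<Longrightarrow> algebraic_set Z"
  unfolding algebraic_set_def
  by (intro exI[of _ "vanishing Z"]) (auto simp: vanishing_def)

lemma vanishing_psubset:
  assumes "algebraic_set Z" "algebraic_set Z'" "Z \<subset> Z'" shows "vanishing Z' \<subset> vanishing Z"
proof -
  have "vanishing Z' \<subseteq> vanishing Z" using assms(3) by (auto simp: vanishing_def)
  moreover have "vanishing Z' \<noteq> vanishing Z"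
    using algebraic_set_vanishing[OF assms(1)] algebraic_set_vanishing[OF assms(2)] assms(3) by auto
  ultimately show ?thesis by blast
qed

lemma algebraic_zeros: "f \<in> polynomial_functions \<Longrightarrow> algebraic_set {p. f p = 0}"
  unfolding algebraic_set_def by (intro exI[of _ "{f}"]) auto

lemma vanishing_prime:
  assumes "irreducible_algebraic_set Z" shows "is_prime (vanishing Z)"
  unfolding is_prime_def
proof (intro conjI ballI impI vanishing_ideal)
  have "Z \<noteq> {}" using assms by (simp add: irreducible_algebraic_set_def)
  then have "1 \<notin> vanishing Z" by (auto simp: vanishing_def)
  then show "vanishing Z \<noteq> polynomial_functions" using pf(2) by blast
  fix f g assume fg: "f \<in> polynomial_functions" "g \<in> polynomial_functions" "f * g \<in> vanishing Z"
  then have "Z \<subseteq> {p. f p = 0} \<union> {p. g p = 0}" by (auto simp: vanishing_def)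
  then have "Z \<subseteq> {p. f p = 0} \<or> Z \<subseteq> {p. g p = 0}"
    using assms algebraic_zeros fg unfolding irreducible_algebraic_set_def by blast
  then show "f \<in> vanishing Z \<or> g \<in> vanishing Z" using fg by (auto simp: vanishing_def)
qed

lemma irreducible_singleton: "irreducible_algebraic_set {p}"
proof -
  have "algebraic_set {p}"
  proof (rule algebraic_setI)
    fix q assume "\<And>f. f \<in> vanishing {p} \<Longrightarrow> f q = 0"
    moreover have "(\<lambda>q. q $ i - p $ i) \<in> vanishing {p}" for i by (auto simp: vanishing_def shifted_coord)
    ultimately have "q $ i - p $ i = 0" for i by fastforce
    then show "q \<in> {p}" by (simp add: vec_eq_iff)
  qed
  then show ?thesis by (auto simp: irreducible_algebraic_set_def)
qed

definition has_chain :: "'a set set \<Rightarrow> nat \<Rightarrow> bool" where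
  "has_chain F m \<longleftrightarrow> (\<exists>Z. (\<forall>i\<le>m. Z i \<in> F) \<and> (\<forall>i<m. Z i \<subset> Z (Suc i)))"

lemma chain_length_alt: "chain_length F = (SUP m\<in>{m. has_chain F m}. enat m)"
  by (simp add: chain_length_def has_chain_def)

lemma has_chain_le: "has_chain F m \<Longrightarrow> chain_length F = enat d \<Longrightarrow> m \<le> d"
  unfolding chain_length_alt by (metis (mono_tags, lifting) SUP_upper enat_ord_simps(1) mem_Collect_eq)

text \<open>A finite supremum of naturals is attained unless the set is empty; a member of
  \<open>F\<close> provides the chain of length 0 that rules this out.\<close>

lemma has_chain_attained:
  assumes "chain_length F = enat d" "F \<noteq> {}"
  shows "has_chain F d"
proof (rule ccontr)
  assume no: "\<not> has_chain F d"
  obtain Z where "Z \<in> F" using assms(2) by blast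
  then have "has_chain F 0" unfolding has_chain_def by (intro exI[of _ "\<lambda>_. Z"]) auto
  then have "d \<noteq> 0" using no by metis
  have "m \<le> d - 1" if "has_chain F m" for m
    using has_chain_le[OF that assms(1)] no that by (cases "m = d") auto
  then have "chain_length F \<le> enat (d - 1)" unfolding chain_length_alt by (intro SUP_least) auto
  then show False using assms(1) \<open>d \<noteq> 0\<close> by simp
qed

definition restr :: "'a set \<Rightarrow> ('a \<Rightarrow> 'k::zero) \<Rightarrow> 'a \<Rightarrow> 'k" where
  "restr X f = (\<lambda>p. if p \<in> X then f p else 0)"

lemma coordinate_ring_restr: "coordinate_ring X = restr X ` polynomial_functions"
  by (auto simp: coordinate_ring_def restr_def)

definition lift :: "('k::field^'n) set \<Rightarrow> ('k^'n \<Rightarrow> 'k) \<Rightarrow> 'k^'n \<Rightarrow> 'k" where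
  "lift X f = (SOME g. g \<in> polynomial_functions \<and> restr X g = f)"

lemma lift:
  assumes "f \<in> coordinate_ring X" shows "lift X f \<in> polynomial_functions" "restr X (lift X f) = f"
  using someI_ex[of "\<lambda>g. g \<in> polynomial_functions \<and> restr X g = f"] assms
  by (auto simp: lift_def coordinate_ring_restr)

lemma restr_add: "restr X (f + g) = restr X f + restr X (g :: 'a \<Rightarrow> 'k::field)"
  and restr_mult: "restr X (f * g) = restr X f * restr X (g :: 'a \<Rightarrow> 'k::field)"
  and restr_scale: "restr X (scale_fun c f) = scale_fun c (restr X (f :: 'a \<Rightarrow> 'k::field))"
  by (auto simp: restr_def scale_fun_def fun_eq_iff)

lemma dot_grad_cong:
  assumes "f \<in> polynomial_functions" "g \<in> polynomial_functions" "restr X f = restr X g" "v \<in> tangent X p"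
  shows "dot (grad f p) v = dot (grad g p) v"
proof -
  have d: "f - g \<in> polynomial_functions" using assms by (intro pf(3))
  have "f p = g p" if "p \<in> X" for p using assms(3) that by (metis restr_def)
  then have "f - g \<in> vanishing X" using d by (auto simp: vanishing_def)
  then have "ddir (f - g) p v = 0" using assms(4) d by (simp add: tangent_def ddir_grad)
  moreover have "ddir ((f - g) + g) p v = ddir (f - g) p v + ddir g p v" by (rule ddir_plus[OF d assms(2)])
  ultimately show ?thesis using assms by (simp add: ddir_grad)
qed

text \<open>A derivation at \<open>p\<close> is determined by its values on the coordinates, so
  differentiation along \<open>v\<close> is a linear bijection from the concrete tangent space onto
  the space of derivations.\<close>

lemma dim_tangent_space:
  fixes p :: "'k::alg_closed_field^'n"
  assumes p: "p \<in> X"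
  shows "vector_space.dim scale_fun (tangent_space X p) = vec.dim (tangent X p)"
proof -
  define \<phi> where "\<phi> v f = (if f \<in> coordinate_ring X then dot (grad (lift X f) p) v else 0)" for v f
  have \<phi>: "\<phi> v (restr X g) = ddir g p v" if "v \<in> tangent X p" "g \<in> polynomial_functions" for v g
  proof -
    have "restr X g \<in> coordinate_ring X" using that(2) by (auto simp: coordinate_ring_restr)
    from dot_grad_cong[OF lift(1)[OF this] that(2) lift(2)[OF this] that(1)] this show ?thesis
      unfolding \<phi>_def ddir_grad[OF that(2)] by simp
  qed
  have "\<phi> v \<in> tangent_space X p" if v: "v \<in> tangent X p" for v
    unfolding tangent_space_def
  proof (intro CollectI conjI ballI allI impI)
    fix f assume f: "f \<in> coordinate_ring X"
    then obtain f' where f': "f' \<in> polynomial_functions" "f = restr X f'" by (auto simp: coordinate_ring_restr)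
    have fp: "f p = f' p" using p by (simp add: f' restr_def)
    have "scale_fun c f' \<in> polynomial_functions" for c
      unfolding scale_fun_def by (intro polynomial_functions.mult polynomial_functions.const f')
    moreover have "ddir (scale_fun c f') p v = c * ddir f' p v" for c
      unfolding scale_fun_def by (subst ddir_mult[OF polynomial_functions.const f'(1)]) (simp add: ddir_const del: zero_fun_eta)
    ultimately show "\<phi> v (scale_fun c f) = c * \<phi> v f" for c
      by (simp add: f'(2) restr_scale[symmetric] \<phi> v f'(1))
    fix g assume "g \<in> coordinate_ring X"
    then obtain g' where g': "g' \<in> polynomial_functions" "g = restr X g'" by (auto simp: coordinate_ring_restr)
    have gp: "g p = g' p" using p by (simp add: g' restr_def)
    have "\<phi> v (restr X (f' + g')) = \<phi> v (restr X f') + \<phi> v (restr X g')"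
      using f' g' pf(6)[OF f'(1) g'(1)] by (simp only: \<phi>[OF v] ddir_plus)
    then show "\<phi> v (f + g) = \<phi> v f + \<phi> v g" by (simp only: f'(2) g'(2) restr_add)
    have "\<phi> v (restr X (f' * g')) = f' p * \<phi> v (restr X g') + g' p * \<phi> v (restr X f')"
      using f' g' pf(4)[OF f'(1) g'(1)] by (simp only: \<phi>[OF v] ddir_times)
    then show "\<phi> v (f * g) = f p * \<phi> v g + g p * \<phi> v f" unfolding fp gp by (simp only: f'(2) g'(2) restr_mult)
  qed (simp add: \<phi>_def)
  moreover have "D \<in> \<phi> ` tangent X p" if D: "D \<in> tangent_space X p" for D
  proof -
    note d = D[unfolded tangent_space_def, simplified, THEN conjunct1]
      D[unfolded tangent_space_def, simplified, THEN conjunct2, THEN conjunct1]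
      D[unfolded tangent_space_def, simplified, THEN conjunct2, THEN conjunct2, THEN conjunct1]
      D[unfolded tangent_space_def, simplified, THEN conjunct2, THEN conjunct2, THEN conjunct2]
    define v where "v = (\<chi> i. D (restr X (\<lambda>q. q $ i)))"
    have cr: "restr X g \<in> coordinate_ring X" if "g \<in> polynomial_functions" for g
      using that by (auto simp: coordinate_ring_restr)
    have "D (restr X (1 * 1)) = 0"
    proof -
      have "restr X 1 p = 1" using p by (simp add: restr_def)
      then have "D (restr X (1 * 1)) = D (restr X 1) + D (restr X 1)"
        unfolding restr_mult using d(4) cr[OF pf(2)] by (metis mult_1)
      then have "D (restr X 1) = D (restr X 1) + D (restr X 1)" by (simp only: mult_1)
      then have "D (restr X 1) = 0" by (simp only: add_cancel_right_right[of "D (restr X 1)" "D (restr X 1)"])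
      then show ?thesis by (simp only: mult_1)
    qed
    then have D1: "D (restr X 1) = 0" by simp
    have Dg: "D (restr X g) = ddir g p v" if "g \<in> polynomial_functions" for g
      using that
    proof induction
      case (const c)
      have "restr X (\<lambda>p. c) = scale_fun c (restr X 1)" by (auto simp: restr_def scale_fun_def)
      then show ?case using d(3) cr[OF pf(2)] D1 by (simp add: ddir_const)
    next
      case (coordinate i)
      then show ?case by (simp add: ddir_coord v_def)
    next
      case (add f g)
      have "restr X (\<lambda>p. f p + g p) = restr X f + restr X g" by (auto simp: restr_def)
      then show ?case using d(2) cr add by (simp add: ddir_add del: plus_fun_apply)
    next
      case (mult f g)
      have "restr X (\<lambda>p. f p * g p) = restr X f * restr X g" by (auto simp: restr_def)
      moreover have "restr X f p = f p" "restr X g p = g p" using p by (auto simp: restr_def)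
      ultimately show ?case using d(4) cr mult by (simp add: ddir_mult del: times_fun_apply)
    qed
    have "D 0 = 0" using d(2) cr[OF pf(1)] by (metis add_cancel_right_left coordinate_ring_0 add_0)
    have "v \<in> tangent X p" unfolding tangent_def
    proof (intro CollectI ballI)
      fix g assume g: "g \<in> vanishing X"
      then have "restr X g = 0" by (auto simp: vanishing_def restr_def)
      then show "dot (grad g p) v = 0" using Dg[of g] g \<open>D 0 = 0\<close> by (simp add: vanishing_def ddir_grad)
    qed
    moreover have "D f = \<phi> v f" for f
    proof (cases "f \<in> coordinate_ring X")
      case True
      then obtain g where "g \<in> polynomial_functions" "f = restr X g" by (auto simp: coordinate_ring_restr)
      then show ?thesis using Dg \<phi>[OF \<open>v \<in> tangent X p\<close>] by simp
    qed (use d(1) in \<open>simp add: \<phi>_def\<close>)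
    ultimately show ?thesis by blast
  qed
  ultimately have im: "tangent_space X p = \<phi> ` tangent X p" by blast
  interpret VS: finite_dimensional_vector_space_pair_1 "(*s) :: 'k \<Rightarrow> 'k^'n \<Rightarrow> 'k^'n" cart_basis
    "scale_fun :: 'k \<Rightarrow> (('k^'n \<Rightarrow> 'k) \<Rightarrow> 'k) \<Rightarrow> _"
    by (intro finite_dimensional_vector_space_pair_1.intro vec.finite_dimensional_vector_space_axioms vector_space_scale_fun)
  have "Vector_Spaces.linear (*s) scale_fun \<phi>"
    unfolding Vector_Spaces.linear_iff
    using vec.vector_space_axioms vector_space_scale_fun
    by (auto simp: \<phi>_def fun_eq_iff scale_fun_def dot_add_right dot_scale_right)
  moreover have "inj_on \<phi> (vec.span (tangent X p))"
  proof (rule inj_onI)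
    fix v w assume "v \<in> vec.span (tangent X p)" "w \<in> vec.span (tangent X p)" and eq: "\<phi> v = \<phi> w"
    then have vw: "v \<in> tangent X p" "w \<in> tangent X p" using tangent_subspace vec.span_eq_iff by blast+
    have "v $ i = w $ i" for i
      using eq \<phi>[OF vw(1) polynomial_functions.coordinate[of i]] \<phi>[OF vw(2) polynomial_functions.coordinate[of i]]
      by (simp add: ddir_coord)
    then show "v = w" by (simp add: vec_eq_iff)
  qed
  ultimately show ?thesis unfolding im by (rule VS.dim_image_eq)
qed

section \<open>Cramer's rule with polynomial entries\<close>

lemma pf_sum: "(\<And>i. i \<in> A \<Longrightarrow> f i \<in> polynomial_functions) \<Longrightarrow> (\<lambda>q. \<Sum>i\<in>A. f i q) \<in> polynomial_functions"
  by (induction A rule: infinite_finite_induct)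
    (auto intro: polynomial_functions.add polynomial_functions.const simp del: zero_fun_eta)

lemma pf_prod: "(\<And>i. i \<in> A \<Longrightarrow> f i \<in> polynomial_functions) \<Longrightarrow> (\<lambda>q. \<Prod>i\<in>A. f i q) \<in> polynomial_functions"
  by (induction A rule: infinite_finite_induct)
    (auto intro: polynomial_functions.mult polynomial_functions.const simp del: zero_fun_eta)

lemma det_polynomial:
  assumes "\<And>i j. (\<lambda>q. A q $ i $ j) \<in> polynomial_functions"
  shows "(\<lambda>q. det (A q)) \<in> polynomial_functions"
  unfolding det_def
  by (intro pf_sum polynomial_functions.mult polynomial_functions.const pf_prod assms)

text \<open>The adjugate of \<open>A\<close> applied to \<open>b\<close>: the solution of the linear
  system with its denominator \<open>det A\<close> cleared, hence polynomial in the entries even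
  where \<open>A\<close> is singular.\<close>

definition cramer_vec :: "'k::field^'n^'n \<Rightarrow> 'k^'n \<Rightarrow> 'k^'n" where
  "cramer_vec A b = (\<chi> k. det (\<chi> i j. if j = k then b $ i else A $ i $ j))"

lemma cramer_vec_mult: "cramer_vec A (A *v x) = det A *s x"
  by (simp add: cramer_vec_def vec_eq_iff cramer_lemma mult.commute)

lemma mult_cramer_vec:
  fixes A :: "'k::field^'n^'n"
  assumes "det A \<noteq> 0"
  shows "A *v cramer_vec A b = det A *s b"
proof -
  define x where "x = (\<chi> k. det (\<chi> i j. if j = k then b $ i else A $ i $ j) / det A)"
  have x: "b = A *v x" unfolding x_def
    by (rule sym, rule iffD2[OF cramer[OF assms] refl])
  show ?thesis
    unfolding x cramer_vec_mult vector_scalar_commute ..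
qed

lemma cramer_vec_polynomial:
  assumes "\<And>i j. (\<lambda>q. A q $ i $ j) \<in> polynomial_functions" "\<And>i. (\<lambda>q. b q $ i) \<in> polynomial_functions"
  shows "(\<lambda>q. cramer_vec (A q) (b q) $ k) \<in> polynomial_functions"
  unfolding cramer_vec_def vec_lambda_beta
proof (intro det_polynomial)
  show "(\<lambda>q. (\<chi> i j. if j = k then b q $ i else A q $ i $ j) $ i $ j) \<in> polynomial_functions" for i j
    by (cases "j = k") (auto simp: assms)
qed

lemma smooth_dim:
  fixes p :: "'k::alg_closed_field^'n"
  assumes "smooth_variety X" "p \<in> X"
  shows "local_dimension X p = enat (vec.dim (tangent X p))"
proof -
  have "enat (vector_space.dim scale_fun (tangent_space X p)) = local_dimension X p"
    using assms unfolding smooth_variety_def by blast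
  then show ?thesis unfolding dim_tangent_space[OF assms(2)] by (rule sym)
qed

text \<open>The equations \<open>F r\<close> that cut out the tangent space at \<open>p\<close> keep
  independent gradients wherever the determinant \<open>h\<close> is non-zero.\<close>

lemma tangent_dim_upper_semicontinuous:
  fixes p :: "'k::alg_closed_field^'n"
  assumes "p \<in> X"
  shows "\<exists>h\<in>polynomial_functions. h p \<noteq> 0 \<and> (\<forall>q\<in>X. h q \<noteq> 0 \<longrightarrow> vec.dim (tangent X q) \<le> vec.dim (tangent X p))"
proof -
  obtain F e R where ad: "adapted X p F e R" using adapted_coordinates[OF assms] by blast
  note F = adaptedD(1-3)[OF ad] and det = adaptedD(4)[OF ad] and FR = adaptedD(5)[OF ad]
    and lin = adaptedD(6)[OF ad] and T = adaptedD(7)[OF ad]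
  define h where "h q = det (\<chi> i. grad (F i) q)" for q
  have "h \<in> polynomial_functions" unfolding h_def[abs_def]
    by (rule det_polynomial) (simp add: grad_polynomial[OF F(1)])
  moreover have "h p \<noteq> 0" using det by (simp add: h_def F)
  moreover have "vec.dim (tangent X q) \<le> vec.dim (tangent X p)" if "q \<in> X" "h q \<noteq> 0" for q
  proof -
    have "tangent X q \<subseteq> {v. \<forall>r\<in>R. dot (grad (F r) q) v = 0}" using FR by (auto simp: tangent_def)
    then have "vec.dim (tangent X q) \<le> vec.dim {v. \<forall>r\<in>R. dot (grad (F r) q) v = 0}" by (rule vec.dim_subset)
    then show ?thesis using dim_kernel_rows[of "\<lambda>i. grad (F i) q" R] dim_kernel_rows[OF det, of R] that T
      by (simp add: h_def)
  qed
  ultimately show ?thesis by blast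
qed

definition tangent_map :: "('k::alg_closed_field^'n) set \<Rightarrow> ('k^'n \<Rightarrow> 'k^'n) \<Rightarrow> bool" where
  "tangent_map X w \<longleftrightarrow> (\<forall>i. (\<lambda>q. w q $ i) \<in> polynomial_functions) \<and> (\<forall>q\<in>X. w q \<in> tangent X q)"

text \<open>The chain given by smoothness shows that the \<open>F r\<close> generate the ideal of
  \<open>X\<close> up to a multiplier \<open>u\<close>. Tangency then needs to be checked against
  the \<open>F r\<close> only, and the adjugate solves these linear conditions polynomially.\<close>

theorem tangent_vector_extends:
  fixes p :: "'k::alg_closed_field^'n"
  assumes X: "algebraic_set X" "smooth_variety X" and p: "p \<in> X" and v: "v \<in> tangent X p"
  shows "\<exists>w. tangent_map X w \<and> w p = v"
proof -
  obtain F e R where ad: "adapted X p F e R" using adapted_coordinates[OF p] by blast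
  note F = adaptedD(1-3)[OF ad] and det = adaptedD(4)[OF ad] and FR = adaptedD(5)[OF ad]
    and lin = adaptedD(6)[OF ad] and T = adaptedD(7)[OF ad]
  let ?F = "{Z. irreducible_algebraic_set Z \<and> Z \<subseteq> X \<and> p \<in> Z}"
  have "chain_length ?F = enat (card (- R))"
    using smooth_dim[OF X(2) p] dim_kernel_rows[OF det, of R] by (simp add: local_dimension_def T)
  moreover have "{p} \<in> ?F" using p irreducible_singleton by blast
  ultimately obtain Z where Z: "\<And>i. i \<le> card (- R) \<Longrightarrow> Z i \<in> ?F" "\<And>i. i < card (- R) \<Longrightarrow> Z i \<subset> Z (Suc i)"
    using has_chain_attained[of ?F "card (- R)"] unfolding has_chain_def by blast
  have sub: "vanishing X \<subseteq> gen (F ` R \<union> mpow p k)" for k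
  proof (rule vanishing_subset_mpow[OF F det lin FR vanishing_ideal])
    show "vanishing X \<subseteq> mpow p 1" unfolding mpow_1 using p by (auto simp: vanishing_def)
    show "is_prime (vanishing (Z i))" if "i \<le> card (- R)" for i using Z(1)[OF that] vanishing_prime by blast
    show "vanishing (Z (Suc i)) \<subset> vanishing (Z i)" if "i < card (- R)" for i
      using Z(1)[of i] Z(1)[of "Suc i"] Z(2)[OF that] that
      by (intro vanishing_psubset) (auto simp: irreducible_algebraic_set_def)
    show "vanishing (Z 0) \<subseteq> mpow p 1" unfolding mpow_1 using Z(1)[of 0] by (auto simp: vanishing_def)
    show "vanishing X \<subseteq> vanishing (Z (card (- R)))" using Z(1)[of "card (- R)"] by (auto simp: vanishing_def)
  qed
  let ?J = "gen (F ` R)"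
  have J: "is_ideal polynomial_functions ?J" using F by (intro gen_ideal) auto
  have "?J \<subseteq> vanishing X" using FR by (intro gen_subset vanishing_ideal) auto
  moreover have "vanishing X \<subseteq> gen (?J \<union> mpow p k)" for k
  proof -
    have "gen (F ` R \<union> mpow p k) \<subseteq> gen (?J \<union> mpow p k)"
      by (intro gen_mono) (auto intro: gen_base)
    then show ?thesis using sub by blast
  qed
  ultimately obtain u where u: "u \<in> polynomial_functions" "u p \<noteq> 0" "\<And>f. f \<in> vanishing X \<Longrightarrow> u * f \<in> ?J"
    using krull_intersection[OF vanishing_ideal J] by blast
  define M where "M q = (\<chi> i. grad (F i) q)" for q
  define c where "c = M p *v v"
  define w0 where "w0 q = cramer_vec (M q) c" for q
  \<comment> \<open>The factor \<open>u\<close> reduces tangency to the \<open>F r\<close>,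
    \<open>det (M q)\<close> disposes of the points where the frame degenerates, and the constant
    normalizes the value at \<open>p\<close>, where \<open>w0 p\<close> is \<open>det (M p)\<close>
    times \<open>v\<close>.\<close>
  define a where "a q = u q * det (M q) * (1 / (u p * det (M p) * det (M p)))" for q
  have Mpf: "(\<lambda>q. M q $ i $ j) \<in> polynomial_functions" for i j
    unfolding M_def by (simp add: grad_polynomial[OF F(1)])
  have detp: "det (M p) \<noteq> 0" using det by (simp add: M_def F)
  have "(\<lambda>q. (a q *s w0 q) $ i) \<in> polynomial_functions" for i
    unfolding a_def w0_def vector_smult_component
    by (intro polynomial_functions.mult polynomial_functions.const u det_polynomial cramer_vec_polynomial Mpf)
  moreover have "a q *s w0 q \<in> tangent X q" if q: "q \<in> X" for q
  proof (cases "det (M q) = 0")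
    case True
    then show ?thesis using vec.subspace_0[OF tangent_subspace] by (simp add: a_def)
  next
    case False
    have "dot (grad (F r) q) (w0 q) = 0" if "r \<in> R" for r
    proof -
      have "dot (grad (F r) q) (w0 q) = (M q *v w0 q) $ r" unfolding M_def matrix_rows_mult by simp
      also have "\<dots> = det (M q) * c $ r" unfolding w0_def mult_cramer_vec[OF False] by simp
      also have "c $ r = dot (e r) v" unfolding c_def M_def matrix_rows_mult by (simp add: F)
      also have "\<dots> = 0" using v that by (simp add: T)
      finally show ?thesis by simp
    qed
    then have Fr: "ddir (F r) q (w0 q) = 0" if "r \<in> R" for r using that by (simp add: ddir_grad F)
    have "y \<in> polynomial_functions \<and> ddir y q (w0 q) = 0" if "y \<in> ?J" for y
      using that
    proof induction
      case zero
      then show ?case by (simp add: pf(1))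
    next
      case (step b f y)
      then obtain r where r: "r \<in> R" "f = F r" by blast
      have "F r q = 0" using FR[OF r(1)] q by (simp add: vanishing_def)
      then have "ddir (b * f) q (w0 q) = 0" unfolding r(2) ddir_times[OF step(1) F(1)] by (simp add: Fr r)
      moreover have bf: "b * f \<in> polynomial_functions" unfolding r(2) by (intro pf(4) step(1) F)
      ultimately show ?case using step(4) ddir_plus[OF bf] pf(6)[OF bf] by (metis add_0)
    qed
    then have J0: "ddir y q (w0 q) = 0" if "y \<in> ?J" for y using that by blast
    have "dot (grad f q) (a q *s w0 q) = 0" if f: "f \<in> vanishing X" for f
    proof -
      have fp: "f \<in> polynomial_functions" "f q = 0" using f q by (auto simp: vanishing_def)
      \<comment> \<open>As \<open>f q = 0\<close>, the product rule for \<open>u * f\<close> leaves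
        only the term with the derivative of \<open>f\<close>.\<close>
      have "0 = u q * ddir f q (w0 q)"
        using J0[OF u(3)[OF f]] unfolding ddir_times[OF u(1) fp(1)] by (simp add: fp(2))
      then show ?thesis unfolding ddir_grad[OF fp(1)] dot_scale_right a_def by auto
    qed
    then show ?thesis by (simp add: tangent_def)
  qed
  moreover have "a p *s w0 p = v"
    unfolding w0_def c_def cramer_vec_mult using u(2) detp by (simp add: a_def)
  ultimately show ?thesis by (intro exI[of _ "\<lambda>q. a q *s w0 q"]) (auto simp: tangent_map_def)
qed

lemma tangent_dim_le:
  assumes "smooth_variety X" "krull_dimension X = enat n" "p \<in> X"
  shows "vec.dim (tangent X p) \<le> n"
proof -
  have "enat (vec.dim (tangent X p)) = local_dimension X p"
    using smooth_dim[OF assms(1,3)] by simp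
  also have "\<dots> \<le> krull_dimension X"
    unfolding local_dimension_def krull_dimension_def chain_length_def
    by (rule SUP_subset_mono) blast+
  finally show ?thesis using assms(2) by simp
qed

section \<open>Irreducible components\<close>

lemma algebraic_wf: "wf {(Y, Z :: ('k::field^'n) set). algebraic_set Y \<and> algebraic_set Z \<and> Y \<subset> Z}"
proof (rule wf_subset)
  show "wf (inv_image {(J, I). is_ideal polynomial_functions I \<and> is_ideal polynomial_functions J \<and> I \<subset> J}
    (vanishing :: ('k^'n) set \<Rightarrow> _))"
    by (rule wf_inv_image[OF noetherian_wf[OF noetherian_polynomial_functions]])
qed (auto simp: inv_image_def vanishing_ideal dest: vanishing_psubset)

lemma vanishing_separates: "algebraic_set Z \<Longrightarrow> p \<notin> Z \<Longrightarrow> \<exists>f\<in>vanishing Z. f p \<noteq> 0"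
  by (subst (asm) (2) algebraic_set_vanishing) auto

lemma algebraic_Int: "algebraic_set A \<Longrightarrow> algebraic_set B \<Longrightarrow> algebraic_set (A \<inter> B)"
proof (rule algebraic_setI)
  fix p assume *: "algebraic_set A" "algebraic_set B" "\<And>f. f \<in> vanishing (A \<inter> B) \<Longrightarrow> f p = 0"
  have "vanishing A \<subseteq> vanishing (A \<inter> B)" "vanishing B \<subseteq> vanishing (A \<inter> B)" by (auto simp: vanishing_def)
  then have "\<forall>f\<in>vanishing A. f p = 0" "\<forall>f\<in>vanishing B. f p = 0" using *(3) by blast+
  then show "p \<in> A \<inter> B" using vanishing_separates[OF *(1), of p] vanishing_separates[OF *(2), of p] by auto
qed

lemma algebraic_Un: "algebraic_set A \<Longrightarrow> algebraic_set B \<Longrightarrow> algebraic_set (A \<union> B)"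
proof (rule algebraic_setI, rule ccontr)
  fix p assume *: "algebraic_set A" "algebraic_set B" "\<And>f. f \<in> vanishing (A \<union> B) \<Longrightarrow> f p = 0" "p \<notin> A \<union> B"
  obtain f where f: "f \<in> vanishing A" "f p \<noteq> 0" using vanishing_separates[OF *(1), of p] *(4) by auto
  obtain g where g: "g \<in> vanishing B" "g p \<noteq> 0" using vanishing_separates[OF *(2), of p] *(4) by auto
  have "f * g \<in> vanishing (A \<union> B)" using f g pf(4)[of f g] by (auto simp: vanishing_def)
  from *(3)[OF this] show False using f g by simp
qed

lemma algebraic_empty: "algebraic_set {}"
proof (rule algebraic_setI)
  fix p :: "'a^'b" assume "\<And>f. f \<in> vanishing {} \<Longrightarrow> f p = 0"
  from this[of 1] show "p \<in> {}" by (simp add: vanishing_def pf(2))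
qed

lemma algebraic_Union: "finite W \<Longrightarrow> (\<And>Y. Y \<in> W \<Longrightarrow> algebraic_set Y) \<Longrightarrow> algebraic_set (\<Union>W)"
  by (induction W rule: finite_induct) (auto intro: algebraic_Un algebraic_empty)

lemma irreducible_subset_Union:
  assumes "irreducible_algebraic_set Y" "finite W" "\<And>Z. Z \<in> W \<Longrightarrow> algebraic_set Z" "Y \<subseteq> \<Union>W"
  shows "\<exists>Z\<in>W. Y \<subseteq> Z"
  using assms(2-4)
proof (induction W rule: finite_induct)
  case empty
  then show ?case using assms(1) by (simp add: irreducible_algebraic_set_def)
next
  case (insert Z W)
  have "Y \<subseteq> Z \<union> \<Union>W" using insert.prems(2) by simp
  moreover have "algebraic_set Z" "algebraic_set (\<Union>W)" using insert algebraic_Union by blast+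
  ultimately have "Y \<subseteq> Z \<or> Y \<subseteq> \<Union>W" using assms(1) unfolding irreducible_algebraic_set_def by blast
  then show ?case using insert by blast
qed

lemma irreducible_decomposition:
  assumes "algebraic_set Z"
  shows "\<exists>W. finite W \<and> (\<forall>Y\<in>W. irreducible_algebraic_set Y) \<and> Z = \<Union>W"
  using algebraic_wf assms
proof (induction Z rule: wf_induct_rule)
  case (less Z)
  show ?case
  proof (cases "irreducible_algebraic_set Z \<or> Z = {}")
    case True
    then show ?thesis
    proof
      assume "irreducible_algebraic_set Z"
      then show ?thesis by (intro exI[of _ "{Z}"]) auto
    qed (intro exI[of _ "{}"], auto)
  next
    case False
    then obtain A B where AB: "algebraic_set A" "algebraic_set B" "Z \<subseteq> A \<union> B" "\<not> Z \<subseteq> A" "\<not> Z \<subseteq> B"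
      using less.prems unfolding irreducible_algebraic_set_def by blast
    have i: "algebraic_set (Z \<inter> A)" "algebraic_set (Z \<inter> B)" using algebraic_Int less.prems AB by blast+
    have "(Z \<inter> A, Z) \<in> {(Y, Z). algebraic_set Y \<and> algebraic_set Z \<and> Y \<subset> Z}"
      "(Z \<inter> B, Z) \<in> {(Y, Z). algebraic_set Y \<and> algebraic_set Z \<and> Y \<subset> Z}"
      using i less.prems AB by auto
    then obtain V W where VW: "finite V" "\<forall>Y\<in>V. irreducible_algebraic_set Y" "Z \<inter> A = \<Union>V"
      "finite W" "\<forall>Y\<in>W. irreducible_algebraic_set Y" "Z \<inter> B = \<Union>W"
      using less.IH i by meson
    have "Z = (Z \<inter> A) \<union> (Z \<inter> B)" using AB(3) by blast
    then have "Z = \<Union>(V \<union> W)" unfolding VW(3,6) by simp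
    then show ?thesis using VW by (intro exI[of _ "V \<union> W"]) auto
  qed
qed

section \<open>The Nullstellensatz\<close>

text \<open>Powers of the leading coefficient clear the denominators of ordinary division. The bound
  on the degree of the quotient is what excludes one of the cases in
  \<open>extend_zero\<close>.\<close>

lemma pseudo_division:
  assumes R: "is_subring R" and G: "\<And>k. coeff G k \<in> R" "degree G > 0" and H: "\<And>k. coeff H k \<in> R"
  shows "\<exists>k q r. (\<forall>k. coeff q k \<in> R) \<and> (\<forall>k. coeff r k \<in> R) \<and> smult (lead_coeff G ^ k) H = G * q + r \<and>
    degree r < degree G \<and> degree q \<le> degree H - degree G"
  using H
proof (induction "degree H" arbitrary: H rule: less_induct)
  case less
  note r = subringD[OF R]
  let ?m = "degree G" and ?c = "lead_coeff G"
  show ?case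
  proof (cases "degree H < ?m")
    case True
    then show ?thesis using less.prems r by (intro exI[of _ 0] exI[of _ H] exI[of _ "0::nat"] conjI) auto
  next
    case False
    define M where "M = monom (lead_coeff H) (degree H - ?m)"
    define H' where "H' = smult ?c H - M * G"
    have MR: "coeff M k \<in> R" for k using less.prems r by (auto simp: M_def)
    have MG: "coeff (M * G) k \<in> R" for k using less.prems G r by (auto simp: M_def coeff_monom_mult)
    have H'R: "coeff H' k \<in> R" for k unfolding H'_def using MG less.prems G r by auto
    have dM: "degree M \<le> degree H - ?m" unfolding M_def by (rule degree_monom_le)
    then have "degree (M * G) \<le> degree H" using degree_mult_le[of M G] False by linarith
    then have "degree H' \<le> degree H"
      unfolding H'_def by (intro degree_diff_le degree_smult_le)
    moreover have "coeff H' (degree H) = 0"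
      using False by (simp add: H'_def M_def coeff_monom_mult)
    ultimately have lt: "degree H' < degree H"
      using eq_zero_or_degree_less[of H' "degree H"] False G(2) by auto
    from less.hyps[OF this H'R] obtain k q t where q: "\<And>k. coeff q k \<in> R" "\<And>k. coeff t k \<in> R"
      "smult (?c ^ k) H' = G * q + t" "degree t < ?m" "degree q \<le> degree H' - ?m" by blast
    let ?q = "q + smult (?c ^ k) M"
    have "smult (?c ^ Suc k) H = smult (?c ^ k) H' + G * smult (?c ^ k) M"
      by (simp add: H'_def smult_diff_right mult.commute)
    also have "\<dots> = G * ?q + t" by (simp add: q(3) algebra_simps)
    finally have "smult (?c ^ Suc k) H = G * ?q + t" .
    moreover have "coeff ?q j \<in> R" for j using q MR G r subring_power[OF R] by auto
    moreover have "degree ?q \<le> degree H - ?m"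
      using q(5) lt dM by (intro degree_add_le order.trans[OF degree_smult_le]) linarith+
    ultimately show ?thesis using q(2,4) by blast
  qed
qed

lemma poly_in_adjoin: "\<forall>k. coeff F k \<in> R \<Longrightarrow> poly F x \<in> adjoin R x"
  by (auto simp: adjoin_def)

lemma poly_in_ideal:
  assumes "is_ideal T I" "x \<in> T" "is_subring T" "\<And>k. coeff F k \<in> I"
  shows "poly F x \<in> I"
  unfolding poly_altdef
  by (intro ideal_sum[OF assms(1)] idealD(5)[OF assms(1)] subring_power assms)

text \<open>Take least degree among the polynomials with value in \<open>I\<close> and some
  coefficient outside \<open>P\<close>. If the leading coefficient were in \<open>P\<close>,
  removing the leading monomial would give a smaller one.\<close>

lemma minimal_lead_coeff:
  assumes R: "is_subring R" and P: "is_ideal (adjoin R x) P" and I: "is_ideal (adjoin R x) I" "P \<subseteq> I"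
    and H: "\<And>k. coeff H k \<in> R" "poly H x \<in> I" "\<exists>k. coeff H k \<notin> P"
  shows "\<exists>G. (\<forall>k. coeff G k \<in> R) \<and> poly G x \<in> I \<and> lead_coeff G \<notin> P \<and>
    (\<forall>H. (\<forall>k. coeff H k \<in> R) \<longrightarrow> poly H x \<in> I \<longrightarrow> degree H < degree G \<longrightarrow> (\<forall>k. coeff H k \<in> P))"
proof -
  note T = subring_adjoin[OF R, of x] and r = subringD[OF R]
  define c where "c G \<longleftrightarrow> (\<forall>k. coeff G k \<in> R) \<and> poly G x \<in> I \<and> (\<exists>k. coeff G k \<notin> P)" for G
  have "c H" using H by (simp add: c_def)
  then obtain G where G: "c G" "\<And>H. c H \<Longrightarrow> degree G \<le> degree H" using ex_has_least_nat[of c H degree] by blast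
  have "lead_coeff G \<notin> P"
  proof
    assume l: "lead_coeff G \<in> P"
    define M where "M = monom (lead_coeff G) (degree G)"
    obtain k where k: "coeff G k \<notin> P" using G(1) by (auto simp: c_def)
    then have "k \<noteq> degree G" using l by auto
    then have "coeff (G - M) k \<notin> P" using k by (simp add: M_def)
    moreover have "poly M x \<in> P"
      using adjoin_gen[OF R] l unfolding M_def poly_monom by (intro idealD(5)[OF P] subring_power[OF T])
    then have "poly (G - M) x \<in> I" using G(1) ideal_diff[OF T I(1)] I(2) by (auto simp: c_def)
    moreover have "coeff (G - M) j \<in> R" for j using G(1) r by (auto simp: c_def M_def)
    ultimately have cc: "c (G - M)" by (auto simp: c_def)
    have "degree (G - M) \<le> degree G" unfolding M_def by (intro degree_diff_le degree_monom_le) simp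
    moreover have "coeff (G - M) (degree G) = 0" by (simp add: M_def)
    ultimately have "G - M = 0 \<or> degree (G - M) < degree G" by (rule eq_zero_or_degree_less)
    moreover have "G - M \<noteq> 0" using \<open>coeff (G - M) k \<notin> P\<close> idealD(1)[OF P] by (metis coeff_0)
    ultimately show False using G(2)[OF cc] by simp
  qed
  then show ?thesis using G unfolding c_def by (metis not_le)
qed

section \<open>Elimination of one coordinate at a time\<close>

primrec coord_ring :: "'n list \<Rightarrow> ('k::field^'n \<Rightarrow> 'k) set" where
  "coord_ring [] = range (\<lambda>c _. c)"
| "coord_ring (i # xs) = adjoin (coord_ring xs) (coord i)"

lemma coord_ring_subring: "is_subring (coord_ring xs)"
  by (induction xs) (use noetherian_constants in \<open>auto simp: noetherian_def intro: subring_adjoin\<close>)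

lemma coord_ring_const: "(\<lambda>_. c) \<in> coord_ring xs"
  by (induction xs) (auto intro: adjoin_base coord_ring_subring)

lemma coord_ring_coord: "i \<in> set xs \<Longrightarrow> coord i \<in> coord_ring xs"
  by (induction xs) (auto intro: adjoin_base adjoin_gen coord_ring_subring)

lemma coord_ring_polynomial: "coord_ring xs \<subseteq> polynomial_functions"
  by (induction xs)
    (auto intro: polynomial_functions.const dest: subsetD[OF adjoin_subset[OF polynomial_functions_subring _ polynomial_functions.coordinate]])

lemma coord_ring_UNIV:
  assumes "set xs = UNIV" "f \<in> polynomial_functions" shows "f \<in> coord_ring xs"
  using assms(2)
proof induction
  case (add f g)
  then show ?case using subringD(6)[OF coord_ring_subring, of f xs g] by (simp add: plus_fun_def)
next
  case (mult f g)
  then show ?case using subringD(4)[OF coord_ring_subring, of f xs g] by (simp add: times_fun_def)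
qed (use assms(1) coord_ring_coord coord_ring_const in auto)

definition upd :: "'k^'n \<Rightarrow> 'n \<Rightarrow> 'k \<Rightarrow> 'k^'n" where
  "upd p i t = (\<chi> j. if j = i then t else p $ j)"

lemma poly_fun_apply: "poly F g p = poly (map_poly (\<lambda>c. c p) F) (g p)"
  for F :: "('a \<Rightarrow> 'k::comm_ring_1) poly"
  by (induction F) (simp_all add: map_poly_pCons)

lemma coord_ring_upd: "i \<notin> set xs \<Longrightarrow> f \<in> coord_ring xs \<Longrightarrow> f (upd p i t) = f p"
proof (induction xs arbitrary: f)
  case (Cons j xs)
  obtain F where F: "f = poly F (coord j)" "\<And>k. coeff F k \<in> coord_ring xs"
    using Cons.prems(2) by (auto simp: adjoin_def)
  have "coeff F n (upd p i t) = coeff F n p" for n using Cons.IH[OF _ F(2)] Cons.prems(1) by simp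
  then have "map_poly (\<lambda>c. c (upd p i t)) F = map_poly (\<lambda>c. c p) F"
    by (intro poly_eqI) (simp add: coeff_map_poly)
  moreover have "upd p i t $ j = p $ j" using Cons.prems(1) by (auto simp: upd_def)
  ultimately show ?case unfolding F(1) poly_fun_apply by simp
qed auto

text \<open>Elimination of one variable: away from the zeros of some \<open>g\<close> outside the prime ideal, zeros
  of the contracted prime ideal extend.\<close>

lemma extend_zero:
  fixes P :: "('k::alg_closed_field^'n \<Rightarrow> 'k) set"
  assumes P: "is_prime P" and i: "i \<notin> set xs" and f: "f \<in> coord_ring (i # xs)" "f \<notin> P"
  shows "\<exists>g\<in>coord_ring xs. g \<notin> P \<and> (\<forall>p. (\<forall>h\<in>P \<inter> coord_ring xs. h p = 0) \<longrightarrow> g p \<noteq> 0 \<longrightarrow>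
    (\<exists>t. (\<forall>h\<in>P \<inter> coord_ring (i # xs). h (upd p i t) = 0) \<and> f (upd p i t) \<noteq> 0))"
proof -
  define R where "R = (coord_ring xs :: ('k^'n \<Rightarrow> 'k) set)"
  define x where "x = (coord i :: 'k^'n \<Rightarrow> 'k)"
  define T where "T = adjoin R x"
  define Q where "Q = P \<inter> T"
  have R: "is_subring R" unfolding R_def by (rule coord_ring_subring)
  have T: "is_subring T" unfolding T_def by (rule subring_adjoin[OF R])
  have Teq: "coord_ring (i # xs) = T" by (simp add: T_def R_def x_def)
  have Tp: "T \<subseteq> polynomial_functions" unfolding Teq[symmetric] by (rule coord_ring_polynomial)
  have RT: "R \<subseteq> T" unfolding T_def using adjoin_base[OF R] by blast
  have xT: "x \<in> T" unfolding T_def by (rule adjoin_gen[OF R])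
  have Pid: "is_ideal polynomial_functions P" using P by (simp add: is_prime_def)
  have Q: "is_ideal T Q" unfolding is_ideal_def Q_def
  proof (intro conjI ballI)
    show "0 \<in> P \<inter> T" using idealD(1)[OF Pid] subringD(1)[OF T] by simp
    show "a + b \<in> P \<inter> T" if "a \<in> P \<inter> T" "b \<in> P \<inter> T" for a b
      using that idealD(3)[OF Pid, of a b] subringD(6)[OF T, of a b] by simp
    show "a * b \<in> P \<inter> T" if "a \<in> T" "b \<in> P \<inter> T" for a b
      using that Tp idealD(4)[OF Pid, of a b] subringD(4)[OF T, of a b] by auto
  qed simp
  have prime: "a \<in> Q \<or> b \<in> Q" if "a * b \<in> Q" "a \<in> T" "b \<in> T" for a b
    using that P Tp unfolding is_prime_def Q_def by blast
  have fT: "f \<in> T" "f \<notin> Q" using f unfolding Teq Q_def by auto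
  have "1 \<notin> Q" using idealD(4)[OF Q fT(1), of 1] fT(2) by auto
  have pow: "a ^ k \<notin> Q" if "a \<in> T" "a \<notin> Q" for a k
  proof (induction k)
    case (Suc k)
    then show ?case using prime[of a "a ^ k"] that subring_power[OF T that(1)] unfolding power_Suc by blast
  qed (unfold power_0, fact)
  have polyT: "poly F x \<in> T" if "\<And>k. coeff F k \<in> R" for F
    unfolding T_def using that by (intro poly_in_adjoin) simp
  have polyQ: "poly F x \<in> Q" if "\<And>k. coeff F k \<in> Q" for F
    by (rule poly_in_ideal[OF Q xT T that])
  obtain F where F: "f = poly F x" "\<And>k. coeff F k \<in> R" using fT(1) by (auto simp: T_def adjoin_def)
  define ev where "ev p F = map_poly (\<lambda>c. c p) F" for p :: "'k^'n" and F :: "('k^'n \<Rightarrow> 'k) poly"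
  have ev_coeff: "coeff (ev p F) k = coeff F k p" for p F k by (simp add: ev_def coeff_map_poly)
  have ev: "poly H x (upd p i t) = poly (ev p H) t" if "\<And>k. coeff H k \<in> R" for H p t
  proof -
    have "coeff H n (upd p i t) = coeff H n p" for n
      using coord_ring_upd[OF i, of "coeff H n"] that unfolding R_def by simp
    then have "map_poly (\<lambda>c. c (upd p i t)) H = ev p H"
      by (intro poly_eqI) (simp add: coeff_map_poly ev_def)
    then show ?thesis unfolding poly_fun_apply by (simp add: x_def upd_def)
  qed
  have ev0: "ev p H = 0" if "\<And>k. coeff H k \<in> R" "\<And>k. coeff H k \<in> Q" "\<forall>h\<in>P \<inter> R. h p = 0" for H p
    using that by (intro poly_eqI) (auto simp: ev_coeff Q_def)
  show ?thesis
  proof (cases "\<exists>H. (\<forall>k. coeff H k \<in> R) \<and> poly H x \<in> Q \<and> (\<exists>k. coeff H k \<notin> Q)")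
    case False
    \<comment> \<open>Here \<open>x\<close> is transcendental over \<open>R\<close> modulo
      \<open>Q\<close>. Zeros of the contracted ideal extend with any \<open>t\<close>, and all but
      finitely many of them keep \<open>f\<close> non-zero.\<close>
    obtain k where k: "coeff F k \<notin> Q" using polyQ[of F] F fT(2) by blast
    have "\<exists>t. (\<forall>h\<in>Q. h (upd p i t) = 0) \<and> f (upd p i t) \<noteq> 0"
      if p: "\<forall>h\<in>P \<inter> R. h p = 0" "coeff F k p \<noteq> 0" for p
    proof -
      have "ev p F \<noteq> 0" using p(2) by (metis ev_coeff coeff_0)
      then obtain t where t: "poly (ev p F) t \<noteq> 0" using poly_ext[of "ev p F" 0] by auto
      moreover have "h (upd p i t) = 0" if "h \<in> Q" for h
      proof -
        obtain H where H: "h = poly H x" "\<And>k. coeff H k \<in> R"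
          using idealD(2)[OF Q \<open>h \<in> Q\<close>] by (auto simp: T_def adjoin_def)
        then have "\<And>k. coeff H k \<in> Q" using False \<open>h \<in> Q\<close> by blast
        then show ?thesis using ev0[OF H(2) _ p(1)] ev[OF H(2)] H(1) by simp
      qed
      ultimately show ?thesis using ev[OF F(2)] F(1) by auto
    qed
    moreover have "coeff F k \<in> R" "coeff F k \<notin> P" using F(2) k RT by (auto simp: Q_def)
    ultimately show ?thesis unfolding Teq R_def[symmetric] Q_def by blast
  next
    case True
    \<comment> \<open>Here \<open>x\<close> is algebraic over \<open>R\<close> modulo
      \<open>Q\<close>; \<open>G\<close> plays the role of its minimal polynomial, with leading
      coefficient not inverted.\<close>
    then obtain H where H: "\<And>k. coeff H k \<in> R" "poly H x \<in> Q" "\<exists>k. coeff H k \<notin> Q" by auto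
    from minimal_lead_coeff[OF R Q[unfolded T_def] Q[unfolded T_def] order.refl H]
    obtain G where G': "\<forall>k. coeff G k \<in> R" "poly G x \<in> Q" "lead_coeff G \<notin> Q"
      "\<forall>H. (\<forall>k. coeff H k \<in> R) \<longrightarrow> poly H x \<in> Q \<longrightarrow> degree H < degree G \<longrightarrow> (\<forall>k. coeff H k \<in> Q)"
      by (elim exE conjE)
    have G: "\<And>k. coeff G k \<in> R" "poly G x \<in> Q" "lead_coeff G \<notin> Q" using G' by simp_all
    have Gmin: "coeff H k \<in> Q" if "\<And>k. coeff H k \<in> R" "poly H x \<in> Q" "degree H < degree G" for H k
      using G'(4) that by simp
    let ?c = "lead_coeff G"
    have cT: "?c \<in> T" using G(1) RT by blast
    have dG: "degree G > 0"
    proof (rule ccontr)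
      assume "\<not> degree G > 0"
      then have "poly G x = ?c" by (simp add: poly_altdef)
      then show False using G(2,3) by metis
    qed
    \<comment> \<open>The aim is an element of \<open>R\<close> outside \<open>Q\<close> in the
      ideal generated by \<open>f\<close> and \<open>Q\<close>: if it is non-zero at the extended
      point, so is \<open>f\<close>.\<close>
    define I where "I = lin T (insert f Q)"
    have QT: "Q \<subseteq> T" using Q by (simp add: is_ideal_def)
    have I: "is_ideal T I" unfolding I_def using QT fT by (intro is_ideal_span[OF T]) auto
    have QI: "Q \<subseteq> I" and fI: "f \<in> I" unfolding I_def
      using lin_base[OF subringD(2)[OF T]] by (metis insertCI mult_1 subsetI)+
    have "\<exists>k. coeff G k \<notin> Q" using G(3) by blast
    from minimal_lead_coeff[OF R Q[unfolded T_def] I[unfolded T_def] QI G(1) subsetD[OF QI G(2)] this]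
    obtain S where S': "\<forall>k. coeff S k \<in> R" "poly S x \<in> I" "lead_coeff S \<notin> Q"
      "\<forall>H. (\<forall>k. coeff H k \<in> R) \<longrightarrow> poly H x \<in> I \<longrightarrow> degree H < degree S \<longrightarrow> (\<forall>k. coeff H k \<in> Q)"
      by (elim exE conjE)
    have S: "\<And>k. coeff S k \<in> R" "poly S x \<in> I" "lead_coeff S \<notin> Q" using S' by simp_all
    have Smin: "coeff H k \<in> Q" if "\<And>k. coeff H k \<in> R" "poly H x \<in> I" "degree H < degree S" for H k
      using S'(4) that by simp
    let ?b = "lead_coeff S"
    have bT: "?b \<in> T" using S(1) RT by blast
    \<comment> \<open>\<open>S\<close> acts as a common divisor of \<open>f\<close> and
      \<open>G\<close> over the fraction field modulo \<open>Q\<close>. As \<open>G\<close> is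
      irreducible there and \<open>f\<close> is non-zero, it has to be constant.\<close>
    have "degree S = 0"
    proof (rule ccontr)
      assume "degree S \<noteq> 0"
      then have dS: "degree S > 0" by simp
      have SG: "degree S \<le> degree G" using Smin[OF G(1)] G(2,3) QI by (metis not_le subsetD)
      obtain k q r where qr: "\<And>k. coeff q k \<in> R" "\<And>k. coeff r k \<in> R"
        "smult (?b ^ k) G = S * q + r" "degree r < degree S" "degree q \<le> degree G - degree S"
        using pseudo_division[OF R S(1) dS G(1)] by blast
      have qT: "poly q x \<in> T" and ST: "poly S x \<in> T" using polyT qr S by blast+
      have eq: "?b ^ k * poly G x = poly S x * poly q x + poly r x"
        using arg_cong[OF qr(3), of "\<lambda>H. poly H x"] by simp
      have bG: "?b ^ k * poly G x \<in> Q" using G(2) bT by (intro idealD(4)[OF Q] subring_power[OF T])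
      have "poly r x = ?b ^ k * poly G x - poly S x * poly q x" by (simp add: eq)
      moreover have "?b ^ k * poly G x - poly S x * poly q x \<in> I"
        by (rule ideal_diff[OF T I subsetD[OF QI bG] idealD(5)[OF I qT S(2)]])
      ultimately have rI: "poly r x \<in> I" by simp
      have rQ: "coeff r j \<in> Q" for j using Smin[OF qr(2) rI qr(4)] .
      have "poly S x * poly q x = ?b ^ k * poly G x - poly r x" by (simp add: eq)
      then have "poly S x * poly q x \<in> Q" using ideal_diff[OF T Q bG polyQ[OF rQ]] by simp
      then consider "poly S x \<in> Q" | "poly q x \<in> Q" using prime ST qT by blast
      then show False
      proof cases
        case 1
        \<comment> \<open>If \<open>S\<close> is itself a relation for \<open>x\<close>, it has at
          least the degree of \<open>G\<close>. The remainder of \<open>f\<close> on division by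
          \<open>G\<close> is then too short to be non-trivial, and \<open>f\<close> falls into
          \<open>Q\<close>.\<close>
        have GS: "degree G \<le> degree S" using Gmin[OF S(1) 1] S(3) by (metis not_le)
        obtain k q r where qr: "\<And>k. coeff q k \<in> R" "\<And>k. coeff r k \<in> R"
          "smult (?c ^ k) F = G * q + r" "degree r < degree G"
          using pseudo_division[OF R G(1) dG F(2)] by blast
        have eq: "?c ^ k * f = poly G x * poly q x + poly r x"
          using arg_cong[OF qr(3), of "\<lambda>H. poly H x"] by (simp add: F(1))
        have Gq: "poly G x * poly q x \<in> Q" using G(2) polyT[OF qr(1)] by (intro idealD(5)[OF Q])
        have "poly r x = ?c ^ k * f - poly G x * poly q x" by (simp add: eq)
        moreover have "?c ^ k * f - poly G x * poly q x \<in> I"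
          by (rule ideal_diff[OF T I idealD(4)[OF I subring_power[OF T cT] fI] subsetD[OF QI Gq]])
        ultimately have "poly r x \<in> I" by simp
        then have "poly r x \<in> Q" using Smin[OF qr(2)] qr(4) GS by (intro polyQ) auto
        then have "?c ^ k * f \<in> Q" unfolding eq using Gq idealD(3)[OF Q] by blast
        then show False using prime[of "?c ^ k" f] pow[OF cT G(3)] fT subring_power[OF T cT] by blast
      next
        case 2
        \<comment> \<open>If the quotient is a relation, its degree is too small, so its
          coefficients lie in \<open>Q\<close>, and with them the leading coefficient of the
          multiple of \<open>G\<close>.\<close>
        have "degree q < degree G" using qr(5) dS dG by linarith
        then have qQ: "coeff q j \<in> Q" for j using Gmin[OF qr(1) 2] by blast
        have "coeff (S * q) j \<in> Q" for j unfolding coeff_mult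
          using S(1) RT by (intro ideal_sum[OF Q] idealD(4)[OF Q] qQ) auto
        then have "coeff (S * q + r) (degree G) \<in> Q" using rQ idealD(3)[OF Q] by simp
        then have "?b ^ k * ?c \<in> Q" unfolding qr(3)[symmetric] by simp
        then show False using prime[of "?b ^ k" ?c] pow[OF bT S(3)] G(3) cT subring_power[OF T bT] by blast
      qed
    qed
    then have Sb: "poly S x = ?b" by (simp add: poly_altdef)
    then have "?b \<in> lin T (insert f Q)" using S(2) unfolding I_def by metis
    from lin_insert[OF this is_ideal_self[OF T]]
    obtain w y where w: "w \<in> T" "y \<in> lin T Q" "?b = w * f + y" by blast
    have yQ: "y \<in> Q" using w(2) lin_subset_ideal[OF Q order.refl order.refl] by blast
    \<comment> \<open>The condition on \<open>?c\<close> preserves the degree of \<open>G\<close>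
      under evaluation at \<open>p\<close>, so a root \<open>t\<close> exists; the condition on
      \<open>?b\<close> keeps \<open>f\<close> non-zero there, since
      \<open>?b = w * f + y\<close>.\<close>
    have "\<exists>t. (\<forall>h\<in>Q. h (upd p i t) = 0) \<and> f (upd p i t) \<noteq> 0"
      if p: "\<forall>h\<in>P \<inter> R. h p = 0" "(?b * ?c) p \<noteq> 0" for p
    proof -
      have bc: "?b p \<noteq> 0" "?c p \<noteq> 0" using p(2) by auto
      have "degree (ev p G) \<ge> degree G" using bc(2) by (intro le_degree) (simp add: ev_coeff)
      then obtain t where t: "poly (ev p G) t = 0" using dG alg_closed_imp_poly_has_root[of "ev p G"] by auto
      have z: "h (upd p i t) = 0" if h: "h \<in> Q" for h
      proof -
        obtain H where H: "h = poly H x" "\<And>k. coeff H k \<in> R"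
          using idealD(2)[OF Q h] by (auto simp: T_def adjoin_def)
        \<comment> \<open>Up to a power of \<open>?c\<close>, an element of \<open>Q\<close> is a
          multiple of \<open>G\<close> plus a remainder whose coefficients lie in \<open>Q\<close>
          and hence vanish at \<open>p\<close>.\<close>
        obtain k q r where qr: "\<And>k. coeff q k \<in> R" "\<And>k. coeff r k \<in> R"
          "smult (?c ^ k) H = G * q + r" "degree r < degree G"
          using pseudo_division[OF R G(1) dG H(2)] by blast
        have eq: "?c ^ k * h = poly G x * poly q x + poly r x"
          using arg_cong[OF qr(3), of "\<lambda>H. poly H x"] by (simp add: H(1))
        have "poly r x = ?c ^ k * h - poly G x * poly q x" by (simp add: eq)
        moreover have "?c ^ k * h - poly G x * poly q x \<in> Q"
          by (rule ideal_diff[OF T Q idealD(4)[OF Q subring_power[OF T cT] h] idealD(5)[OF Q polyT[OF qr(1)] G(2)]])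
        ultimately have "poly r x \<in> Q" by simp
        then have "\<And>j. coeff r j \<in> Q" using Gmin[OF qr(2)] qr(4) by blast
        then have "poly r x (upd p i t) = 0" using ev[OF qr(2)] ev0[OF qr(2) _ p(1)] by simp
        moreover have "poly G x (upd p i t) = 0" using ev[OF G(1)] t by simp
        moreover have "(?c ^ k * h) (upd p i t) = (poly G x * poly q x + poly r x) (upd p i t)" by (simp only: eq)
        moreover have "(?c ^ k) (upd p i t) = ?c p ^ k"
        proof -
          have "?c (upd p i t) = ?c p" using coord_ring_upd[OF i, of ?c] G(1) unfolding R_def by simp
          then show ?thesis by (induction k) auto
        qed
        ultimately show ?thesis using bc(2) by simp
      qed
      moreover have "f (upd p i t) \<noteq> 0"
      proof
        assume "f (upd p i t) = 0"
        then have "?b (upd p i t) = 0" using w(3) z[OF yQ] by simp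
        moreover have "?b (upd p i t) = ?b p" using coord_ring_upd[OF i, of ?b] S(1) unfolding R_def by simp
        ultimately show False using bc(1) by simp
      qed
      ultimately show ?thesis by blast
    qed
    moreover have "?b * ?c \<notin> P" using prime[OF _ bT cT] S(3) G(3) bT cT subringD(4)[OF T bT cT] unfolding Q_def by blast
    moreover have "?b * ?c \<in> R" by (intro subringD(4)[OF R] S G)
    ultimately show ?thesis unfolding Teq R_def[symmetric] Q_def by blast
  qed
qed

text \<open>The function \<open>f\<close> to be kept non-zero makes the induction work: the
  obstruction \<open>g\<close> to extending a zero is handed down as the \<open>f\<close> of the
  shorter list.\<close>

lemma prime_zero:
  fixes P :: "('k::alg_closed_field^'n \<Rightarrow> 'k) set"
  assumes P: "is_prime P" and "distinct xs" "f \<in> coord_ring xs" "f \<notin> P"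
  shows "\<exists>p. (\<forall>h\<in>P \<inter> coord_ring xs. h p = 0) \<and> f p \<noteq> 0"
  using assms(2-4)
proof (induction xs arbitrary: f)
  case Nil
  have Pid: "is_ideal polynomial_functions P" using P by (simp add: is_prime_def)
  have "c = 0" if "(\<lambda>_. c) \<in> P" for c
  proof (rule ccontr)
    assume "c \<noteq> 0"
    then have "f = (f * (\<lambda>_. 1 / c)) * (\<lambda>_. c)" by (auto simp: fun_eq_iff)
    moreover have "f * (\<lambda>_. 1 / c) \<in> polynomial_functions"
      using Nil coord_ring_polynomial by (intro pf(4) polynomial_functions.const) blast
    ultimately show False using Nil idealD(4)[OF Pid _ that] by metis
  qed
  then have "h p = 0" if "h \<in> P \<inter> coord_ring []" for h p using that by auto
  moreover obtain c where c: "f = (\<lambda>_. c)" using Nil by auto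
  then have "c \<noteq> 0" using Nil idealD(1)[OF Pid] by auto
  ultimately show ?case using c by blast
next
  case (Cons i xs)
  obtain g where g: "g \<in> coord_ring xs" "g \<notin> P"
    "\<And>p. (\<forall>h\<in>P \<inter> coord_ring xs. h p = 0) \<Longrightarrow> g p \<noteq> 0 \<Longrightarrow>
      (\<exists>t. (\<forall>h\<in>P \<inter> coord_ring (i # xs). h (upd p i t) = 0) \<and> f (upd p i t) \<noteq> 0)"
    using extend_zero[OF P _ Cons.prems(2,3)] Cons.prems(1) by auto
  obtain p where "\<forall>h\<in>P \<inter> coord_ring xs. h p = 0" "g p \<noteq> 0" using Cons.IH[OF _ g(1,2)] Cons.prems(1) by auto
  from g(3)[OF this] show ?case by blast
qed

text \<open>An ideal that is maximal among those containing \<open>I\<close> but not 1 is prime, so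
  it has a zero by elimination of all coordinates.\<close>

theorem nullstellensatz:
  fixes I :: "('k::alg_closed_field^'n \<Rightarrow> 'k) set"
  assumes I: "is_ideal polynomial_functions I" and no: "\<And>p. \<exists>f\<in>I. f p \<noteq> 0"
  shows "1 \<in> I"
proof (rule ccontr)
  assume one: "1 \<notin> I"
  let ?A = "{J. is_ideal polynomial_functions J \<and> I \<subseteq> J \<and> 1 \<notin> J}"
  let ?r = "{(J, I :: ('k^'n \<Rightarrow> 'k) set). is_ideal polynomial_functions I \<and> is_ideal polynomial_functions J \<and> I \<subset> J}"
  have "I \<in> ?A" using I one by blast
  from wfE_min[OF noetherian_wf[OF noetherian_polynomial_functions] this]
  obtain P where P: "P \<in> ?A" "\<And>J. (J, P) \<in> ?r \<Longrightarrow> J \<notin> ?A" by blast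
  have Pid: "is_ideal polynomial_functions P" using P by blast
  have Pp: "P \<subseteq> polynomial_functions" using Pid by (simp add: is_ideal_def)
  have "f \<in> P \<or> g \<in> P" if fg: "f \<in> polynomial_functions" "g \<in> polynomial_functions" "f * g \<in> P" for f g
  proof (rule ccontr)
    assume "\<not> ?thesis"
    then have n: "f \<notin> P" "g \<notin> P" by auto
    let ?J = "gen (insert f P)"
    have J: "is_ideal polynomial_functions ?J" using fg Pp by (intro gen_ideal) auto
    have "insert f P \<subseteq> ?J" by (rule gen_superset)
    then have "(?J, P) \<in> ?r" "I \<subseteq> ?J" using J Pid n P(1) by auto
    then have "1 \<in> ?J" using P(2) J by blast
    from lin_insert[OF this is_ideal_self[OF polynomial_functions_subring]]
    obtain a y where a: "a \<in> polynomial_functions" "y \<in> gen P" "1 = a * f + y" by blast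
    have y: "y \<in> P" using a(2) gen_of_ideal[OF Pid] by blast
    have "g = g * (a * f + y)" using a(3) by simp
    also have "\<dots> = a * (f * g) + g * y" by (simp only: distrib_left ac_simps)
    also have "\<dots> \<in> P" by (intro idealD(3)[OF Pid] idealD(4)[OF Pid] a y fg)
    finally show False using n by simp
  qed
  then have prime: "is_prime P" unfolding is_prime_def using Pid P(1) pf(2) by blast
  obtain xs :: "'n list" where xs: "set xs = UNIV" "distinct xs" using finite_distinct_list[OF finite_class.finite_UNIV] by blast
  obtain p where p: "\<forall>h\<in>P \<inter> coord_ring xs. h p = 0"
    using prime_zero[OF prime xs(2) coord_ring_const, of 1] P(1) by (auto simp: one_fun_def)
  then have "\<forall>h\<in>I. h p = 0" using P(1) Pp coord_ring_UNIV[OF xs(1)] by blast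
  then show False using no by blast
qed

section \<open>Spanning the tangent spaces by few vector fields\<close>

lemma rows_independent:
  fixes e :: "'n \<Rightarrow> 'k::field^'n"
  assumes "det (\<chi> i. e i) \<noteq> 0"
  shows "inj e" "vec.independent (e ` R)" "vec.dim (e ` R) = card R"
proof -
  let ?A = "\<chi> i. e i"
  show inj: "inj e"
  proof (rule injI, rule ccontr)
    fix i j assume "e i = e j" "i \<noteq> j"
    then have "det ?A = 0" by (intro det_identical_rows[of i j]) (auto simp: row_def)
    then show False using assms by simp
  qed
  have z: "\<And>c i. (\<Sum>i\<in>UNIV. c i *s row i ?A) = 0 \<Longrightarrow> c i = 0"
    using assms unfolding invertible_det_nz[symmetric] invertible_right_inverse matrix_right_invertible_independent_rows
    by blast
  have "vec.independent (range e)"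
  proof (rule vec.independent_if_scalars_zero)
    fix f x assume f: "(\<Sum>x\<in>range e. f x *s x) = 0" and "x \<in> range e"
    then obtain i where i: "x = e i" by blast
    have "(\<Sum>i\<in>UNIV. f (e i) *s row i ?A) = 0"
      using f by (simp add: sum.reindex[OF inj] row_def)
    from z[OF this, of i] show "f x = 0" by (simp add: i)
  qed simp
  then show ind: "vec.independent (e ` R)" by (rule vec.independent_mono) auto
  show "vec.dim (e ` R) = card R"
    using vec.dim_eq_card_independent[OF ind] card_image[OF inj_on_subset[OF inj subset_UNIV], of R] by simp
qed

definition polynomial_map :: "('k::field^'n \<Rightarrow> 'k^'m) \<Rightarrow> bool" where
  "polynomial_map w \<longleftrightarrow> (\<forall>i. (\<lambda>q. w q $ i) \<in> polynomial_functions)"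

text \<open>A maximal independent subfamily of the \<open>y i\<close> at \<open>p\<close>, completed to a matrix that is invertible
  at \<open>p\<close> by constant rows.\<close>

lemma local_frame:
  fixes y :: "'i \<Rightarrow> 'k::field^'n \<Rightarrow> 'k^'n"
  assumes "\<And>i. i \<in> A \<Longrightarrow> polynomial_map (y i)"
  shows "\<exists>M j R. (\<forall>r\<in>R. j r \<in> A \<and> M r = y (j r)) \<and> (\<forall>i. polynomial_map (M i)) \<and>
    det (\<chi> i. M i p) \<noteq> 0 \<and> card R = vec.dim ((\<lambda>i. y i p) ` A)"
proof -
  obtain B where B: "B \<subseteq> (\<lambda>i. y i p) ` A" "vec.independent B" "(\<lambda>i. y i p) ` A \<subseteq> vec.span B"
    "card B = vec.dim ((\<lambda>i. y i p) ` A)"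
    using vec.basis_exists by blast
  obtain e :: "'n \<Rightarrow> 'k^'n" and R where e: "bij_betw e R B" "det (\<chi> i. e i) \<noteq> 0"
    using adapted_rows[OF B(2)] by blast
  have "e r \<in> (\<lambda>i. y i p) ` A" if "r \<in> R" for r using B(1) e(1) that by (auto simp: bij_betw_def)
  then have "\<forall>r\<in>R. \<exists>j\<in>A. e r = y j p" by (metis imageE)
  then obtain j where j: "\<And>r. r \<in> R \<Longrightarrow> j r \<in> A \<and> e r = y (j r) p" by metis
  define M where "M r = (if r \<in> R then y (j r) else (\<lambda>_. e r))" for r
  have "M r p = e r" for r using j by (simp add: M_def)
  moreover have "polynomial_map (M r)" for r
    using assms j by (auto simp: M_def polynomial_map_def intro: polynomial_functions.const)
  moreover have "card R = vec.dim ((\<lambda>i. y i p) ` A)" using bij_betw_same_card[OF e(1)] B(4) by simp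
  ultimately show ?thesis using e(2) j by (intro exI[of _ M] exI[of _ j] exI[of _ R]) (auto simp: M_def)
qed

lemma det_polynomial_map: "(\<And>i. polynomial_map (M i)) \<Longrightarrow> (\<lambda>q. det (\<chi> i. M i q)) \<in> polynomial_functions"
  by (rule det_polynomial) (simp add: polynomial_map_def)

lemma rank_lower_semicontinuous:
  fixes y :: "'i \<Rightarrow> 'k::field^'n \<Rightarrow> 'k^'n"
  assumes "\<And>i. i \<in> A \<Longrightarrow> polynomial_map (y i)"
  shows "\<exists>h\<in>polynomial_functions. h p \<noteq> 0 \<and>
    (\<forall>q. h q \<noteq> 0 \<longrightarrow> vec.dim ((\<lambda>i. y i p) ` A) \<le> vec.dim ((\<lambda>i. y i q) ` A))"
proof -
  obtain M j R where M: "\<forall>r\<in>R. j r \<in> A \<and> M r = y (j r)" "\<forall>i. polynomial_map (M i)"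
    "det (\<chi> i. M i p) \<noteq> 0" "card R = vec.dim ((\<lambda>i. y i p) ` A)"
    using local_frame[where A = A and y = y and p = p] assms by blast
  have "vec.dim ((\<lambda>i. y i p) ` A) \<le> vec.dim ((\<lambda>i. y i q) ` A)" if "det (\<chi> i. M i q) \<noteq> 0" for q
  proof -
    have "(\<lambda>r. M r q) ` R \<subseteq> (\<lambda>i. y i q) ` A" using M(1) by auto
    from vec.dim_subset[OF this] show ?thesis using rows_independent(3)[OF that, of R] M(4) by simp
  qed
  then show ?thesis using M(2,3) det_polynomial_map[of M]
    by (intro bexI[of _ "\<lambda>q. det (\<chi> i. M i q)"]) auto
qed

text \<open>Both inequalities are closed conditions, so these loci are algebraic; every point where
  the fields fail to span lies in the one with \<open>s\<close> equal to the rank there.\<close>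

definition defect :: "('k::alg_closed_field^'n) set \<Rightarrow> (nat \<Rightarrow> 'k^'n \<Rightarrow> 'k^'n) \<Rightarrow> nat \<Rightarrow> nat \<Rightarrow> ('k^'n) set" where
  "defect X y k s = {q \<in> X. vec.dim ((\<lambda>i. y i q) ` {..<k}) \<le> s \<and> s < vec.dim (tangent X q)}"

lemma defect_algebraic:
  assumes X: "algebraic_set X" and y: "\<And>i. i < k \<Longrightarrow> polynomial_map (y i)"
  shows "algebraic_set (defect X y k s)"
proof (rule algebraic_setI, rule ccontr)
  fix p assume *: "\<And>f. f \<in> vanishing (defect X y k s) \<Longrightarrow> f p = 0" "p \<notin> defect X y k s"
  have "\<exists>f\<in>vanishing (defect X y k s). f p \<noteq> 0"
  proof (cases "p \<in> X")
    case False
    then obtain f where "f \<in> vanishing X" "f p \<noteq> 0" using vanishing_separates[OF X] by blast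
    then show ?thesis by (intro bexI[of _ f]) (auto simp: vanishing_def defect_def)
  next
    case True
    then consider "s < vec.dim ((\<lambda>i. y i p) ` {..<k})" | "vec.dim (tangent X p) \<le> s"
      using *(2) by (force simp: defect_def)
    then show ?thesis
    proof cases
      case 1
      obtain h where h: "h \<in> polynomial_functions" "h p \<noteq> 0"
        "\<And>q. h q \<noteq> 0 \<Longrightarrow> vec.dim ((\<lambda>i. y i p) ` {..<k}) \<le> vec.dim ((\<lambda>i. y i q) ` {..<k})"
        using rank_lower_semicontinuous[where A = "{..<k}" and y = y and p = p] y by auto
      have "h \<in> vanishing (defect X y k s)" using h(1,3) 1 by (force simp: vanishing_def defect_def)
      then show ?thesis using h(2) by blast
    next
      case 2
      obtain h where h: "h \<in> polynomial_functions" "h p \<noteq> 0"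
        "\<And>q. q \<in> X \<Longrightarrow> h q \<noteq> 0 \<Longrightarrow> vec.dim (tangent X q) \<le> vec.dim (tangent X p)"
        using tangent_dim_upper_semicontinuous[OF True] by blast
      have "h \<in> vanishing (defect X y k s)" using h(1,3) 2 by (force simp: vanishing_def defect_def)
      then show ?thesis using h(2) by blast
    qed
  qed
  then show False using *(1) by blast
qed

lemma delta_function:
  assumes "finite Q"
  shows "\<exists>d\<in>polynomial_functions. d q = 1 \<and> (\<forall>q'\<in>Q - {q}. d q' = 0)"
proof -
  have "\<forall>q'. \<exists>i. q' \<noteq> q \<longrightarrow> q' $ i \<noteq> q $ i" by (metis vec_eq_iff)
  then obtain i where i: "\<And>q'. q' \<noteq> q \<Longrightarrow> q' $ i q' \<noteq> q $ i q'" by metis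
  define d where "d x = (\<Prod>q'\<in>Q - {q}. (x $ i q' - q' $ i q') * (1 / (q $ i q' - q' $ i q')))" for x
  have "d \<in> polynomial_functions" unfolding d_def
    by (intro pf_prod polynomial_functions.mult polynomial_functions.const shifted_coord)
  moreover have "d q = 1" unfolding d_def
  proof (intro prod.neutral ballI)
    fix q' assume "q' \<in> Q - {q}"
    then have "q' $ i q' \<noteq> q $ i q'" using i by blast
    then show "(q $ i q' - q' $ i q') * (1 / (q $ i q' - q' $ i q')) = 1" by simp
  qed
  moreover have "d q' = 0" if "q' \<in> Q - {q}" for q'
    unfolding d_def using that assms by (intro prod_zero bexI[of _ q']) auto
  ultimately show ?thesis by blast
qed

text \<open>Extensions of the single tangent vectors are glued by polynomials that are 1 at one
  point of \<open>Q\<close> and 0 at the others.\<close>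

lemma interpolating_field:
  fixes X :: "('k::alg_closed_field^'n) set"
  assumes X: "algebraic_set X" "smooth_variety X" and Q: "finite Q" "Q \<subseteq> X"
    and v: "\<And>q. q \<in> Q \<Longrightarrow> v q \<in> tangent X q"
  shows "\<exists>w b. tangent_map X w \<and> b \<in> polynomial_functions \<and>
    (\<forall>q\<in>Q. w q = v q \<and> (v q \<noteq> 0 \<longrightarrow> ddir b q (v q) \<noteq> 0))"
proof -
  have "\<forall>q. \<exists>d\<in>polynomial_functions. d q = 1 \<and> (\<forall>q'\<in>Q - {q}. d q' = 0)"
    using delta_function[OF Q(1)] by blast
  then obtain d where d: "\<And>q. d q \<in> polynomial_functions" "\<And>q. d q q = 1"
    "\<And>q q'. q' \<in> Q \<Longrightarrow> q' \<noteq> q \<Longrightarrow> d q q' = 0" by (metis DiffI singletonD)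
  have "\<forall>q\<in>Q. \<exists>w. tangent_map X w \<and> w q = v q" using tangent_vector_extends[OF X] Q v by blast
  then obtain w where w: "\<And>q. q \<in> Q \<Longrightarrow> tangent_map X (w q) \<and> w q q = v q" by metis
  have "\<forall>q. \<exists>i. v q \<noteq> 0 \<longrightarrow> v q $ i \<noteq> 0" by (metis vec_eq_iff zero_index)
  then obtain i where i: "\<And>q. v q \<noteq> 0 \<Longrightarrow> v q $ i q \<noteq> 0" by metis
  define W where "W x = (\<Sum>q\<in>Q. d q x *s w q x)" for x
  have "tangent_map X W" unfolding tangent_map_def
  proof (intro conjI allI ballI)
    fix l
    have "(\<lambda>x. \<Sum>q\<in>Q. d q x * w q x $ l) \<in> polynomial_functions"
      using w by (intro pf_sum polynomial_functions.mult d) (auto simp: tangent_map_def)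
    then show "(\<lambda>x. W x $ l) \<in> polynomial_functions" by (simp add: W_def)
    show "W x \<in> tangent X x" if "x \<in> X" for x unfolding W_def using w that
      by (intro vec.subspace_sum[OF tangent_subspace] vec.subspace_scale[OF tangent_subspace])
        (auto simp: tangent_map_def)
  qed
  moreover have "W q = v q" if "q \<in> Q" for q
  proof -
    have "W q = (\<Sum>q'\<in>Q. if q' = q then v q else 0)" unfolding W_def
      by (intro sum.cong refl) (use d w that in auto)
    then show ?thesis using Q(1) that by simp
  qed
  moreover define l where "l q = linear_at q (axis (i q) 1)" for q
  \<comment> \<open>Squaring \<open>d q\<close> kills its derivative at the other points of
    \<open>Q\<close>. At \<open>q\<close> itself \<open>l q\<close> vanishes, so only the derivative
    of \<open>l q\<close> survives.\<close>
  define b where "b = (\<Sum>q\<in>Q. (d q * d q) * l q)"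
  have dd: "d q * d q \<in> polynomial_functions" for q by (intro pf(4) d)
  have lp: "l q \<in> polynomial_functions" for q unfolding l_def by (rule linear_at_polynomial)
  have "b \<in> polynomial_functions" unfolding b_def by (intro pf(7) pf(4) dd lp d)
  moreover have "ddir b q (v q) \<noteq> 0" if q: "q \<in> Q" "v q \<noteq> 0" for q
  proof -
    have "ddir b q (v q) = (\<Sum>q'\<in>Q. ddir ((d q' * d q') * l q') q (v q))"
      unfolding b_def by (intro ddir_sum pf(4) d lp)
    also have "\<dots> = (\<Sum>q'\<in>Q. if q' = q then v q $ i q else 0)"
    proof (intro sum.cong refl)
      fix q' assume "q' \<in> Q"
      have "ddir (l q) q (v q) = v q $ i q"
        unfolding ddir_grad[OF lp] by (simp add: l_def dot_def axis_def if_distrib[of "\<lambda>x. x * _"] cong: if_cong)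
      moreover have "l q q = 0" by (simp add: l_def)
      ultimately show "ddir ((d q' * d q') * l q') q (v q) = (if q' = q then v q $ i q else 0)"
        unfolding ddir_times[OF dd lp] ddir_times[OF d(1) d(1)] using d(2)[of q] d(3)[OF q(1), of q'] by auto
    qed
    also have "\<dots> = v q $ i q" using Q(1) q(1) by simp
    finally show ?thesis using i[OF q(2)] by simp
  qed
  ultimately show ?thesis by blast
qed

text \<open>The field \<open>D(b) D\<close>, where \<open>D\<close> is differentiation along
  \<open>w\<close>.\<close>

definition multiple_field :: "('k::alg_closed_field^'n \<Rightarrow> 'k) \<Rightarrow> ('k^'n \<Rightarrow> 'k^'n) \<Rightarrow> 'k^'n \<Rightarrow> 'k^'n" where
  "multiple_field b w q = ddir b q (w q) *s w q"

lemma tangent_map_polynomial: "tangent_map X w \<Longrightarrow> polynomial_map w"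
  by (simp add: tangent_map_def polynomial_map_def)

lemma tangent_map_scale:
  assumes "tangent_map X w" "f \<in> polynomial_functions" shows "tangent_map X (\<lambda>q. f q *s w q)"
  using assms unfolding tangent_map_def vector_smult_component
  by (auto intro!: polynomial_functions.mult vec.subspace_scale[OF tangent_subspace])

lemma tangent_map_multiple_field:
  "tangent_map X w \<Longrightarrow> b \<in> polynomial_functions \<Longrightarrow> tangent_map X (multiple_field b w)"
  unfolding multiple_field_def[abs_def]
  by (rule tangent_map_scale, assumption, rule ddir_polynomial) (simp_all add: tangent_map_def)

text \<open>Each new field lowers the dimension of every defect locus: on a component either the rank is
  generically smaller than \<open>s\<close>, or the new field is independent of the previous ones at some point.\<close>

lemma spanning_fields_step:
  fixes X :: "('k::alg_closed_field^'n) set"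
  assumes X: "algebraic_set X" "smooth_variety X" and dim: "krull_dimension X = enat n"
  shows "\<exists>w b. (\<forall>i<k. tangent_map X (w i) \<and> b i \<in> polynomial_functions) \<and>
    (\<forall>s m. m + k \<ge> n + 1 + s \<longrightarrow>
      \<not> has_chain {Z. irreducible_algebraic_set Z \<and> Z \<subseteq> defect X (\<lambda>i. multiple_field (b i) (w i)) k s} m)"
proof (induction k)
  \<comment> \<open>The invariant says that the defect locus for \<open>k\<close> and
    \<open>s\<close> has dimension at most \<open>n + s - k\<close>; it is empty if this is
    negative.\<close>
  case 0
  have "\<not> has_chain {Z. irreducible_algebraic_set Z \<and> Z \<subseteq> defect X y 0 s} m" if "m \<ge> n + 1 + s" for y s m
  proof
    assume "has_chain {Z. irreducible_algebraic_set Z \<and> Z \<subseteq> defect X y 0 s} m"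
    then have "has_chain {Z. irreducible_algebraic_set Z \<and> Z \<subseteq> X} m"
      unfolding has_chain_def defect_def by blast
    from has_chain_le[OF this] show False using dim that by (simp add: krull_dimension_def)
  qed
  then show ?case by simp
next
  case (Suc k)
  then obtain w b where wb: "\<And>i. i < k \<Longrightarrow> tangent_map X (w i)" "\<And>i. i < k \<Longrightarrow> b i \<in> polynomial_functions"
    and IH: "\<And>s m. m + k \<ge> n + 1 + s \<Longrightarrow>
      \<not> has_chain {Z. irreducible_algebraic_set Z \<and> Z \<subseteq> defect X (\<lambda>i. multiple_field (b i) (w i)) k s} m"
    by blast
  define y where "y = (\<lambda>i. multiple_field (b i) (w i))"
  have yt: "tangent_map X (y i)" if "i < k" for i
    unfolding y_def using wb that by (intro tangent_map_multiple_field)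
  define rk where "rk q = vec.dim ((\<lambda>i. y i q) ` {..<k})" for q
  have "algebraic_set (defect X y k s)" for s
    by (rule defect_algebraic[OF X(1) tangent_map_polynomial[OF yt]])
  from irreducible_decomposition[OF this]
  have "\<forall>s. \<exists>W. finite W \<and> (\<forall>Y\<in>W. irreducible_algebraic_set Y) \<and> defect X y k s = \<Union>W" by blast
  then obtain W where W: "\<And>s. finite (W s)" "\<And>s Y. Y \<in> W s \<Longrightarrow> irreducible_algebraic_set Y"
    "\<And>s. defect X y k s = \<Union>(W s)" by metis
  define pt where "pt s Y = (SOME q. q \<in> Y \<and> rk q = s)" for s and Y :: "('k^'n) set"
  have pt: "pt s Y \<in> Y" "rk (pt s Y) = s" if "\<exists>q\<in>Y. rk q = s" for s Y
    using someI_ex[of "\<lambda>q. q \<in> Y \<and> rk q = s"] that by (auto simp: pt_def)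
  \<comment> \<open>One test point of rank exactly \<open>s\<close> on each component that has one.
    Only \<open>s < n\<close> matters, because \<open>s\<close> is less than the dimension of a
    tangent space.\<close>
  define Q where "Q = (\<Union>s<n. pt s ` {Y \<in> W s. \<exists>q\<in>Y. rk q = s})"
  have Qd: "q \<in> X \<and> rk q < vec.dim (tangent X q)" if q: "q \<in> Q" for q
  proof -
    obtain s Y where sY: "Y \<in> W s" "\<exists>q\<in>Y. rk q = s" "q = pt s Y" using q by (auto simp: Q_def)
    have "q \<in> defect X y k s" using pt[OF sY(2)] W(3) sY by blast
    then show ?thesis using pt[OF sY(2)] sY(3) by (auto simp: defect_def)
  qed
  have "finite Q" unfolding Q_def using W(1) by auto
  have "\<exists>v. v \<in> tangent X q \<and> v \<notin> vec.span ((\<lambda>i. y i q) ` {..<k})" if q: "q \<in> Q" for q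
  proof (rule ccontr)
    assume "\<not> ?thesis"
    then have "tangent X q \<subseteq> vec.span ((\<lambda>i. y i q) ` {..<k})" by blast
    from vec.dim_subset[OF this] show False using Qd[OF q] by (simp add: rk_def)
  qed
  then obtain v where v: "\<And>q. q \<in> Q \<Longrightarrow> v q \<in> tangent X q"
    "\<And>q. q \<in> Q \<Longrightarrow> v q \<notin> vec.span ((\<lambda>i. y i q) ` {..<k})" by metis
  have "Q \<subseteq> X" using Qd by blast
  from interpolating_field[OF X \<open>finite Q\<close> this v(1)]
  obtain w' b' where w': "tangent_map X w'" "b' \<in> polynomial_functions"
    "\<And>q. q \<in> Q \<Longrightarrow> w' q = v q" "\<And>q. q \<in> Q \<Longrightarrow> v q \<noteq> 0 \<Longrightarrow> ddir b' q (v q) \<noteq> 0"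
    by blast
  define y' where "y' i = multiple_field ((b(k := b')) i) ((w(k := w')) i)" for i
  have y': "(\<lambda>i. y' i q) ` {..<Suc k} = insert (multiple_field b' w' q) ((\<lambda>i. y i q) ` {..<k})" for q
    by (auto simp: y'_def y_def lessThan_Suc)
  have rk_mono: "rk q \<le> vec.dim ((\<lambda>i. y' i q) ` {..<Suc k})" for q
    unfolding rk_def y' by (intro vec.dim_subset) blast
  have rk_Q: "vec.dim ((\<lambda>i. y' i q) ` {..<Suc k}) = rk q + 1" if q: "q \<in> Q" for q
  proof -
    have "v q \<noteq> 0" using v(2)[OF q] vec.span_zero by metis
    then have c: "ddir b' q (v q) \<noteq> 0" using w'(4) q by blast
    have "multiple_field b' w' q \<notin> vec.span ((\<lambda>i. y i q) ` {..<k})"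
    proof
      assume "multiple_field b' w' q \<in> vec.span ((\<lambda>i. y i q) ` {..<k})"
      then have "(1 / ddir b' q (v q)) *s multiple_field b' w' q \<in> vec.span ((\<lambda>i. y i q) ` {..<k})"
        by (rule vec.span_scale)
      then show False using v(2)[OF q] c by (simp add: multiple_field_def w'(3)[OF q])
    qed
    then show ?thesis unfolding y' rk_def by (simp add: vec.dim_insert)
  qed
  have "\<not> has_chain {Z. irreducible_algebraic_set Z \<and> Z \<subseteq> defect X y' (Suc k) s} m"
    if m: "m + Suc k \<ge> n + 1 + s" for s m
  proof
    assume "has_chain {Z. irreducible_algebraic_set Z \<and> Z \<subseteq> defect X y' (Suc k) s} m"
    then obtain Z where Z: "\<And>i. i \<le> m \<Longrightarrow> irreducible_algebraic_set (Z i)"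
      "\<And>i. i \<le> m \<Longrightarrow> Z i \<subseteq> defect X y' (Suc k) s" "\<And>i. i < m \<Longrightarrow> Z i \<subset> Z (Suc i)"
      unfolding has_chain_def by blast
    have sub: "defect X y' (Suc k) s \<subseteq> defect X y k s"
      using rk_mono order.trans unfolding defect_def rk_def by blast
    have "Z m \<subseteq> \<Union>(W s)" using Z(2)[of m] sub W(3) by blast
    then obtain V where V: "V \<in> W s" "Z m \<subseteq> V"
      using irreducible_subset_Union[OF Z(1)[of m] W(1)] W(2) irreducible_algebraic_set_def by blast
    have ZV: "Z i \<subseteq> V" if "i \<le> m" for i
      using that by (induction rule: inc_induct) (use V Z(3) in auto)
    have Vd: "V \<subseteq> defect X y k s" using V(1) W(3) by blast
    show False
    proof (cases "\<exists>q\<in>V. rk q = s")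
      case True
      let ?q = "pt s V"
      have qV: "?q \<in> V" "rk ?q = s" using pt[OF True] .
      then have "?q \<in> X" "s < vec.dim (tangent X ?q)" using Vd by (auto simp: defect_def)
      then have "s < n" using tangent_dim_le[OF X(2) dim] by fastforce
      then have "?q \<in> Q" using V(1) True unfolding Q_def by blast
      then have "?q \<notin> defect X y' (Suc k) s" using rk_Q[of ?q] qV by (simp add: defect_def)
      \<comment> \<open>The new field raises the rank at the test point, so the chain ends strictly
        inside \<open>V\<close>. Appending \<open>V\<close> makes it longer by one, which pays for
        the increase of \<open>k\<close>.\<close>
      then have psub: "Z m \<subset> V" using V(2) qV(1) Z(2)[of m] by blast
      have "has_chain {Z. irreducible_algebraic_set Z \<and> Z \<subseteq> defect X y k s} (Suc m)"
        unfolding has_chain_def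
      proof (intro exI[of _ "Z(Suc m := V)"] conjI allI impI)
        show "(Z(Suc m := V)) i \<in> {Z. irreducible_algebraic_set Z \<and> Z \<subseteq> defect X y k s}" if "i \<le> Suc m" for i
          using Z(1)[of i] ZV[of i] Vd W(2)[OF V(1)] that by (cases "i = Suc m") auto
        show "(Z(Suc m := V)) i \<subset> (Z(Suc m := V)) (Suc i)" if "i < Suc m" for i
          using Z(3)[of i] psub that by (cases "i = m") auto
      qed
      then show False using IH[of s "Suc m"] m by (simp add: y_def)
    next
      case False
      have V1: "rk q < s" if "q \<in> V" for q
        using Vd that False by (force simp: defect_def rk_def)
      obtain q where "q \<in> V" using Z(1)[of 0] ZV[of 0] by (auto simp: irreducible_algebraic_set_def)
      then have s: "s \<ge> 1" using V1 by fastforce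
      \<comment> \<open>All of \<open>V\<close> has smaller rank, so the same chain lives in the
        locus for \<open>s - 1\<close>, and the drop in \<open>s\<close> pays for the increase of
        \<open>k\<close>.\<close>
      have "V \<subseteq> defect X y k (s - 1)"
        using Vd V1 s by (fastforce simp: defect_def rk_def)
      then have "has_chain {Z. irreducible_algebraic_set Z \<and> Z \<subseteq> defect X y k (s - 1)} m"
        unfolding has_chain_def using Z(1,3) ZV by (intro exI[of _ Z]) blast
      then show False using IH[of "s - 1" m] m s by (simp add: y_def)
    qed
  qed
  then show ?case using wb w' unfolding y'_def
    by (intro exI[of _ "w(k := w')"] exI[of _ "b(k := b')"]) (auto simp: less_Suc_eq)
qed

text \<open>At a point where spanning fails the rank \<open>s\<close> is at most
  \<open>n - 1\<close>. So \<open>k = 2 * n\<close> meets \<open>k >= n + 1 + s\<close>, which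
  excludes even the chain consisting of that point.\<close>

theorem spanning_fields:
  fixes X :: "('k::alg_closed_field^'n) set"
  assumes X: "algebraic_set X" "smooth_variety X" and dim: "krull_dimension X = enat n"
  shows "\<exists>w b. (\<forall>i<2 * n. tangent_map X (w i) \<and> b i \<in> polynomial_functions) \<and>
    (\<forall>p\<in>X. tangent X p \<subseteq> vec.span ((\<lambda>i. multiple_field (b i) (w i) p) ` {..<2 * n}))"
proof -
  obtain w b where wb: "\<forall>i<2 * n. tangent_map X (w i) \<and> b i \<in> polynomial_functions"
    and nc: "\<And>s m. m + 2 * n \<ge> n + 1 + s \<Longrightarrow>
      \<not> has_chain {Z. irreducible_algebraic_set Z \<and> Z \<subseteq> defect X (\<lambda>i. multiple_field (b i) (w i)) (2 * n) s} m"
    using spanning_fields_step[OF assms, of "2 * n"] by blast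
  have "tangent X p \<subseteq> vec.span ((\<lambda>i. multiple_field (b i) (w i) p) ` {..<2 * n})" if p: "p \<in> X" for p
  proof (rule ccontr)
    let ?S = "(\<lambda>i. multiple_field (b i) (w i) p) ` {..<2 * n}"
    assume n: "\<not> tangent X p \<subseteq> vec.span ?S"
    have "multiple_field (b i) (w i) p \<in> tangent X p" if "i < 2 * n" for i
      using tangent_map_multiple_field[of X "w i" "b i"] wb p that by (auto simp: tangent_map_def)
    then have "?S \<subseteq> tangent X p" by auto
    then have sub: "vec.span ?S \<subseteq> tangent X p" by (rule vec.span_minimal[OF _ tangent_subspace])
    have lt: "vec.dim ?S < vec.dim (tangent X p)"
    proof (rule ccontr)
      assume "\<not> ?thesis"
      then have "vec.span ?S = tangent X p"
        using vec.subspace_dim_equal[OF vec.subspace_span tangent_subspace sub] by simp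
      then show False using n by simp
    qed
    then have "p \<in> defect X (\<lambda>i. multiple_field (b i) (w i)) (2 * n) (vec.dim ?S)"
      using p by (simp add: defect_def)
    then have "has_chain {Z. irreducible_algebraic_set Z \<and>
        Z \<subseteq> defect X (\<lambda>i. multiple_field (b i) (w i)) (2 * n) (vec.dim ?S)} 0"
      unfolding has_chain_def using irreducible_singleton[of p] by (intro exI[of _ "\<lambda>_. {p}"]) auto
    moreover have "0 + 2 * n \<ge> n + 1 + vec.dim ?S"
      using lt tangent_dim_le[OF X(2) dim p] by linarith
    ultimately show False using nc by blast
  qed
  then show ?thesis using wb by blast
qed

section \<open>Vector fields as combinations of a spanning family\<close>

lemma sum_fibres:
  fixes c :: "'r::finite \<Rightarrow> 'k::field" and u :: "nat \<Rightarrow> 'k^'n"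
  assumes "\<And>r. r \<in> R \<Longrightarrow> j r < m"
  shows "(\<Sum>r\<in>R. c r *s u (j r)) = (\<Sum>i<m. (\<Sum>r\<in>R. if j r = i then c r else 0) *s u i)"
proof -
  have "(\<Sum>i<m. (\<Sum>r\<in>R. if j r = i then c r else 0) *s u i) = (\<Sum>r\<in>R. \<Sum>i<m. (if j r = i then c r else 0) *s u i)"
    by (simp add: vec.scale_sum_left sum.swap[of _ R])
  also have "\<dots> = (\<Sum>r\<in>R. c r *s u (j r))"
  proof (intro sum.cong refl)
    fix r assume "r \<in> R"
    have "(\<Sum>i<m. (if j r = i then c r else 0) *s u i) = (\<Sum>i<m. if j r = i then c r *s u i else 0)"
      by (intro sum.cong) auto
    then show "(\<Sum>i<m. (if j r = i then c r else 0) *s u i) = c r *s u (j r)" using assms[OF \<open>r \<in> R\<close>] by simp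
  qed
  finally show ?thesis by simp
qed

text \<open>The tangent dimension cannot rise near \<open>p\<close> and independence persists, so a
  frame chosen at \<open>p\<close> remains a basis of the tangent spaces nearby. Cramer's rule gives
  the coefficients up to a denominator.\<close>

lemma locally_generated:
  fixes X :: "('k::alg_closed_field^'n) set" and y :: "nat \<Rightarrow> 'k^'n \<Rightarrow> 'k^'n"
  assumes p: "p \<in> X" and y: "\<And>i. i < m \<Longrightarrow> tangent_map X (y i)"
    and span: "tangent X p \<subseteq> vec.span ((\<lambda>i. y i p) ` {..<m})" and v: "tangent_map X v"
  shows "\<exists>h g. h \<in> polynomial_functions \<and> h p \<noteq> 0 \<and> (\<forall>i. g i \<in> polynomial_functions) \<and>
    (\<forall>q\<in>X. h q *s v q = (\<Sum>i<m. g i q *s y i q))"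
proof -
  obtain M j R where M: "\<forall>r\<in>R. j r \<in> {..<m} \<and> M r = y (j r)" "\<forall>i. polynomial_map (M i)"
    "det (\<chi> i. M i p) \<noteq> 0" "card R = vec.dim ((\<lambda>i. y i p) ` {..<m})"
    using local_frame[where A = "{..<m}" and y = y and p = p] tangent_map_polynomial[OF y] by blast
  obtain h0 where h0: "h0 \<in> polynomial_functions" "h0 p \<noteq> 0"
    "\<And>q. q \<in> X \<Longrightarrow> h0 q \<noteq> 0 \<Longrightarrow> vec.dim (tangent X q) \<le> vec.dim (tangent X p)"
    using tangent_dim_upper_semicontinuous[OF p] by blast
  have dR: "vec.dim (tangent X p) \<le> card R" using vec.dim_subset[OF span] M(4) by simp
  define A where "A q = (\<chi> i l. M l q $ i)" for q
  define c where "c q = cramer_vec (A q) (v q)" for q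
  \<comment> \<open>Vanishes wherever the frame may fail to be a basis of the tangent space: where
    the dimension may exceed that at \<open>p\<close> (\<open>h0\<close>), or where the frame
    degenerates (\<open>det\<close>).\<close>
  define h1 where "h1 q = h0 q * h0 q * det (A q)" for q
  have Ap: "(\<lambda>q. A q $ i $ l) \<in> polynomial_functions" for i l
    using M(2) by (simp add: A_def polynomial_map_def)
  have cp: "(\<lambda>q. c q $ i) \<in> polynomial_functions" for i
    unfolding c_def using v by (intro cramer_vec_polynomial Ap) (auto simp: tangent_map_def)
  have h1p: "h1 \<in> polynomial_functions" unfolding h1_def
    by (intro polynomial_functions.mult det_polynomial Ap h0)
  define g where "g i q = h1 q * (\<Sum>r\<in>R. if j r = i then c q $ r else 0)" for i q
  have gp: "g i \<in> polynomial_functions" for i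
  proof -
    have "(\<lambda>q. if j r = i then c q $ r else 0) \<in> polynomial_functions" for r
      by (cases "j r = i") (auto intro: cp polynomial_functions.const simp del: zero_fun_eta)
    then show ?thesis unfolding g_def by (intro polynomial_functions.mult h1p pf_sum)
  qed
  have "A q = Finite_Cartesian_Product.transpose (\<chi> i. M i q)" for q
    by (simp add: A_def Finite_Cartesian_Product.transpose_def)
  then have detA: "det (A q) = det (\<chi> i. M i q)" for q by simp
  have Av: "A q *v u = (\<Sum>r\<in>UNIV. u $ r *s M r q)" for q u
    by (simp add: matrix_mult_sum A_def column_def)
  have "(h1 q * det (A q)) *s v q = (\<Sum>i<m. g i q *s y i q)" if q: "q \<in> X" for q
  proof (cases "h1 q = 0")
    case True
    then show ?thesis by (simp add: g_def)
  next
    case False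
    then have nz: "det (\<chi> i. M i q) \<noteq> 0" "h0 q \<noteq> 0" by (auto simp: h1_def detA)
    note ri = rows_independent[OF nz(1)]
    have RT: "(\<lambda>r. M r q) ` R \<subseteq> tangent X q" using M(1) y q by (auto simp: tangent_map_def)
    have "vec.span ((\<lambda>r. M r q) ` R) = tangent X q"
    proof (rule vec.subspace_dim_equal[OF vec.subspace_span tangent_subspace])
      show "vec.span ((\<lambda>r. M r q) ` R) \<subseteq> tangent X q" by (rule vec.span_minimal[OF RT tangent_subspace])
      show "vec.dim (tangent X q) \<le> vec.dim (vec.span ((\<lambda>r. M r q) ` R))"
        using h0(3)[OF q nz(2)] dR ri(3)[of R] by simp
    qed
    moreover have "v q \<in> tangent X q" using v q by (simp add: tangent_map_def)
    ultimately have "v q \<in> vec.span ((\<lambda>r. M r q) ` R)" by simp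
    then obtain a where a: "v q = (\<Sum>x\<in>(\<lambda>r. M r q) ` R. a x *s x)"
      using vec.span_finite[of "(\<lambda>r. M r q) ` R"] by auto
    define b where "b = (\<chi> r. if r \<in> R then a (M r q) else 0)"
    have "v q = (\<Sum>r\<in>R. a (M r q) *s M r q)"
      unfolding a by (simp add: sum.reindex[OF inj_on_subset[OF ri(1) subset_UNIV]])
    also have "\<dots> = (\<Sum>r\<in>UNIV. b $ r *s M r q)"
      by (rule sum.mono_neutral_cong_left) (auto simp: b_def)
    also have "\<dots> = A q *v b"
      by (simp add: Av)
    finally have vb: "v q = A q *v b" .
    have cb: "c q = det (A q) *s b" unfolding c_def vb by (rule cramer_vec_mult)
    have "(h1 q * det (A q)) *s v q = h1 q *s (\<Sum>r\<in>UNIV. c q $ r *s M r q)"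
      unfolding cb vb by (simp add: Av vec.scale_sum_right mult.assoc)
    \<comment> \<open>The constant rows that complete the frame receive coefficient 0, since
      \<open>v q\<close> lies in the span of the rows in \<open>R\<close>.\<close>
    also have "(\<Sum>r\<in>UNIV. c q $ r *s M r q) = (\<Sum>r\<in>R. c q $ r *s M r q)"
      by (rule sum.mono_neutral_right) (auto simp: cb b_def)
    also have "\<dots> = (\<Sum>r\<in>R. c q $ r *s y (j r) q)" using M(1) by (intro sum.cong) auto
    also have "\<dots> = (\<Sum>i<m. (\<Sum>r\<in>R. if j r = i then c q $ r else 0) *s y i q)"
      using M(1) by (intro sum_fibres[where u = "\<lambda>i. y i q" and c = "\<lambda>r. c q $ r"]) auto
    also have "h1 q *s \<dots> = (\<Sum>i<m. g i q *s y i q)"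
      by (simp add: vec.scale_sum_right g_def)
    finally show ?thesis .
  qed
  moreover have "h1 p * det (A p) \<noteq> 0" using h0(2) M(3) by (simp add: h1_def detA)
  moreover have "(\<lambda>q. h1 q * det (A q)) \<in> polynomial_functions"
    by (intro polynomial_functions.mult h1p det_polynomial Ap)
  ultimately show ?thesis using gp by (intro exI[of _ "\<lambda>q. h1 q * det (A q)"] exI[of _ g]) auto
qed

text \<open>The denominators \<open>h\<close> form an ideal. It has no zero on \<open>X\<close> by
  \<open>locally_generated\<close>, and none outside because it contains the ideal of
  \<open>X\<close>; so 1 is a denominator.\<close>

theorem generated:
  fixes X :: "('k::alg_closed_field^'n) set" and y :: "nat \<Rightarrow> 'k^'n \<Rightarrow> 'k^'n"
  assumes X: "algebraic_set X" and y: "\<And>i. i < m \<Longrightarrow> tangent_map X (y i)"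
    and span: "\<And>p. p \<in> X \<Longrightarrow> tangent X p \<subseteq> vec.span ((\<lambda>i. y i p) ` {..<m})" and v: "tangent_map X v"
  shows "\<exists>g. (\<forall>i. g i \<in> polynomial_functions) \<and> (\<forall>q\<in>X. v q = (\<Sum>i<m. g i q *s y i q))"
proof -
  define I where "I = {h \<in> polynomial_functions. \<exists>g. (\<forall>i. g i \<in> polynomial_functions) \<and>
    (\<forall>q\<in>X. h q *s v q = (\<Sum>i<m. g i q *s y i q))}"
  have "is_ideal polynomial_functions I" unfolding is_ideal_def
  proof (intro conjI ballI)
    show "0 \<in> I" unfolding I_def by (auto intro!: pf(1) exI[of _ "\<lambda>_. 0"])
    fix h h' :: "'k^'n \<Rightarrow> 'k" assume "h \<in> I" "h' \<in> I"
    then obtain g g' where g: "h \<in> polynomial_functions" "\<forall>i. g i \<in> polynomial_functions"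
      "\<forall>q\<in>X. h q *s v q = (\<Sum>i<m. g i q *s y i q)"
      and g': "h' \<in> polynomial_functions" "\<forall>i. g' i \<in> polynomial_functions"
      "\<forall>q\<in>X. h' q *s v q = (\<Sum>i<m. g' i q *s y i q)" unfolding I_def by blast
    have "\<forall>q\<in>X. (h + h') q *s v q = (\<Sum>i<m. (g i + g' i) q *s y i q)"
      using g(3) g'(3) by (simp add: vec.scale_left_distrib sum.distrib)
    moreover have "\<forall>i. g i + g' i \<in> polynomial_functions" using g(2) g'(2) pf(6) by blast
    moreover have "h + h' \<in> polynomial_functions" using g(1) g'(1) by (rule pf(6))
    ultimately show "h + h' \<in> I" unfolding I_def
      by (intro CollectI conjI exI[of _ "\<lambda>i. g i + g' i"])
  next
    fix f h :: "'k^'n \<Rightarrow> 'k" assume f: "f \<in> polynomial_functions" and "h \<in> I"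
    then obtain g where g: "h \<in> polynomial_functions" "\<forall>i. g i \<in> polynomial_functions"
      "\<forall>q\<in>X. h q *s v q = (\<Sum>i<m. g i q *s y i q)" unfolding I_def by blast
    have "(f * h) q *s v q = (\<Sum>i<m. (f * g i) q *s y i q)" if "q \<in> X" for q
    proof -
      have "(f * h) q *s v q = f q *s (h q *s v q)" by simp
      also have "h q *s v q = (\<Sum>i<m. g i q *s y i q)" using g(3) that by blast
      finally show ?thesis by (simp add: vec.scale_sum_right)
    qed
    then have "\<forall>q\<in>X. (f * h) q *s v q = (\<Sum>i<m. (f * g i) q *s y i q)" by blast
    moreover have "\<forall>i. f * g i \<in> polynomial_functions" using g(2) f pf(4) by blast
    moreover have "f * h \<in> polynomial_functions" using f g(1) by (rule pf(4))
    ultimately show "f * h \<in> I" unfolding I_def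
      by (intro CollectI conjI exI[of _ "\<lambda>i. f * g i"])
  qed (auto simp: I_def)
  moreover have "\<exists>h\<in>I. h p \<noteq> 0" for p
  proof (cases "p \<in> X")
    case True
    then show ?thesis using locally_generated[OF True y span[OF True] v] unfolding I_def by blast
  next
    case False
    then obtain h where h: "h \<in> vanishing X" "h p \<noteq> 0" using vanishing_separates[OF X] by blast
    have "\<forall>q\<in>X. h q *s v q = (\<Sum>i<m. 0 q *s y i q)" using h(1) by (simp add: vanishing_def)
    moreover have "h \<in> polynomial_functions" using h(1) by (simp add: vanishing_def)
    ultimately have "h \<in> I" unfolding I_def
      by (intro CollectI conjI exI[of _ "\<lambda>_. 0"]) (auto intro: pf(1))
    then show ?thesis using h(2) by blast
  qed
  ultimately have "1 \<in> I" by (rule nullstellensatz)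
  then obtain g where "\<forall>i. g i \<in> polynomial_functions" "\<forall>q\<in>X. 1 q *s v q = (\<Sum>i<m. g i q *s y i q)"
    unfolding I_def by blast
  then show ?thesis by auto
qed

section \<open>Vector fields and their brackets\<close>

text \<open>The value is computed from a chosen representative \<open>lift X f\<close>; when
  \<open>w\<close> is tangent, every other representative gives the same function on
  \<open>X\<close>.\<close>

definition field_of :: "('k::alg_closed_field^'n) set \<Rightarrow> ('k^'n \<Rightarrow> 'k^'n) \<Rightarrow> ('k^'n \<Rightarrow> 'k) \<Rightarrow> 'k^'n \<Rightarrow> 'k" where
  "field_of X w f = (if f \<in> coordinate_ring X then restr X (\<lambda>q. ddir (lift X f) q (w q)) else 0)"

lemma restr_coordinate_ring: "f \<in> polynomial_functions \<Longrightarrow> restr X f \<in> coordinate_ring X"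
  by (simp add: coordinate_ring_restr)

lemma field_of_restr:
  assumes "tangent_map X w" "g \<in> polynomial_functions"
  shows "field_of X w (restr X g) = restr X (\<lambda>q. ddir g q (w q))"
proof -
  note l = lift[OF restr_coordinate_ring[OF assms(2), of X]]
  have "ddir (lift X (restr X g)) q (w q) = ddir g q (w q)" if "q \<in> X" for q
    unfolding ddir_grad[OF l(1)] ddir_grad[OF assms(2)]
    using assms(1) that by (intro dot_grad_cong[OF l(1) assms(2) l(2)]) (simp add: tangent_map_def)
  then show ?thesis using restr_coordinate_ring[OF assms(2), of X] by (auto simp: field_of_def restr_def)
qed

lemma ddir_tangent_polynomial:
  "tangent_map X w \<Longrightarrow> f \<in> polynomial_functions \<Longrightarrow> (\<lambda>q. ddir f q (w q)) \<in> polynomial_functions"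
  by (rule ddir_polynomial) (simp_all add: tangent_map_def)

lemma field_of_vector_field:
  assumes w: "tangent_map X w" shows "field_of X w \<in> vector_fields X"
  unfolding vector_fields_def
proof (intro CollectI conjI ballI allI impI)
  fix f assume f: "f \<in> coordinate_ring X"
  then obtain f' where f': "f' \<in> polynomial_functions" "f = restr X f'" by (auto simp: coordinate_ring_restr)
  show "field_of X w f \<in> coordinate_ring X"
    unfolding f'(2) field_of_restr[OF w f'(1)]
    by (rule restr_coordinate_ring[OF ddir_tangent_polynomial[OF w f'(1)]])
  have sp: "scale_fun c f' \<in> polynomial_functions" for c
    unfolding scale_fun_def by (intro polynomial_functions.mult polynomial_functions.const f')
  have sd: "ddir (scale_fun c f') q u = c * ddir f' q u" for c q u
    unfolding scale_fun_def
    by (subst ddir_mult[OF polynomial_functions.const f'(1)]) (simp add: ddir_const del: zero_fun_eta)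
  show "field_of X w (scale_fun c f) = scale_fun c (field_of X w f)" for c
    unfolding f'(2) restr_scale[symmetric] field_of_restr[OF w sp] field_of_restr[OF w f'(1)] sd
    by (auto simp: restr_def scale_fun_def)
  fix g assume "g \<in> coordinate_ring X"
  then obtain g' where g': "g' \<in> polynomial_functions" "g = restr X g'" by (auto simp: coordinate_ring_restr)
  show "field_of X w (f + g) = field_of X w f + field_of X w g"
    unfolding f'(2) g'(2) restr_add[symmetric] field_of_restr[OF w f'(1)] field_of_restr[OF w g'(1)]
      field_of_restr[OF w pf(6)[OF f'(1) g'(1)]] ddir_plus[OF f'(1) g'(1)]
    by (auto simp: restr_def)
  show "field_of X w (f * g) = f * field_of X w g + g * field_of X w f"
    unfolding f'(2) g'(2) restr_mult[symmetric] field_of_restr[OF w f'(1)] field_of_restr[OF w g'(1)]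
      field_of_restr[OF w pf(4)[OF f'(1) g'(1)]] ddir_times[OF f'(1) g'(1)]
    by (auto simp: restr_def)
qed (simp add: field_of_def)

text \<open>The components of \<open>w\<close> represent the images of the coordinates. Tangency
  holds because elements of the ideal of \<open>X\<close> restrict to 0, which \<open>V\<close>
  sends to 0.\<close>

lemma vector_field_eq_field_of:
  assumes V: "V \<in> vector_fields X"
  shows "\<exists>w. tangent_map X w \<and> V = field_of X w"
proof -
  note d = vector_fieldsD[OF V]
  define w where "w q = (\<chi> i. lift X (V (restr X (coord i))) q)" for q
  have Vc: "V (restr X (coord i)) \<in> coordinate_ring X" for i by (rule vector_fields_closed[OF V])
  have wp: "(\<lambda>q. w q $ i) \<in> polynomial_functions" for i using lift(1)[OF Vc] by (simp add: w_def)
  note cr = restr_coordinate_ring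
  have V1: "V (restr X 1) = 0"
  proof -
    let ?e = "restr X (1 :: 'a^'b \<Rightarrow> 'a)"
    have e: "?e \<in> coordinate_ring X" by (rule cr[OF pf(2)])
    have "?e * V ?e = V ?e"
    proof -
      obtain f where "V ?e = restr X f" using vector_fields_closed[OF V, of ?e] by (auto simp: coordinate_ring_restr)
      then show ?thesis by (auto simp: restr_def fun_eq_iff)
    qed
    moreover have "?e * ?e = ?e" by (auto simp: restr_def fun_eq_iff)
    ultimately have "V ?e = V ?e + V ?e" using d(5)[OF e e] by simp
    then show ?thesis by (simp only: add_cancel_right_right)
  qed
  have Vr: "V (restr X g) = restr X (\<lambda>q. ddir g q (w q))" if "g \<in> polynomial_functions" for g
    using that
  proof induction
    case (const c)
    have "restr X (\<lambda>p. c) = scale_fun c (restr X 1)" by (auto simp: restr_def scale_fun_def)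
    moreover have "V (scale_fun c (restr X 1)) = scale_fun c (V (restr X 1))" by (rule d(4)[OF cr[OF pf(2)]])
    ultimately have "V (restr X (\<lambda>p. c)) = scale_fun c 0" unfolding V1 by metis
    then show ?case by (auto simp: ddir_const restr_def scale_fun_def fun_eq_iff)
  next
    case (coordinate i)
    show ?case unfolding ddir_coord using lift(2)[OF Vc[of i]] by (simp add: w_def)
  next
    case (add f g)
    have "restr X (\<lambda>p. f p + g p) = restr X f + restr X g" by (auto simp: restr_def)
    then have "V (restr X (\<lambda>p. f p + g p)) = V (restr X f) + V (restr X g)" using d(3)[OF cr cr] add by metis
    then show ?case using add by (auto simp: ddir_add restr_def fun_eq_iff)
  next
    case (mult f g)
    have "restr X (\<lambda>p. f p * g p) = restr X f * restr X g" by (auto simp: restr_def)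
    then have "V (restr X (\<lambda>p. f p * g p)) = restr X f * V (restr X g) + restr X g * V (restr X f)"
      using d(5)[OF cr cr] mult by metis
    then show ?case using mult by (auto simp: ddir_mult restr_def fun_eq_iff)
  qed
  have w: "tangent_map X w" unfolding tangent_map_def
  proof (intro conjI allI ballI wp)
    fix q assume q: "q \<in> X"
    show "w q \<in> tangent X q" unfolding tangent_def
    proof (intro CollectI ballI)
      fix f assume f: "f \<in> vanishing X"
      then have fp: "f \<in> polynomial_functions" and "restr X f = 0" by (auto simp: vanishing_def restr_def)
      then have "restr X (\<lambda>q. ddir f q (w q)) = 0" using Vr[OF fp] vector_fields_zero[OF V] by simp
      then have "restr X (\<lambda>q. ddir f q (w q)) q = 0" by simp
      then show "dot (grad f q) (w q) = 0" using q by (simp add: restr_def ddir_grad[OF fp])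
    qed
  qed
  have "V f = field_of X w f" for f
  proof (cases "f \<in> coordinate_ring X")
    case True
    then obtain g where "g \<in> polynomial_functions" "f = restr X g" by (auto simp: coordinate_ring_restr)
    then show ?thesis using Vr field_of_restr[OF w] by simp
  qed (use d(1) in \<open>simp add: field_of_def\<close>)
  then show ?thesis using w by blast
qed

lemma commutator_restr:
  assumes v: "tangent_map X v" and w: "tangent_map X w" and f: "f \<in> polynomial_functions"
  shows "commutator (field_of X v) (field_of X w) (restr X f) =
    restr X (\<lambda>q. ddir (\<lambda>q. ddir f q (w q)) q (v q) - ddir (\<lambda>q. ddir f q (v q)) q (w q))"
  unfolding commutator_def field_of_restr[OF v f] field_of_restr[OF w f]
    field_of_restr[OF v ddir_tangent_polynomial[OF w f]] field_of_restr[OF w ddir_tangent_polynomial[OF v f]]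
  by (auto simp: restr_def)

lemma ddir_scale_right: "f \<in> polynomial_functions \<Longrightarrow> ddir f q (c *s v) = c * ddir f q v"
  by (simp add: ddir_grad dot_scale_right)

text \<open>The identity \<open>2 a D(b) D = [D, a b D] + [a D, b D]\<close>.\<close>

lemma double_as_commutators:
  assumes w: "tangent_map X w" and a: "a \<in> polynomial_functions" and b: "b \<in> polynomial_functions"
    and f: "f \<in> polynomial_functions" and q: "q \<in> X"
  shows "commutator (field_of X w) (field_of X (\<lambda>q. (a q * b q) *s w q)) (restr X f) q
      + commutator (field_of X (\<lambda>q. a q *s w q)) (field_of X (\<lambda>q. b q *s w q)) (restr X f) q
    = 2 * a q * ddir f q (multiple_field b w q)"
proof -
  have ab: "(\<lambda>q. a q * b q) \<in> polynomial_functions" using a b by (rule polynomial_functions.mult)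
  have F: "(\<lambda>q. ddir f q (w q)) \<in> polynomial_functions" by (rule ddir_tangent_polynomial[OF w f])
  note t = tangent_map_scale[OF w]
  note df = ddir_scale_right[OF f]
  \<comment> \<open>The two brackets are \<open>D(a b) D\<close> and
    \<open>(a D(b) - b D(a)) D\<close>: second-order terms cancel, and so do those with
    \<open>D(a)\<close> in the sum.\<close>
  show ?thesis
    unfolding commutator_restr[OF w t[OF ab] f] commutator_restr[OF t[OF a] t[OF b] f] df
      ddir_mult[OF ab F] ddir_mult[OF a F] ddir_mult[OF b F] ddir_scale_right[OF F]
      ddir_scale_right[OF a] ddir_scale_right[OF b] ddir_mult[OF a b] multiple_field_def
    using q by (simp add: restr_def ddir_mult[OF a F] ddir_mult[OF b F] ddir_scale_right[OF F] 
      ddir_scale_right[OF a] ddir_scale_right[OF b] ddir_mult[OF b F] algebra_simps)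
qed

lemma vector_field_sum_of_commutators:
  fixes X :: "('k::alg_closed_field^'n) set"
  assumes char: "CHAR('k) \<noteq> 2" and X: "algebraic_set X" "smooth_variety X"
    and dim: "krull_dimension X = enat n" and V: "V \<in> vector_fields X"
  shows "\<exists>x y. (\<forall>i<4 * n. x i \<in> vector_fields X \<and> y i \<in> vector_fields X) \<and>
    V = (\<Sum>i<4 * n. commutator (x i) (y i))"
proof -
  have "(2::'k) \<noteq> 0"
  proof
    assume "(2::'k) = 0"
    then have "of_nat 2 = (0::'k)" by simp
    then have "CHAR('k) dvd 2" by (simp only: of_nat_eq_0_iff_char_dvd)
    then have "CHAR('k) \<le> 2" by (rule dvd_imp_le) simp
    then show False using char CHAR_not_1' \<open>CHAR('k) dvd 2\<close> by (metis One_nat_def dvd_0_left_iff le_Suc_eq le_zero_eq numeral_2_eq_2 zero_neq_numeral)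
  qed
  obtain w b where wb: "\<And>i. i < 2 * n \<Longrightarrow> tangent_map X (w i)" "\<And>i. i < 2 * n \<Longrightarrow> b i \<in> polynomial_functions"
    and span: "\<And>p. p \<in> X \<Longrightarrow> tangent X p \<subseteq> vec.span ((\<lambda>i. multiple_field (b i) (w i) p) ` {..<2 * n})"
    using spanning_fields[OF X dim] by blast
  obtain v where v: "tangent_map X v" "V = field_of X v" using vector_field_eq_field_of[OF V] by blast
  obtain g where g: "\<And>i. g i \<in> polynomial_functions"
    "\<And>q. q \<in> X \<Longrightarrow> v q = (\<Sum>i<2 * n. g i q *s multiple_field (b i) (w i) q)"
    using generated[OF X(1) tangent_map_multiple_field[OF wb] span v(1)] by blast
  \<comment> \<open>Half the coefficient compensates the factor 2 in
    \<open>double_as_commutators\<close>; this is where the characteristic enters.\<close>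
  define a where "a i q = 1 / 2 * g i q" for i q
  have a: "a i \<in> polynomial_functions" for i unfolding a_def
    by (intro polynomial_functions.mult polynomial_functions.const g)
  \<comment> \<open>Indices below \<open>2 * n\<close> carry the brackets \<open>[D, a b D]\<close>,
    and index \<open>2 * n + i\<close> carries the partner \<open>[a D, b D]\<close> of index
    \<open>i\<close>.\<close>
  define x where "x i = field_of X (if i < 2 * n then w i else (\<lambda>q. a (i - 2 * n) q *s w (i - 2 * n) q))" for i
  define y where "y i = field_of X (if i < 2 * n then (\<lambda>q. (a i q * b i q) *s w i q)
    else (\<lambda>q. b (i - 2 * n) q *s w (i - 2 * n) q))" for i
  have xy: "x i \<in> vector_fields X" "y i \<in> vector_fields X" if "i < 4 * n" for i
    using that wb a unfolding x_def y_def
    by (auto intro!: field_of_vector_field tangent_map_scale polynomial_functions.mult)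
  have split: "(\<Sum>i<4 * n. F i) = (\<Sum>i<2 * n. F i + F (2 * n + i))" for F :: "nat \<Rightarrow> 'k"
  proof -
    have "(\<Sum>i<m + k. F i) = (\<Sum>i<m. F i) + (\<Sum>i<k. F (m + i))" for m k
      by (induction k) (simp_all add: add.assoc)
    from this[of "2 * n" "2 * n"] show ?thesis by (simp add: sum.distrib)
  qed
  have "V f = (\<Sum>i<4 * n. commutator (x i) (y i)) f" for f
  proof (cases "f \<in> coordinate_ring X")
    case True
    then obtain h where h: "h \<in> polynomial_functions" "f = restr X h" by (auto simp: coordinate_ring_restr)
    have "V f q = (\<Sum>i<4 * n. commutator (x i) (y i)) f q" for q
    proof (cases "q \<in> X")
      case q: True
      have "(\<Sum>i<4 * n. commutator (x i) (y i)) f q = (\<Sum>i<4 * n. commutator (x i) (y i) f q)"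
        by (simp add: fun_sum_apply)
      also have "\<dots> = (\<Sum>i<2 * n. commutator (x i) (y i) f q + commutator (x (2 * n + i)) (y (2 * n + i)) f q)"
        by (rule split)
      also have "\<dots> = (\<Sum>i<2 * n. 2 * a i q * ddir h q (multiple_field (b i) (w i) q))"
      proof (intro sum.cong refl)
        fix i assume "i \<in> {..<2 * n}"
        then show "commutator (x i) (y i) f q + commutator (x (2 * n + i)) (y (2 * n + i)) f q
            = 2 * a i q * ddir h q (multiple_field (b i) (w i) q)"
          using double_as_commutators[OF wb(1) a wb(2) h(1) q, of i i i] by (simp add: x_def y_def h(2))
      qed
      also have "\<dots> = (\<Sum>i<2 * n. dot (grad h q) (g i q *s multiple_field (b i) (w i) q))"
        using \<open>(2::'k) \<noteq> 0\<close> by (simp add: a_def dot_scale_right ddir_grad[OF h(1)])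
      also have "\<dots> = dot (grad h q) (v q)"
        unfolding g(2)[OF q]
        by (induction "2 * n" arbitrary: n rule: nat.induct) (auto simp: dot_add_right sum_distrib_left dot_def sum.swap[of _ UNIV])
      also have "\<dots> = V f q" unfolding v(2) h(2) field_of_restr[OF v(1) h(1)] using q
        by (simp add: restr_def ddir_grad[OF h(1)])
      finally show ?thesis by simp
    next
      case False
      have z: "D f q = 0" if "D \<in> vector_fields X" for D
        using vector_fields_closed[OF that, of f] False by (auto simp: coordinate_ring_restr restr_def)
      have "commutator (x i) (y i) f q = 0" if "i < 4 * n" for i
        by (rule z[OF commutator_vector_fields[OF xy[OF that]]])
      then show ?thesis using z[OF V] by (simp add: fun_sum_apply)
    qed
    then show ?thesis by blast
  next
    case False
    have "commutator (x i) (y i) f = 0" if "i < 4 * n" for i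
      by (rule vector_fieldsD(1)[OF commutator_vector_fields[OF xy[OF that]] False])
    then show ?thesis using vector_fieldsD(1)[OF V False] by (simp add: fun_sum_apply)
  qed
  then show ?thesis using xy by blast
qed

theorem theorem1p1:
  fixes X :: "('k::alg_closed_field ^ 'n) set" and n :: nat
  assumes "CHAR('k) \<noteq> 2"
    and "affine_variety X"
    and "smooth_variety X"
    and "krull_dimension X = enat n"
  shows "lie_algebra.bracket_width scale_op (vector_fields X) commutator \<le> enat ((n + 1)\<^sup>2)"
proof -
  interpret L: lie_algebra scale_op "vector_fields X" commutator by (rule lie_algebra_vector_fields)
  have X: "algebraic_set X" using assms(2) by (simp add: affine_variety_def)
  have "4 * n \<le> (n + 1)\<^sup>2"
  proof -
    \<comment> \<open>The difference of the two sides is \<open>(n - 1)\<close> squared, computed in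
      the integers because subtraction of naturals truncates.\<close>
    have "0 \<le> (int n - 1)\<^sup>2" by simp
    then have "4 * int n \<le> (int n + 1)\<^sup>2" by (simp add: power2_eq_square algebra_simps)
    then have "int (4 * n) \<le> int ((n + 1)\<^sup>2)" by (simp add: ac_simps)
    then show ?thesis by (simp only: of_nat_le_iff)
  qed
  moreover have "L.bracket_length z \<le> 4 * n" if "z \<in> L.derived_algebra" for z
  proof -
    have "L.derived_algebra \<subseteq> vector_fields X"
      unfolding L.derived_algebra_def using L.bracket_closed by (intro L.span_minimal L.subspace_L) auto
    then have "z \<in> vector_fields X" using that by blast
    from vector_field_sum_of_commutators[OF assms(1) X assms(3,4) this]
    show ?thesis unfolding L.bracket_length_def by (intro Least_le) blast
  qed
  ultimately show ?thesis unfolding L.bracket_width_def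
    by (intro SUP_least) (meson enat_ord_simps(1) order.trans)
qed

end
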